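(* Let $\mathcal P=[X:\mathcal R]$ be an inverse monoid presentation of an inverse monoid $M$, with associated inverse monoid $\mathcal T=\mathcal T(M,X)$. Then the crossed $\mathcal T$-module $S^{\bowtie}\xrightarrow{\mathbf r}\mathcal T\rightrightarrows E(M)$ is isomorphic to the free crossed $\mathcal T$-module $C\xrightarrow{\partial}\mathcal T\rightrightarrows E(M)$ with basis $\omega:R\to\mathcal T$, where $R=\bigsqcup_{x\in E(\mathcal T)}R_x$, $R_x=\{(l,r,x):(l,r)\in\mathcal R,\ ((l^{-1}r)\rho\tau)\psi\geq x\psi\}$, and $(l,r,x)\omega=x\,((l^{-1}r)\rho\tau)\,x$.
   Context: Maps are written on the right and composed left to right. $E(S)$ is the semilattice of idempotents of an inverse semigroup $S$, and $\leq$ the natural partial order. **Presentation and factorisation.** $A=X\sqcup X^{-1}$, $A^*$ is the free monoid on $A$, with formal inverses $(a_1\cdots a_n)^{-1}=a_n^{-1}\cdots a_1^{-1}$; $\mathcal R\subseteq A^*\times A^*$; $\rho:A^*\to \mathrm{FIM}(X)$ is the canonical map to the free inverse monoid; $M$ is the quotient of $\mathrm{FIM}(X)$ by the congruence generated by the pairs $(l\rho,r\rho)$, $(l,r)\in\mathcal R$, with quotient map $\theta$. Let $\theta_{\min}$ be the congruence on $\mathrm{FIM}(X)$: $a\,\theta_{\min}\,b$ iff there is an idempotent $e$ with $ae=be$ and $(a^{-1}a)\theta=e\theta=(b^{-1}b)\theta$. Put $\mathcal T=\mathrm{FIM}(X)/\theta_{\min}$, with quotient map $\tau$ and induced map $\psi:\mathcal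 T\to M$, so $\theta=\tau\psi$. Here $\tau$ is idempotent pure and $\psi$ is surjective and idempotent separating, so $\psi$ restricts to a bijection $E(\mathcal T)\to E(M)$, by which these sets are identified. **$\mathcal T$ as a groupoid.** $\mathcal T$ is regarded as a groupoid with vertex set $E(\mathcal T)$: $w\in\mathcal T$ is an arrow from $ww^{-1}$ to $w^{-1}w$, and $s\circ t=st$ is defined iff $s^{-1}s=tt^{-1}$. **Crossed modules of groupoids.** For a groupoid $G$ with vertex set $V$, with domain and range maps $\mathbf d,\mathbf r$, a crossed $G$-module $C\xrightarrow{\partial}G\rightrightarrows V$ consists of a disjoint union of groups $C=\bigsqcup_{e\in V}C_e$, a groupoid homomorphism $\partial$ (identity on $V$), and an action of $G$ on $C$ by group isomorphisms, with $c^g\in C_f$ for $c\in C_e$ and $g$ an arrow from $e$ to $f$, such that $(c^g)\partial=g^{-1}(c\partial)g$ and $c^{a\partial}=a^{-1}ca$ for $a,c\in C_e$. A morphism of crossed $G$-modules $\phi:C\to C'$ is a family of group homomorphisms $C_e\to C'_e$ compatible with the $G$-actions and satisfying $\partial=\phi\partial'$. Given a set $R$ and $\omega:R\to G$ with $r\omega\mathbf d=r\omega\mathbf r$ for all $r$, a crossed $G$-module $C$ together with $\nu:R\to C$, $\nu\partial=\omega$, is free with basis $\omega$ if for every crossed $G$-module $C'\xrightarrow{\partial'}G$ and function $\sigma:R\to C'$ with $\sigma\partial'=\omega$ there is a unique morphism $\phi:C\to C'$ of crossed $G$-modules with $\nu\phi=\sigma$. Such a free crossed module exists and is unique up to isomorphism.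 (For the $\omega$ of the claim, $(l,r,x)\omega\mathbf d=(l,r,x)\omega\mathbf r$.) **Squier complex.** $\mathrm{Sq}(\mathcal P)$ is the $2$-complex with vertex set $\mathcal T$; an edge $(p,l,r,q)$ for all $p,q\in\mathcal T$, $(l,r)\in\mathcal R$, from $p(l\rho\tau)q$ to $p(r\rho\tau)q$; and, for all $p,q,p',q'\in\mathcal T$ and $(l,r),(l',r')\in\mathcal R$, a $2$-cell making the paths $(p,l,r,qp'(l'\rho\tau)q')\circ(p(r\rho\tau)qp',l',r',q')$ and $(p(l\rho\tau)qp',l',r',q')\circ(p,l,r,qp'(r'\rho\tau)q')$ homotopic. Let $\pi=\pi(\mathrm{Sq}(\mathcal P),\mathcal T)$ be its fundamental groupoid on the vertex set $\mathcal T$, with domain and range maps $\mathbf d,\mathbf r$ and composition $\circ$. $\mathcal T$ acts on both sides of $\pi$ by the actions induced from $t\rhd(p,l,r,q)=(tp,l,r,q)$ and $(p,l,r,q)\lhd t=(p,l,r,qt)$. Put $\alpha\ast\beta=(\alpha\lhd\beta\mathbf d)\circ(\alpha\mathbf r\rhd\beta)$. **The crossed module $S^{\bowtie}$.** For $e\in E(\mathcal T)$ let $\mathrm{star}_e^{\bowtie}=\{e\rhd\alpha\lhd e:\alpha\in\pi,\ \alpha\mathbf d=e\}$, a group under $\ast$ with identity $1_e$. Put $S^{\bowtie}=\bigsqcup_{e\in E(\mathcal T)}\mathrm{star}_e^{\bowtie}$, with the map $\mathbf r:S^{\bowtie}\to\mathcal T$ given by the range, and with $\mathcal T$-action $\alpha^w=w^{-1}\rhd\alpha\lhd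 w\in\mathrm{star}^{\bowtie}_{w^{-1}w}$ for $w\in\mathcal T$, $\alpha\in\mathrm{star}^{\bowtie}_{ww^{-1}}$. *)

theory Defs
  imports "HOL-Algebra.Group"
begin

section \<open>Inverse monoids\<close>

text \<open>Inverse monoids are \<^typ>\<open>'a monoid\<close> structures of HOL-Algebra. The HOL-Algebra inverse is the
  inverse of a unit, so the semigroup inverse gets its own constant.\<close>

definition sinv :: "('a, 'b) monoid_scheme \<Rightarrow> 'a \<Rightarrow> 'a" where
  "sinv S a = (THE b. b \<in> carrier S \<and> a \<otimes>\<^bsub>S\<^esub> b \<otimes>\<^bsub>S\<^esub> a = a \<and> b \<otimes>\<^bsub>S\<^esub> a \<otimes>\<^bsub>S\<^esub> b = b)"

definition idems :: "('a, 'b) monoid_scheme \<Rightarrow> 'a set" where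
  "idems S = {e \<in> carrier S. e \<otimes>\<^bsub>S\<^esub> e = e}"

definition nat_le :: "('a, 'b) monoid_scheme \<Rightarrow> 'a \<Rightarrow> 'a \<Rightarrow> bool" where
  "nat_le S a b \<longleftrightarrow> (\<exists>e \<in> idems S. a = e \<otimes>\<^bsub>S\<^esub> b)"

definition monoid_congruence :: "('a, 'b) monoid_scheme \<Rightarrow> ('a \<times> 'a) set \<Rightarrow> bool" where
  "monoid_congruence S \<kappa> \<longleftrightarrow> equiv (carrier S) \<kappa> \<and>
     (\<forall>a b c d. (a, b) \<in> \<kappa> \<longrightarrow> (c, d) \<in> \<kappa> \<longrightarrow> (a \<otimes>\<^bsub>S\<^esub> c, b \<otimes>\<^bsub>S\<^esub> d) \<in> \<kappa>)"

definition generated_congruence ::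
  "('a, 'b) monoid_scheme \<Rightarrow> ('a \<times> 'a) set \<Rightarrow> ('a \<times> 'a) set" where
  "generated_congruence S P = \<Inter> {\<kappa>. monoid_congruence S \<kappa> \<and> P \<subseteq> \<kappa>}"

definition quotient_monoid ::
  "('a, 'b) monoid_scheme \<Rightarrow> ('a \<times> 'a) set \<Rightarrow> 'a set monoid" where
  "quotient_monoid S \<kappa> =
     \<lparr>carrier = carrier S // \<kappa>,
      monoid.mult = (\<lambda>U V. \<Union>a\<in>U. \<Union>b\<in>V. \<kappa> `` {a \<otimes>\<^bsub>S\<^esub> b}),
      one = \<kappa> `` {\<one>\<^bsub>S\<^esub>}\<rparr>"

section \<open>The free inverse monoid\<close>

text \<open>Words over $X \sqcup X^{-1}$: \<^term>\<open>Inl x\<close> is the letter $x$ and \<^term>\<open>Inr x\<close> is $x^{-1}$.\<close>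

type_synonym 'x word = "('x + 'x) list"

definition words :: "'x set \<Rightarrow> 'x word set" where
  "words X = lists (X <+> X)"

definition word_inv :: "'x word \<Rightarrow> 'x word" where
  "word_inv w = rev (map (case_sum Inr Inl) w)"

definition free_monoid :: "'x set \<Rightarrow> 'x word monoid" where
  "free_monoid X = \<lparr>carrier = words X, monoid.mult = (@), one = []\<rparr>"

definition vagner :: "'x set \<Rightarrow> ('x word \<times> 'x word) set" where
  "vagner X = generated_congruence (free_monoid X)
     ({(w @ word_inv w @ w, w) | w. w \<in> words X} \<union>
      {(u @ word_inv u @ v @ word_inv v, v @ word_inv v @ u @ word_inv u) | u v.
         u \<in> words X \<and> v \<in> words X})"

definition FIM :: "'x set \<Rightarrow> 'x word set monoid" where
  "FIM X = quotient_monoid (free_monoid X) (vagner X)"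

definition rho :: "'x set \<Rightarrow> 'x word \<Rightarrow> 'x word set" where
  "rho X w = vagner X `` {w}"

section \<open>The monoids $M$ and $\mathcal T$ of a presentation\<close>

definition theta_cong ::
  "'x set \<Rightarrow> ('x word \<times> 'x word) set \<Rightarrow> ('x word set \<times> 'x word set) set" where
  "theta_cong X \<R> = generated_congruence (FIM X) {(rho X l, rho X r) | l r. (l, r) \<in> \<R>}"

definition theta ::
  "'x set \<Rightarrow> ('x word \<times> 'x word) set \<Rightarrow> 'x word set \<Rightarrow> 'x word set set" where
  "theta X \<R> a = theta_cong X \<R> `` {a}"

definition M_of :: "'x set \<Rightarrow> ('x word \<times> 'x word) set \<Rightarrow> 'x word set set monoid" where
  "M_of X \<R> = quotient_monoid (FIM X) (theta_cong X \<R>)"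

definition theta_min ::
  "'x set \<Rightarrow> ('x word \<times> 'x word) set \<Rightarrow> ('x word set \<times> 'x word set) set" where
  "theta_min X \<R> = {(a, b). a \<in> carrier (FIM X) \<and> b \<in> carrier (FIM X) \<and>
     (\<exists>e \<in> idems (FIM X). a \<otimes>\<^bsub>FIM X\<^esub> e = b \<otimes>\<^bsub>FIM X\<^esub> e \<and>
        theta X \<R> (sinv (FIM X) a \<otimes>\<^bsub>FIM X\<^esub> a) = theta X \<R> e \<and>
        theta X \<R> e = theta X \<R> (sinv (FIM X) b \<otimes>\<^bsub>FIM X\<^esub> b))}"

type_synonym 'x T_elt = "'x word set set"

definition T_of :: "'x set \<Rightarrow> ('x word \<times> 'x word) set \<Rightarrow> 'x T_elt monoid" where
  "T_of X \<R> = quotient_monoid (FIM X) (theta_min X \<R>)"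

definition tau ::
  "'x set \<Rightarrow> ('x word \<times> 'x word) set \<Rightarrow> 'x word set \<Rightarrow> 'x T_elt" where
  "tau X \<R> a = theta_min X \<R> `` {a}"

definition psi ::
  "'x set \<Rightarrow> ('x word \<times> 'x word) set \<Rightarrow> 'x T_elt \<Rightarrow> 'x word set set" where
  "psi X \<R> t = (THE m. \<exists>a \<in> carrier (FIM X). tau X \<R> a = t \<and> theta X \<R> a = m)"

definition T_word ::
  "'x set \<Rightarrow> ('x word \<times> 'x word) set \<Rightarrow> 'x word \<Rightarrow> 'x T_elt" where
  "T_word X \<R> w = tau X \<R> (rho X w)"

section \<open>Groupoids and crossed modules\<close>

text \<open>Composition is written left to right.\<close>

record ('v, 'g) groupoid_data =
  objs :: "'v set"
  arrs :: "'g set"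
  gdom :: "'g \<Rightarrow> 'v"
  gran :: "'g \<Rightarrow> 'v"
  gcomp :: "'g \<Rightarrow> 'g \<Rightarrow> 'g"
  gid :: "'v \<Rightarrow> 'g"
  ginv :: "'g \<Rightarrow> 'g"

locale groupoid =
  fixes G :: "('v, 'g) groupoid_data"
  assumes dom_in: "g \<in> arrs G \<Longrightarrow> gdom G g \<in> objs G"
    and ran_in: "g \<in> arrs G \<Longrightarrow> gran G g \<in> objs G"
    and comp_in: "\<lbrakk>g \<in> arrs G; h \<in> arrs G; gran G g = gdom G h\<rbrakk> \<Longrightarrow>
        gcomp G g h \<in> arrs G \<and> gdom G (gcomp G g h) = gdom G g \<and> gran G (gcomp G g h) = gran G h"
    and comp_assoc: "\<lbrakk>g \<in> arrs G; h \<in> arrs G; k \<in> arrs G; gran G g = gdom G h; gran G h = gdom G k\<rbrakk> \<Longrightarrow>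
        gcomp G (gcomp G g h) k = gcomp G g (gcomp G h k)"
    and id_in: "e \<in> objs G \<Longrightarrow> gid G e \<in> arrs G \<and> gdom G (gid G e) = e \<and> gran G (gid G e) = e"
    and id_comp: "g \<in> arrs G \<Longrightarrow> gcomp G (gid G (gdom G g)) g = g"
    and comp_id: "g \<in> arrs G \<Longrightarrow> gcomp G g (gid G (gran G g)) = g"
    and inv_in: "g \<in> arrs G \<Longrightarrow>
        ginv G g \<in> arrs G \<and> gdom G (ginv G g) = gran G g \<and> gran G (ginv G g) = gdom G g"
    and inv_left: "g \<in> arrs G \<Longrightarrow> gcomp G (ginv G g) g = gid G (gran G g)"
    and inv_right: "g \<in> arrs G \<Longrightarrow> gcomp G g (ginv G g) = gid G (gdom G g)"

record ('v, 'g, 'c) xmod_data =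
  fib :: "'v \<Rightarrow> 'c monoid"
  bd :: "'c \<Rightarrow> 'g"
  act :: "'c \<Rightarrow> 'g \<Rightarrow> 'c"

definition total_set :: "('v, 'g) groupoid_data \<Rightarrow> ('v, 'g, 'c) xmod_data \<Rightarrow> 'c set" where
  "total_set G C = (\<Union>e \<in> objs G. carrier (fib C e))"

locale crossed_module = groupoid G
  for G :: "('v, 'g) groupoid_data" +
  fixes C :: "('v, 'g, 'c) xmod_data"
  assumes fib_group: "e \<in> objs G \<Longrightarrow> group (fib C e)"
    and fib_disjoint: "\<lbrakk>e \<in> objs G; f \<in> objs G; e \<noteq> f\<rbrakk> \<Longrightarrow>
        carrier (fib C e) \<inter> carrier (fib C f) = {}"
    and bd_in: "\<lbrakk>e \<in> objs G; c \<in> carrier (fib C e)\<rbrakk> \<Longrightarrow>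
        bd C c \<in> arrs G \<and> gdom G (bd C c) = e \<and> gran G (bd C c) = e"
    and bd_mult: "\<lbrakk>e \<in> objs G; a \<in> carrier (fib C e); c \<in> carrier (fib C e)\<rbrakk> \<Longrightarrow>
        bd C (a \<otimes>\<^bsub>fib C e\<^esub> c) = gcomp G (bd C a) (bd C c)"
    and act_iso: "g \<in> arrs G \<Longrightarrow>
        (\<lambda>c. act C c g) \<in> iso (fib C (gdom G g)) (fib C (gran G g))"
    and act_id: "\<lbrakk>e \<in> objs G; c \<in> carrier (fib C e)\<rbrakk> \<Longrightarrow> act C c (gid G e) = c"
    and act_comp: "\<lbrakk>g \<in> arrs G; h \<in> arrs G; gran G g = gdom G h; c \<in> carrier (fib C (gdom G g))\<rbrakk> \<Longrightarrow>
        act C c (gcomp G g h) = act C (act C c g) h"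
    and bd_act: "\<lbrakk>g \<in> arrs G; c \<in> carrier (fib C (gdom G g))\<rbrakk> \<Longrightarrow>
        bd C (act C c g) = gcomp G (gcomp G (ginv G g) (bd C c)) g"
    and peiffer: "\<lbrakk>e \<in> objs G; a \<in> carrier (fib C e); c \<in> carrier (fib C e)\<rbrakk> \<Longrightarrow>
        act C c (bd C a) = inv\<^bsub>fib C e\<^esub> a \<otimes>\<^bsub>fib C e\<^esub> c \<otimes>\<^bsub>fib C e\<^esub> a"

text \<open>Fibres are disjoint, so a family of maps between fibres is a single function.\<close>

definition xmod_morphism ::
  "('v, 'g) groupoid_data \<Rightarrow> ('v, 'g, 'c) xmod_data \<Rightarrow> ('v, 'g, 'd) xmod_data \<Rightarrow> ('c \<Rightarrow> 'd) \<Rightarrow> bool"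
  where
  "xmod_morphism G C D \<phi> \<longleftrightarrow>
     (\<forall>e \<in> objs G. \<phi> \<in> hom (fib C e) (fib D e)) \<and>
     (\<forall>g \<in> arrs G. \<forall>c \<in> carrier (fib C (gdom G g)). \<phi> (act C c g) = act D (\<phi> c) g) \<and>
     (\<forall>c \<in> total_set G C. bd C c = bd D (\<phi> c))"

definition xmod_isomorphic ::
  "('v, 'g) groupoid_data \<Rightarrow> ('v, 'g, 'c) xmod_data \<Rightarrow> ('v, 'g, 'd) xmod_data \<Rightarrow> bool" where
  "xmod_isomorphic G C D \<longleftrightarrow>
     (\<exists>\<phi>. xmod_morphism G C D \<phi> \<and>
        (\<forall>e \<in> objs G. bij_betw \<phi> (carrier (fib C e)) (carrier (fib D e))))"

text \<open>HOL cannot quantify over types inside a formula, so the type \<^typ>\<open>'d\<close> of the elements of the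
  test crossed modules is a parameter of the universal property; freeness in the usual sense is the
  conjunction over all \<^typ>\<open>'d\<close>. That \<open>\<omega>\<close> takes values in loops follows from \<open>bd C (\<nu> s) = \<omega> s\<close>.\<close>

definition free_crossed_module ::
  "'d itself \<Rightarrow> ('v, 'g) groupoid_data \<Rightarrow> 's set \<Rightarrow> ('s \<Rightarrow> 'g) \<Rightarrow>
   ('v, 'g, 'c) xmod_data \<Rightarrow> ('s \<Rightarrow> 'c) \<Rightarrow> bool" where
  "free_crossed_module _ G S \<omega> C \<nu> \<longleftrightarrow>
     crossed_module G C \<and>
     (\<forall>s \<in> S. \<nu> s \<in> total_set G C \<and> bd C (\<nu> s) = \<omega> s) \<and>
     (\<forall>(D :: ('v, 'g, 'd) xmod_data) \<sigma>.
        crossed_module G D \<longrightarrow>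
        (\<forall>s \<in> S. \<sigma> s \<in> total_set G D \<and> bd D (\<sigma> s) = \<omega> s) \<longrightarrow>
        (\<exists>\<phi>. xmod_morphism G C D \<phi> \<and> (\<forall>s \<in> S. \<phi> (\<nu> s) = \<sigma> s) \<and>
           (\<forall>\<phi>'. xmod_morphism G C D \<phi>' \<and> (\<forall>s \<in> S. \<phi>' (\<nu> s) = \<sigma> s) \<longrightarrow>
              (\<forall>c \<in> total_set G C. \<phi>' c = \<phi> c))))"

section \<open>The fundamental groupoid of a 2-complex\<close>

text \<open>A signed edge \<open>(e, True)\<close> is traversed forwards and \<open>(e, False)\<close> backwards. A path is a start
  vertex with a list of signed edges. A 2-cell \<open>(u, c, c')\<close> is spanned by the two parallel paths
  \<open>c\<close> and \<open>c'\<close> starting at \<open>u\<close>.\<close>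

record ('v, 'e) complex2 =
  verts :: "'v set"
  edges :: "'e set"
  src :: "'e \<Rightarrow> 'v"
  tgt :: "'e \<Rightarrow> 'v"
  cells :: "('v \<times> ('e \<times> bool) list \<times> ('e \<times> bool) list) set"

type_synonym ('v, 'e) path = "'v \<times> ('e \<times> bool) list"

fun path_from_to ::
  "('v, 'e) complex2 \<Rightarrow> 'v \<Rightarrow> ('e \<times> bool) list \<Rightarrow> 'v \<Rightarrow> bool" where
  "path_from_to K u [] v \<longleftrightarrow> u \<in> verts K \<and> u = v"
| "path_from_to K u ((e, s) # p) v \<longleftrightarrow>
     e \<in> edges K \<and> u = (if s then src K e else tgt K e) \<and>
     path_from_to K (if s then tgt K e else src K e) p v"

definition paths :: "('v, 'e) complex2 \<Rightarrow> ('v, 'e) path set" where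
  "paths K = {(u, p). \<exists>v. path_from_to K u p v}"

inductive_set homotopy :: "('v, 'e) complex2 \<Rightarrow> (('v, 'e) path \<times> ('v, 'e) path) set"
  for K :: "('v, 'e) complex2" where
  refl: "x \<in> paths K \<Longrightarrow> (x, x) \<in> homotopy K"
| sym: "(x, y) \<in> homotopy K \<Longrightarrow> (y, x) \<in> homotopy K"
| trans: "\<lbrakk>(x, y) \<in> homotopy K; (y, z) \<in> homotopy K\<rbrakk> \<Longrightarrow> (x, z) \<in> homotopy K"
| cancel: "\<lbrakk>path_from_to K u a v; path_from_to K v [(e, s)] w; path_from_to K v b z\<rbrakk> \<Longrightarrow>
     ((u, a @ (e, s) # (e, \<not> s) # b), (u, a @ b)) \<in> homotopy K"
| cell: "\<lbrakk>(v, c, c') \<in> cells K; path_from_to K u a v; path_from_to K v c w;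
      path_from_to K v c' w; path_from_to K w b z\<rbrakk> \<Longrightarrow>
     ((u, a @ c @ b), (u, a @ c' @ b)) \<in> homotopy K"

definition fundamental_groupoid ::
  "('v, 'e) complex2 \<Rightarrow> ('v, ('v, 'e) path set) groupoid_data" where
  "fundamental_groupoid K =
     \<lparr>objs = verts K,
      arrs = paths K // homotopy K,
      gdom = (\<lambda>\<alpha>. THE u. \<exists>p. (u, p) \<in> \<alpha>),
      gran = (\<lambda>\<alpha>. THE v. \<exists>u p. (u, p) \<in> \<alpha> \<and> path_from_to K u p v),
      gcomp = (\<lambda>\<alpha> \<beta>. homotopy K ``
        {(u, p @ q) | u p v q. (u, p) \<in> \<alpha> \<and> path_from_to K u p v \<and> (v, q) \<in> \<beta>}),
      gid = (\<lambda>u. homotopy K `` {(u, [])}),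
      ginv = (\<lambda>\<alpha>. homotopy K ``
        {(v, rev (map (\<lambda>(e, s). (e, \<not> s)) p)) | u p v. (u, p) \<in> \<alpha> \<and> path_from_to K u p v})\<rparr>"

section \<open>The Squier complex\<close>

type_synonym 'x sq_edge = "'x T_elt \<times> 'x word \<times> 'x word \<times> 'x T_elt"
type_synonym 'x sq_arr = "('x T_elt, 'x sq_edge) path set"

definition Squier ::
  "'x set \<Rightarrow> ('x word \<times> 'x word) set \<Rightarrow> ('x T_elt, 'x sq_edge) complex2" where
  "Squier X \<R> = (let T = T_of X \<R>; t = T_word X \<R> in
     \<lparr>verts = carrier T,
      edges = {(p, l, r, q). p \<in> carrier T \<and> (l, r) \<in> \<R> \<and> q \<in> carrier T},
      src = (\<lambda>(p, l, r, q). p \<otimes>\<^bsub>T\<^esub> t l \<otimes>\<^bsub>T\<^esub> q),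
      tgt = (\<lambda>(p, l, r, q). p \<otimes>\<^bsub>T\<^esub> t r \<otimes>\<^bsub>T\<^esub> q),
      cells =
        {(p \<otimes>\<^bsub>T\<^esub> t l \<otimes>\<^bsub>T\<^esub> q \<otimes>\<^bsub>T\<^esub> p' \<otimes>\<^bsub>T\<^esub> t l' \<otimes>\<^bsub>T\<^esub> q',
          [((p, l, r, q \<otimes>\<^bsub>T\<^esub> p' \<otimes>\<^bsub>T\<^esub> t l' \<otimes>\<^bsub>T\<^esub> q'), True),
           ((p \<otimes>\<^bsub>T\<^esub> t r \<otimes>\<^bsub>T\<^esub> q \<otimes>\<^bsub>T\<^esub> p', l', r', q'), True)],
          [((p \<otimes>\<^bsub>T\<^esub> t l \<otimes>\<^bsub>T\<^esub> q \<otimes>\<^bsub>T\<^esub> p', l', r', q'), True),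
           ((p, l, r, q \<otimes>\<^bsub>T\<^esub> p' \<otimes>\<^bsub>T\<^esub> t r' \<otimes>\<^bsub>T\<^esub> q'), True)])
         | p l r q p' l' r' q'.
           p \<in> carrier T \<and> q \<in> carrier T \<and> p' \<in> carrier T \<and> q' \<in> carrier T \<and>
           (l, r) \<in> \<R> \<and> (l', r') \<in> \<R>}\<rparr>)"

definition Sq_pi ::
  "'x set \<Rightarrow> ('x word \<times> 'x word) set \<Rightarrow> ('x T_elt, 'x sq_arr) groupoid_data" where
  "Sq_pi X \<R> = fundamental_groupoid (Squier X \<R>)"

definition lact ::
  "'x set \<Rightarrow> ('x word \<times> 'x word) set \<Rightarrow> 'x T_elt \<Rightarrow> 'x sq_arr \<Rightarrow> 'x sq_arr" where
  "lact X \<R> t \<alpha> = homotopy (Squier X \<R>) ``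
     ((\<lambda>(u, p). (t \<otimes>\<^bsub>T_of X \<R>\<^esub> u,
         map (\<lambda>((a, l, r, b), s). ((t \<otimes>\<^bsub>T_of X \<R>\<^esub> a, l, r, b), s)) p)) ` \<alpha>)"

definition ract ::
  "'x set \<Rightarrow> ('x word \<times> 'x word) set \<Rightarrow> 'x sq_arr \<Rightarrow> 'x T_elt \<Rightarrow> 'x sq_arr" where
  "ract X \<R> \<alpha> t = homotopy (Squier X \<R>) ``
     ((\<lambda>(u, p). (u \<otimes>\<^bsub>T_of X \<R>\<^esub> t,
         map (\<lambda>((a, l, r, b), s). ((a, l, r, b \<otimes>\<^bsub>T_of X \<R>\<^esub> t), s)) p)) ` \<alpha>)"

definition ast ::
  "'x set \<Rightarrow> ('x word \<times> 'x word) set \<Rightarrow> 'x sq_arr \<Rightarrow> 'x sq_arr \<Rightarrow> 'x sq_arr" where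
  "ast X \<R> \<alpha> \<beta> = gcomp (Sq_pi X \<R>)
     (ract X \<R> \<alpha> (gdom (Sq_pi X \<R>) \<beta>)) (lact X \<R> (gran (Sq_pi X \<R>) \<alpha>) \<beta>)"

section \<open>The two crossed modules\<close>

text \<open>The vertex set is $E(\mathcal T)$, identified with $E(M)$ along \<open>psi\<close>.\<close>

definition T_groupoid ::
  "'x set \<Rightarrow> ('x word \<times> 'x word) set \<Rightarrow> ('x T_elt, 'x T_elt) groupoid_data" where
  "T_groupoid X \<R> = (let T = T_of X \<R> in
     \<lparr>objs = idems T,
      arrs = carrier T,
      gdom = (\<lambda>w. w \<otimes>\<^bsub>T\<^esub> sinv T w),
      gran = (\<lambda>w. sinv T w \<otimes>\<^bsub>T\<^esub> w),
      gcomp = (\<lambda>s t. s \<otimes>\<^bsub>T\<^esub> t),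
      gid = (\<lambda>e. e),
      ginv = sinv T\<rparr>)"

definition star_bowtie ::
  "'x set \<Rightarrow> ('x word \<times> 'x word) set \<Rightarrow> 'x T_elt \<Rightarrow> 'x sq_arr set" where
  "star_bowtie X \<R> e =
     {ract X \<R> (lact X \<R> e \<alpha>) e | \<alpha>. \<alpha> \<in> arrs (Sq_pi X \<R>) \<and> gdom (Sq_pi X \<R>) \<alpha> = e}"

definition S_bowtie ::
  "'x set \<Rightarrow> ('x word \<times> 'x word) set \<Rightarrow> ('x T_elt, 'x T_elt, 'x sq_arr) xmod_data" where
  "S_bowtie X \<R> =
     \<lparr>fib = (\<lambda>e. \<lparr>carrier = star_bowtie X \<R> e, monoid.mult = ast X \<R>, one = gid (Sq_pi X \<R>) e\<rparr>),
      bd = gran (Sq_pi X \<R>),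
      act = (\<lambda>\<alpha> w. ract X \<R> (lact X \<R> (sinv (T_of X \<R>) w) \<alpha>) w)\<rparr>"

definition basis_set ::
  "'x set \<Rightarrow> ('x word \<times> 'x word) set \<Rightarrow> ('x word \<times> 'x word \<times> 'x T_elt) set" where
  "basis_set X \<R> = {(l, r, x). (l, r) \<in> \<R> \<and> x \<in> idems (T_of X \<R>) \<and>
     nat_le (M_of X \<R>) (psi X \<R> x) (psi X \<R> (T_word X \<R> (word_inv l @ r)))}"

definition basis_map ::
  "'x set \<Rightarrow> ('x word \<times> 'x word) set \<Rightarrow> 'x word \<times> 'x word \<times> 'x T_elt \<Rightarrow> 'x T_elt" where
  "basis_map X \<R> = (\<lambda>(l, r, x).
     x \<otimes>\<^bsub>T_of X \<R>\<^esub> T_word X \<R> (word_inv l @ r) \<otimes>\<^bsub>T_of X \<R>\<^esub> x)"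

end

theory Submission
  imports Defs
begin

text \<open>The translate \<open>s\<^sup>\<star> \<rhd> \<epsilon>\<close> of a forward edge \<open>\<epsilon> = (x, l, r, y)\<close> that is local at \<open>e\<close> (that is,
  \<open>e \<cdot> x = x\<close> and \<open>y \<cdot> e = y\<close>) and starts at \<open>s\<close> in the group \<open>H_class e\<close> is \<open>basis_elt (l, r, y \<cdot> y\<^sup>\<star>)\<close> acted on
  by \<open>y\<close>. Every element of \<open>star_bowtie e\<close> is represented by a path of local edges, hence is a product
  of such elements and their inverses, which gives uniqueness. Conversely a path is sent to the product
  of the corresponding elements \<open>\<sigma> (l, r, y \<cdot> y\<^sup>\<star>)\<close> acted on by \<open>y\<close>; this does not depend on \<open>x\<close>, so it is
  multiplicative for \<open>ast\<close>, and invariance under the 2-cells is exactly the Peiffer identity of the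
  target. So \<open>S_bowtie\<close> is itself free on the given basis.\<close>

section \<open>Inverse monoids and their quotients\<close>

text \<open>The obstacle is that homotopies are taken in the whole Squier complex, so two local
  paths may be joined through edges that are not local. Such edges still cannot leave the vertex
  group: both ends of an edge have the same image in \<open>M\<close> and \<open>psi\<close>
  separates idempotents, so an edge with one end in \<open>H_class e\<close> has the other end there
  too. For an edge \<open>(x, l, r, y)\<close> starting at \<open>s\<close> in
  \<open>H_class e\<close>, put \<open>z = y \<cdot> e\<close>. Absorbing \<open>e\<close> on both
  sides of \<open>s = x \<cdot> t l \<cdot> y\<close> allows this product to be split before or
  after \<open>t l\<close> as a composition of groupoid arrows (\<open>H_class_factor\<close>).
  Hence \<open>z\<close> ends at \<open>e\<close>, its domain lies below
  \<open>(t l)\<^sup>\<star> \<cdot> t l\<close>, and \<open>s\<^sup>\<star> \<cdot> x =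
  z\<^sup>\<star> \<cdot> (t l)\<^sup>\<star>\<close>, so translation by
  \<open>s\<^sup>\<star>\<close> erases \<open>x\<close>. The condition on the domain of
  \<open>z\<close> is the membership condition of the basis, read in \<open>T\<close>; the basis is
  thus indexed by exactly the idempotents that occur as such domains.\<close>

locale inverse_monoid = monoid S for S (structure) +
  assumes regular: "a \<in> carrier S \<Longrightarrow> \<exists>b \<in> carrier S. a \<otimes> b \<otimes> a = a"
    and idems_commute: "\<lbrakk>e \<in> idems S; f \<in> idems S\<rbrakk> \<Longrightarrow> e \<otimes> f = f \<otimes> e"
begin

abbreviation star :: "'a \<Rightarrow> 'a" (\<open>_\<^sup>\<star>\<close> [1000] 1000) where
  "a\<^sup>\<star> \<equiv> sinv S a"

lemma idemsD [simp]: "e \<in> idems S \<Longrightarrow> e \<in> carrier S" "e \<in> idems S \<Longrightarrow> e \<otimes> e = e"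
  by (auto simp: idems_def)

lemma idemsI: "\<lbrakk>e \<in> carrier S; e \<otimes> e = e\<rbrakk> \<Longrightarrow> e \<in> idems S"
  unfolding idems_def by blast

lemma mult_eq_left:
  assumes "a \<otimes> b = c" "a \<in> carrier S" "b \<in> carrier S" "x \<in> carrier S"
  shows "a \<otimes> (b \<otimes> x) = c \<otimes> x"
  using assms m_assoc by metis

text \<open>Both inverses equal \<open>b \<otimes> a \<otimes> c\<close>: for \<open>b\<close> the
  idempotents \<open>a \<otimes> b\<close> and \<open>a \<otimes> c\<close> are commuted, for
  \<open>c\<close> the idempotents \<open>c \<otimes> a\<close> and
  \<open>b \<otimes> a\<close>.\<close>

lemma inverse_unique:
  assumes "a \<in> carrier S" "b \<in> carrier S" "c \<in> carrier S"
    and "a \<otimes> b \<otimes> a = a" "b \<otimes> a \<otimes> b = b" "a \<otimes> c \<otimes> a = a" "c \<otimes> a \<otimes> c = c"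
  shows "b = c"
proof -
  have ab: "a \<otimes> b \<in> idems S" and ac: "a \<otimes> c \<in> idems S"
    and ba: "b \<otimes> a \<in> idems S" and ca: "c \<otimes> a \<in> idems S"
    using assms by (auto intro!: idemsI simp: m_assoc[symmetric])
  have "b = b \<otimes> (a \<otimes> c \<otimes> a) \<otimes> b" using assms by simp
  also have "\<dots> = b \<otimes> ((a \<otimes> c) \<otimes> (a \<otimes> b))" using assms(1-3) by (simp add: m_assoc)
  also have "\<dots> = b \<otimes> ((a \<otimes> b) \<otimes> (a \<otimes> c))" using idems_commute[OF ab ac] by simp
  also have "\<dots> = (b \<otimes> a \<otimes> b) \<otimes> a \<otimes> c" using assms(1-3) by (simp add: m_assoc)
  also have "\<dots> = b \<otimes> a \<otimes> c" using assms by simp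
  finally have 1: "b = b \<otimes> a \<otimes> c" .
  have "c = c \<otimes> (a \<otimes> b \<otimes> a) \<otimes> c" using assms by simp
  also have "\<dots> = ((c \<otimes> a) \<otimes> (b \<otimes> a)) \<otimes> c" using assms(1-3) by (simp add: m_assoc)
  also have "\<dots> = ((b \<otimes> a) \<otimes> (c \<otimes> a)) \<otimes> c" using idems_commute[OF ba ca] by simp
  also have "\<dots> = b \<otimes> a \<otimes> (c \<otimes> a \<otimes> c)" using assms(1-3) by (simp add: m_assoc)
  also have "\<dots> = b \<otimes> a \<otimes> c" using assms by simp
  finally show ?thesis using 1 by simp
qed

lemma sinv_eqI:
  assumes "a \<in> carrier S" "b \<in> carrier S" "a \<otimes> b \<otimes> a = a" "b \<otimes> a \<otimes> b = b"
  shows "a\<^sup>\<star> = b"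
  unfolding sinv_def
proof (rule the_equality)
  show "x = b" if "x \<in> carrier S \<and> a \<otimes> x \<otimes> a = a \<and> x \<otimes> a \<otimes> x = x" for x
    using inverse_unique[of a x b] that assms by blast
qed (use assms in blast)

lemma sinv_props:
  assumes "a \<in> carrier S"
  shows "a\<^sup>\<star> \<in> carrier S \<and> a \<otimes> a\<^sup>\<star> \<otimes> a = a \<and> a\<^sup>\<star> \<otimes> a \<otimes> a\<^sup>\<star> = a\<^sup>\<star>"
proof -
  obtain b where b: "b \<in> carrier S" "a \<otimes> b \<otimes> a = a" using regular assms by blast
  \<comment> \<open>Regularity gives only the first of the two equations of an inverse; sandwiching
    \<open>a\<close> between two copies of \<open>b\<close> supplies the second.\<close>
  let ?c = "b \<otimes> a \<otimes> b"
  have r: "a \<otimes> (b \<otimes> a) = a" using b assms by (simp add: m_assoc)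
  have r': "a \<otimes> (b \<otimes> (a \<otimes> x)) = a \<otimes> x" if "x \<in> carrier S" for x
    using b that assms by (metis m_assoc m_closed)
  have "a\<^sup>\<star> = ?c" by (rule sinv_eqI) (use b assms in \<open>simp_all add: m_assoc r r'\<close>)
  then show ?thesis using b assms by (simp add: m_assoc r r')
qed

lemma sinv_closed [simp]: "a \<in> carrier S \<Longrightarrow> a\<^sup>\<star> \<in> carrier S"
  using sinv_props by blast

lemma mult_sinv_mult [simp]: "a \<in> carrier S \<Longrightarrow> a \<otimes> (a\<^sup>\<star> \<otimes> a) = a"
  using sinv_props m_assoc sinv_closed by metis

lemma mult_sinv_mult_left [simp]:
  "\<lbrakk>a \<in> carrier S; x \<in> carrier S\<rbrakk> \<Longrightarrow> a \<otimes> (a\<^sup>\<star> \<otimes> (a \<otimes> x)) = a \<otimes> x"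
  by (metis m_assoc m_closed mult_sinv_mult sinv_closed)

lemma sinv_sinv [simp]: "a \<in> carrier S \<Longrightarrow> a\<^sup>\<star>\<^sup>\<star> = a"
  by (rule sinv_eqI) (use sinv_props in auto)

lemma sinv_mult_sinv [simp]: "a \<in> carrier S \<Longrightarrow> a\<^sup>\<star> \<otimes> (a \<otimes> a\<^sup>\<star>) = a\<^sup>\<star>"
  using mult_sinv_mult[of "a\<^sup>\<star>"] by simp

lemma sinv_mult_sinv_left [simp]:
  "\<lbrakk>a \<in> carrier S; x \<in> carrier S\<rbrakk> \<Longrightarrow> a\<^sup>\<star> \<otimes> (a \<otimes> (a\<^sup>\<star> \<otimes> x)) = a\<^sup>\<star> \<otimes> x"
  using mult_sinv_mult_left[of "a\<^sup>\<star>" x] by simp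

lemma ran_idem [simp]: "a \<in> carrier S \<Longrightarrow> a\<^sup>\<star> \<otimes> a \<in> idems S"
  and dom_idem [simp]: "a \<in> carrier S \<Longrightarrow> a \<otimes> a\<^sup>\<star> \<in> idems S"
  by (auto intro!: idemsI simp: m_assoc)

lemma sinv_idem [simp]: "e \<in> idems S \<Longrightarrow> e\<^sup>\<star> = e"
  by (rule sinv_eqI) auto

lemma idem_mult_left [simp]:
  "\<lbrakk>e \<in> idems S; x \<in> carrier S\<rbrakk> \<Longrightarrow> e \<otimes> (e \<otimes> x) = e \<otimes> x"
  using mult_eq_left[of e e e x] by simp

lemma idems_left_commute:
  "\<lbrakk>e \<in> idems S; f \<in> idems S; x \<in> carrier S\<rbrakk> \<Longrightarrow> e \<otimes> (f \<otimes> x) = f \<otimes> (e \<otimes> x)"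
  by (metis idems_commute idemsD(1) m_assoc)

lemma idems_mult [simp]: "\<lbrakk>e \<in> idems S; f \<in> idems S\<rbrakk> \<Longrightarrow> e \<otimes> f \<in> idems S"
  by (rule idemsI) (simp_all add: m_assoc idems_left_commute[of f e])

lemma sinv_mult [simp]:
  assumes "a \<in> carrier S" "b \<in> carrier S"
  shows "(a \<otimes> b)\<^sup>\<star> = b\<^sup>\<star> \<otimes> a\<^sup>\<star>"
proof (rule sinv_eqI)
  have c: "(b \<otimes> b\<^sup>\<star>) \<otimes> (a\<^sup>\<star> \<otimes> a) = (a\<^sup>\<star> \<otimes> a) \<otimes> (b \<otimes> b\<^sup>\<star>)"
    using assms by (intro idems_commute) auto
  have "a \<otimes> b \<otimes> (b\<^sup>\<star> \<otimes> a\<^sup>\<star>) \<otimes> (a \<otimes> b) = a \<otimes> ((b \<otimes> b\<^sup>\<star>) \<otimes> (a\<^sup>\<star> \<otimes> a)) \<otimes> b"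
    using assms by (simp add: m_assoc)
  also have "\<dots> = a \<otimes> b" unfolding c using assms by (simp add: m_assoc)
  finally show "a \<otimes> b \<otimes> (b\<^sup>\<star> \<otimes> a\<^sup>\<star>) \<otimes> (a \<otimes> b) = a \<otimes> b" .
  have "b\<^sup>\<star> \<otimes> a\<^sup>\<star> \<otimes> (a \<otimes> b) \<otimes> (b\<^sup>\<star> \<otimes> a\<^sup>\<star>) = b\<^sup>\<star> \<otimes> ((a\<^sup>\<star> \<otimes> a) \<otimes> (b \<otimes> b\<^sup>\<star>)) \<otimes> a\<^sup>\<star>"
    using assms by (simp add: m_assoc)
  also have "\<dots> = b\<^sup>\<star> \<otimes> a\<^sup>\<star>" unfolding c[symmetric] using assms by (simp add: m_assoc)
  finally show "b\<^sup>\<star> \<otimes> a\<^sup>\<star> \<otimes> (a \<otimes> b) \<otimes> (b\<^sup>\<star> \<otimes> a\<^sup>\<star>) = b\<^sup>\<star> \<otimes> a\<^sup>\<star>" .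
qed (use assms in auto)

lemma conj_idem [simp]:
  assumes "e \<in> idems S" "a \<in> carrier S" shows "a\<^sup>\<star> \<otimes> (e \<otimes> a) \<in> idems S"
  using ran_idem[of "e \<otimes> a"] assms by (simp add: m_assoc)

text \<open>Serves to move an idempotent across a factor: it reappears on the right as its
  conjugate.\<close>

lemma idem_mult_eq_conj:
  assumes "e \<in> idems S" "a \<in> carrier S" shows "e \<otimes> a = a \<otimes> (a\<^sup>\<star> \<otimes> (e \<otimes> a))"
proof -
  have "a \<otimes> (a\<^sup>\<star> \<otimes> (e \<otimes> a)) = (a \<otimes> a\<^sup>\<star>) \<otimes> (e \<otimes> a)" using assms by (simp add: m_assoc)
  also have "\<dots> = e \<otimes> ((a \<otimes> a\<^sup>\<star>) \<otimes> a)"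
    using assms by (intro idems_left_commute) auto
  finally show ?thesis using assms by (simp add: m_assoc)
qed

end

text \<open>For words an involution is at hand, but commutation is known only for products
  \<open>a \<otimes> f a\<close>. The point is that every idempotent \<open>e\<close> is such a
  product: writing \<open>f e\<close> as
  \<open>(f e \<otimes> f (f e)) \<otimes> (e \<otimes> f e)\<close> and commuting the two factors
  gives \<open>f e = e\<close>.\<close>

lemma inverse_monoidI_involution:
  assumes "monoid S"
    and cl: "\<And>a. a \<in> carrier S \<Longrightarrow> f a \<in> carrier S"
    and inv: "\<And>a. a \<in> carrier S \<Longrightarrow> f (f a) = a"
    and anti: "\<And>a b. \<lbrakk>a \<in> carrier S; b \<in> carrier S\<rbrakk> \<Longrightarrow> f (a \<otimes>\<^bsub>S\<^esub> b) = f b \<otimes>\<^bsub>S\<^esub> f a"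
    and reg: "\<And>a. a \<in> carrier S \<Longrightarrow> a \<otimes>\<^bsub>S\<^esub> f a \<otimes>\<^bsub>S\<^esub> a = a"
    and com: "\<And>a b. \<lbrakk>a \<in> carrier S; b \<in> carrier S\<rbrakk> \<Longrightarrow>
      (a \<otimes>\<^bsub>S\<^esub> f a) \<otimes>\<^bsub>S\<^esub> (b \<otimes>\<^bsub>S\<^esub> f b) = (b \<otimes>\<^bsub>S\<^esub> f b) \<otimes>\<^bsub>S\<^esub> (a \<otimes>\<^bsub>S\<^esub> f a)"
  shows "inverse_monoid S" and "a \<in> carrier S \<Longrightarrow> sinv S a = f a"
proof -
  interpret monoid S by fact
  have idem: "e = e \<otimes>\<^bsub>S\<^esub> f e" if "e \<in> idems S" for e
  proof -
    have e: "e \<in> carrier S" "e \<otimes>\<^bsub>S\<^esub> e = e" using that by (auto simp: idems_def)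
    have fe: "f e \<in> carrier S" "f e \<otimes>\<^bsub>S\<^esub> f e = f e" using e anti[of e e] cl by auto
    have "f e = f e \<otimes>\<^bsub>S\<^esub> e \<otimes>\<^bsub>S\<^esub> f e" using reg[OF fe(1)] inv e by simp
    also have "\<dots> = (f e \<otimes>\<^bsub>S\<^esub> f (f e)) \<otimes>\<^bsub>S\<^esub> (e \<otimes>\<^bsub>S\<^esub> f e)"
      using e fe inv by (metis m_assoc m_closed)
    also have "\<dots> = (e \<otimes>\<^bsub>S\<^esub> f e) \<otimes>\<^bsub>S\<^esub> (f e \<otimes>\<^bsub>S\<^esub> f (f e))"
      using com e fe by blast
    also have "\<dots> = e \<otimes>\<^bsub>S\<^esub> (f e \<otimes>\<^bsub>S\<^esub> f e) \<otimes>\<^bsub>S\<^esub> e"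
      using e(1) fe(1) inv by (simp add: m_assoc)
    also have "\<dots> = e" using fe e reg by simp
    finally show "e = e \<otimes>\<^bsub>S\<^esub> f e" using e by simp
  qed
  show S: "inverse_monoid S"
  proof
    show "\<exists>b\<in>carrier S. a \<otimes>\<^bsub>S\<^esub> b \<otimes>\<^bsub>S\<^esub> a = a" if "a \<in> carrier S" for a
      using reg cl that by blast
    show "e \<otimes>\<^bsub>S\<^esub> g = g \<otimes>\<^bsub>S\<^esub> e" if "e \<in> idems S" "g \<in> idems S" for e g
      using com[of e g] idem that by (auto simp: idems_def)
  qed
  show "sinv S a = f a" if "a \<in> carrier S"
    using that inverse_monoid.sinv_eqI[OF S that cl[OF that]] reg[of a] reg[of "f a"] inv cl by simp
qed

section \<open>Congruences and quotient monoids\<close>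

lemma monoid_congruenceD:
  assumes "monoid_congruence S \<kappa>"
  shows "equiv (carrier S) \<kappa>"
    and "\<lbrakk>(a, b) \<in> \<kappa>; (c, d) \<in> \<kappa>\<rbrakk> \<Longrightarrow> (a \<otimes>\<^bsub>S\<^esub> c, b \<otimes>\<^bsub>S\<^esub> d) \<in> \<kappa>"
  using assms by (auto simp: monoid_congruence_def)

lemma generated_congruence_least:
  "\<lbrakk>monoid_congruence S \<kappa>; P \<subseteq> \<kappa>\<rbrakk> \<Longrightarrow> generated_congruence S P \<subseteq> \<kappa>"
  by (auto simp: generated_congruence_def)

lemma generated_congruence_contains: "P \<subseteq> generated_congruence S P"
  by (auto simp: generated_congruence_def)

lemma generated_congruence:
  assumes "monoid S" "P \<subseteq> carrier S \<times> carrier S"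
  shows "monoid_congruence S (generated_congruence S P)"
proof -
  interpret monoid S by fact
  \<comment> \<open>The universal relation keeps the family nonempty, so that its intersection stays
    inside the carrier.\<close>
  have full: "monoid_congruence S (carrier S \<times> carrier S)"
    by (auto simp: monoid_congruence_def equiv_def refl_on_def sym_def trans_def)
  let ?Q = "{\<kappa>. monoid_congruence S \<kappa> \<and> P \<subseteq> \<kappa>}"
  have "equiv (carrier S) (\<Inter> ?Q)"
  proof (rule equivI)
    show "\<Inter> ?Q \<subseteq> carrier S \<times> carrier S" using full assms by blast
    show "refl_on (carrier S) (\<Inter> ?Q)"
      by (auto simp: refl_on_def monoid_congruence_def equiv_def)
    show "sym (\<Inter> ?Q)" unfolding sym_def
      by (auto simp: monoid_congruence_def equiv_def dest: symD)
    show "trans (\<Inter> ?Q)" unfolding trans_def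
      by (auto simp: monoid_congruence_def equiv_def dest: transD)
  qed
  then show ?thesis unfolding generated_congruence_def
    by (auto simp: monoid_congruence_def)
qed

locale monoid_quotient = monoid S for S (structure) +
  fixes \<kappa>
  assumes cong: "monoid_congruence S \<kappa>"
begin

abbreviation cl where "cl a \<equiv> \<kappa> `` {a}"

lemma equiv: "equiv (carrier S) \<kappa>" using cong monoid_congruenceD by blast

lemma cl_eq_iff: "\<lbrakk>a \<in> carrier S; b \<in> carrier S\<rbrakk> \<Longrightarrow> cl a = cl b \<longleftrightarrow> (a, b) \<in> \<kappa>"
  by (rule eq_equiv_class_iff[OF equiv])

lemma cl_mem: "a \<in> carrier S \<Longrightarrow> a \<in> cl a"
  by (rule equiv_class_self[OF equiv])

lemma carrier_quotient: "carrier (quotient_monoid S \<kappa>) = cl ` carrier S"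
  by (auto simp: quotient_monoid_def quotient_def)

lemma cl_closed [simp]: "a \<in> carrier S \<Longrightarrow> cl a \<in> carrier (quotient_monoid S \<kappa>)"
  by (auto simp: carrier_quotient)

lemma cl_one: "\<one>\<^bsub>quotient_monoid S \<kappa>\<^esub> = cl \<one>"
  by (simp add: quotient_monoid_def)

lemma cl_mult [simp]:
  assumes "a \<in> carrier S" "b \<in> carrier S"
  shows "cl a \<otimes>\<^bsub>quotient_monoid S \<kappa>\<^esub> cl b = cl (a \<otimes> b)"
proof -
  have "\<kappa> `` {a' \<otimes> b'} = cl (a \<otimes> b)" if "a' \<in> cl a" "b' \<in> cl b" for a' b'
  proof -
    have "(a \<otimes> b, a' \<otimes> b') \<in> \<kappa>" using that monoid_congruenceD(2)[OF cong] by blast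
    then show ?thesis using equiv_class_eq[OF equiv] by blast
  qed
  then have "(\<Union>a'\<in>cl a. \<Union>b'\<in>cl b. \<kappa> `` {a' \<otimes> b'}) = cl (a \<otimes> b)"
    using cl_mem assms by blast
  then show ?thesis by (simp add: quotient_monoid_def)
qed

lemma monoid_quotient: "monoid (quotient_monoid S \<kappa>)"
  by (rule monoidI) (auto simp: carrier_quotient cl_one m_assoc)

end

locale inverse_quotient = inverse_monoid S + monoid_quotient S \<kappa> for S (structure) and \<kappa>
begin

text \<open>Lallement's lemma: a class containing \<open>a\<close> and \<open>a \<otimes> a\<close> contains the idempotent
  \<open>a \<otimes> (a \<otimes> a)\<^sup>\<star> \<otimes> a\<close>.\<close>

lemma idems_quotient: "idems (quotient_monoid S \<kappa>) = cl ` idems S"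
proof
  show "cl ` idems S \<subseteq> idems (quotient_monoid S \<kappa>)"
    by (auto simp: idems_def[of "quotient_monoid S \<kappa>"])
  show "idems (quotient_monoid S \<kappa>) \<subseteq> cl ` idems S"
  proof
    fix A assume A: "A \<in> idems (quotient_monoid S \<kappa>)"
    then obtain a where a: "a \<in> carrier S" "A = cl a" by (auto simp: idems_def[of "quotient_monoid S \<kappa>"] carrier_quotient)
    let ?Q = "quotient_monoid S \<kappa>"
    let ?x = "(a \<otimes> a)\<^sup>\<star>" let ?e = "a \<otimes> ?x \<otimes> a"
    have x: "?x \<in> carrier S" using a by auto
    have aa: "cl (a \<otimes> a) = cl a" using A a by (auto simp: idems_def[of ?Q])
    have "?e \<otimes> ?e = a \<otimes> (?x \<otimes> (a \<otimes> a) \<otimes> ?x) \<otimes> a" using a x by (simp add: m_assoc del: sinv_mult)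
    also have "?x \<otimes> (a \<otimes> a) \<otimes> ?x = ?x" using sinv_props[of "a \<otimes> a"] a by blast
    finally have e: "?e \<in> idems S" using a x by (intro idemsI m_closed)
    have "cl ?e = cl a \<otimes>\<^bsub>?Q\<^esub> cl ?x \<otimes>\<^bsub>?Q\<^esub> cl a" using a x by simp
    also have "\<dots> = cl (a \<otimes> a) \<otimes>\<^bsub>?Q\<^esub> cl ?x \<otimes>\<^bsub>?Q\<^esub> cl (a \<otimes> a)" by (simp only: aa)
    also have "\<dots> = cl (a \<otimes> a \<otimes> ?x \<otimes> (a \<otimes> a))" using a x by (simp del: sinv_mult)
    also have "\<dots> = cl (a \<otimes> a)" using sinv_props[of "a \<otimes> a"] a by (simp del: sinv_mult)
    finally show "A \<in> cl ` idems S" using e a aa by blast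
  qed
qed

text \<open>This is the gain from defining inverse monoids by regularity and commuting idempotents:
  both conditions pass to classes, the second because an idempotent class contains an
  idempotent.\<close>

lemma inverse_quotient: "inverse_monoid (quotient_monoid S \<kappa>)"
proof (intro inverse_monoid.intro monoid_quotient inverse_monoid_axioms.intro)
  fix A assume "A \<in> carrier (quotient_monoid S \<kappa>)"
  then obtain a where a: "a \<in> carrier S" "A = cl a" by (auto simp: carrier_quotient)
  then show "\<exists>B\<in>carrier (quotient_monoid S \<kappa>).
      A \<otimes>\<^bsub>quotient_monoid S \<kappa>\<^esub> B \<otimes>\<^bsub>quotient_monoid S \<kappa>\<^esub> A = A"
    by (intro bexI[of _ "cl (a\<^sup>\<star>)"]) (auto simp: m_assoc)
next
  fix E F assume "E \<in> idems (quotient_monoid S \<kappa>)" "F \<in> idems (quotient_monoid S \<kappa>)"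
  then obtain e f where "e \<in> idems S" "f \<in> idems S" "E = cl e" "F = cl f"
    by (auto simp: idems_quotient)
  then show "E \<otimes>\<^bsub>quotient_monoid S \<kappa>\<^esub> F = F \<otimes>\<^bsub>quotient_monoid S \<kappa>\<^esub> E"
    by (simp add: idems_commute[of e f])
qed

lemma sinv_cl:
  assumes "a \<in> carrier S" shows "sinv (quotient_monoid S \<kappa>) (cl a) = cl (a\<^sup>\<star>)"
  by (rule inverse_monoid.sinv_eqI[OF inverse_quotient]) (use assms in \<open>auto simp: m_assoc\<close>)

end

section \<open>The free inverse monoid\<close>

lemma free_monoid_simps [simp]:
  "carrier (free_monoid X) = words X" "u \<otimes>\<^bsub>free_monoid X\<^esub> v = u @ v" "\<one>\<^bsub>free_monoid X\<^esub> = []"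
  by (simp_all add: free_monoid_def)

lemma words_simps [simp]:
  "[] \<in> words X" "u @ v \<in> words X \<longleftrightarrow> u \<in> words X \<and> v \<in> words X"
  by (auto simp: words_def)

lemma word_inv_words [simp]: "w \<in> words X \<Longrightarrow> word_inv w \<in> words X"
  by (force simp: words_def word_inv_def lists_eq_set Plus_def split: sum.splits)

lemma word_inv_append [simp]: "word_inv (u @ v) = word_inv v @ word_inv u"
  by (simp add: word_inv_def)

lemma word_inv_word_inv [simp]: "word_inv (word_inv w) = w"
  by (induction w) (auto simp: word_inv_def split: sum.splits)

lemma monoid_free_monoid: "monoid (free_monoid X)"
  by (rule monoidI) auto

lemma vagner_congruence: "monoid_congruence (free_monoid X) (vagner X)"
  unfolding vagner_def by (rule generated_congruence[OF monoid_free_monoid]) auto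

interpretation vagner: monoid_quotient "free_monoid X" "vagner X" for X
  by (intro monoid_quotient.intro monoid_free_monoid monoid_quotient_axioms.intro vagner_congruence)

lemma vagner_generators:
  "w \<in> words X \<Longrightarrow> (w @ word_inv w @ w, w) \<in> vagner X"
  "\<lbrakk>u \<in> words X; v \<in> words X\<rbrakk> \<Longrightarrow>
     (u @ word_inv u @ v @ word_inv v, v @ word_inv v @ u @ word_inv u) \<in> vagner X"
  unfolding vagner_def by (rule subsetD[OF generated_congruence_contains], blast)+

text \<open>The pullback of the congruence along word inversion is again a congruence, and inversion
  turns generating pairs into generating pairs, exchanging \<open>u\<close> and \<open>v\<close> in
  the second kind. By minimality the pullback contains the congruence.\<close>

lemma vagner_word_inv: "(u, v) \<in> vagner X \<Longrightarrow> (word_inv u, word_inv v) \<in> vagner X"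
proof -
  let ?\<kappa> = "{(u, v). u \<in> words X \<and> v \<in> words X \<and> (word_inv u, word_inv v) \<in> vagner X}"
  have eq: "equiv (words X) (vagner X)" using vagner.equiv[of X] by simp
  have "monoid_congruence (free_monoid X) ?\<kappa>"
    unfolding monoid_congruence_def
  proof (intro conjI equivI)
    show "refl_on (carrier (free_monoid X)) ?\<kappa>"
      using eq by (auto simp: refl_on_def equiv_def)
    show "sym ?\<kappa>" using eq by (auto simp: sym_def equiv_def)
    show "trans ?\<kappa>" using eq by (auto simp: trans_def equiv_def)
  qed (use monoid_congruenceD(2)[OF vagner_congruence] in auto)
  moreover have "{(w @ word_inv w @ w, w) | w. w \<in> words X} \<union>
      {(u @ word_inv u @ v @ word_inv v, v @ word_inv v @ u @ word_inv u) | u v.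
         u \<in> words X \<and> v \<in> words X} \<subseteq> ?\<kappa>" (is "?A \<union> ?B \<subseteq> _")
  proof
    fix z assume "z \<in> ?A \<union> ?B"
    then consider w where "w \<in> words X" "z = (w @ word_inv w @ w, w)"
      | u v where "u \<in> words X" "v \<in> words X"
        "z = (u @ word_inv u @ v @ word_inv v, v @ word_inv v @ u @ word_inv u)" by blast
    then show "z \<in> ?\<kappa>"
    proof cases
      case 1
      then show ?thesis using vagner_generators(1)[of "word_inv w" X] by simp
    next
      case 2
      then show ?thesis using vagner_generators(2)[of v X u] by simp
    qed
  qed
  ultimately have "vagner X \<subseteq> ?\<kappa>"
    unfolding vagner_def[of X] by (rule generated_congruence_least)
  then show "(u, v) \<in> vagner X \<Longrightarrow> (word_inv u, word_inv v) \<in> vagner X" by blast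
qed

lemma carrier_FIM: "carrier (FIM X) = rho X ` words X"
  using vagner.carrier_quotient[of X] by (auto simp: FIM_def rho_def)

lemma rho_closed [simp]: "w \<in> words X \<Longrightarrow> rho X w \<in> carrier (FIM X)"
  by (simp add: carrier_FIM)

lemma rho_mult [simp]:
  "\<lbrakk>u \<in> words X; v \<in> words X\<rbrakk> \<Longrightarrow> rho X u \<otimes>\<^bsub>FIM X\<^esub> rho X v = rho X (u @ v)"
  using vagner.cl_mult[of u X v] by (simp add: FIM_def rho_def)

lemma rho_eq_iff: "\<lbrakk>u \<in> words X; v \<in> words X\<rbrakk> \<Longrightarrow> rho X u = rho X v \<longleftrightarrow> (u, v) \<in> vagner X"
  using vagner.cl_eq_iff[of u X v] by (simp add: rho_def)

lemma rho_vagner [simp]: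
  "w \<in> words X \<Longrightarrow> rho X (w @ word_inv w @ w) = rho X w"
  by (simp add: rho_eq_iff vagner_generators)

lemma rho_vagner_commute:
  "\<lbrakk>u \<in> words X; v \<in> words X\<rbrakk> \<Longrightarrow>
     rho X (u @ word_inv u @ v @ word_inv v) = rho X (v @ word_inv v @ u @ word_inv u)"
  by (subst rho_eq_iff) (auto intro: vagner_generators)

lemma
  shows inverse_monoid_FIM: "inverse_monoid (FIM X)"
    and sinv_rho: "w \<in> words X \<Longrightarrow> sinv (FIM X) (rho X w) = rho X (word_inv w)"
proof -
  \<comment> \<open>Inversion on classes goes through a chosen representative;
    \<open>vagner_word_inv\<close> makes the choice irrelevant.\<close>
  define f where "f a = rho X (word_inv (SOME w. w \<in> words X \<and> rho X w = a))" for a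
  have f: "f (rho X w) = rho X (word_inv w)" if w: "w \<in> words X" for w
  proof -
    have "\<exists>v. v \<in> words X \<and> rho X v = rho X w" using w by blast
    from someI_ex[OF this] obtain v
      where v: "v \<in> words X" "rho X v = rho X w" "f (rho X w) = rho X (word_inv v)"
      unfolding f_def by blast
    then have "(word_inv v, word_inv w) \<in> vagner X" using w by (simp add: rho_eq_iff vagner_word_inv)
    then show ?thesis using v w by (simp add: rho_eq_iff)
  qed
  have "monoid (FIM X)" using vagner.monoid_quotient by (simp add: FIM_def)
  note * = inverse_monoidI_involution[OF this, of f]
  have A: "\<And>a. a \<in> carrier (FIM X) \<Longrightarrow> f a \<in> carrier (FIM X)"
    "\<And>a. a \<in> carrier (FIM X) \<Longrightarrow> f (f a) = a"
    "\<And>a b. \<lbrakk>a \<in> carrier (FIM X); b \<in> carrier (FIM X)\<rbrakk> \<Longrightarrow>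
       f (a \<otimes>\<^bsub>FIM X\<^esub> b) = f b \<otimes>\<^bsub>FIM X\<^esub> f a"
    "\<And>a. a \<in> carrier (FIM X) \<Longrightarrow> a \<otimes>\<^bsub>FIM X\<^esub> f a \<otimes>\<^bsub>FIM X\<^esub> a = a"
    "\<And>a b. \<lbrakk>a \<in> carrier (FIM X); b \<in> carrier (FIM X)\<rbrakk> \<Longrightarrow>
      (a \<otimes>\<^bsub>FIM X\<^esub> f a) \<otimes>\<^bsub>FIM X\<^esub> (b \<otimes>\<^bsub>FIM X\<^esub> f b) =
      (b \<otimes>\<^bsub>FIM X\<^esub> f b) \<otimes>\<^bsub>FIM X\<^esub> (a \<otimes>\<^bsub>FIM X\<^esub> f a)"
    by (auto simp: carrier_FIM f)[4] (clarsimp simp: carrier_FIM f, rule rho_vagner_commute)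
  show "inverse_monoid (FIM X)" by (rule *(1)) (fact A)+
  show "sinv (FIM X) (rho X w) = rho X (word_inv w)" if "w \<in> words X"
    using that *(2)[OF A, of "rho X w"] by (simp add: f)
qed

section \<open>The congruence \<open>theta_min\<close> and the monoid \<open>T\<close>\<close>

context inverse_quotient
begin

text \<open>This is \<open>theta_min\<close> for an arbitrary congruence, in semigroup theory the
  least congruence with the same trace. What matters below is that it lies inside
  \<open>\<kappa>\<close> and agrees with it on idempotents.\<close>

definition min_cong where
  "min_cong = {(a, b). a \<in> carrier S \<and> b \<in> carrier S \<and>
     (\<exists>e \<in> idems S. a \<otimes> e = b \<otimes> e \<and> (a\<^sup>\<star> \<otimes> a, e) \<in> \<kappa> \<and> (b\<^sup>\<star> \<otimes> b, e) \<in> \<kappa>)}"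

lemma kappa_sym: "(a, b) \<in> \<kappa> \<Longrightarrow> (b, a) \<in> \<kappa>"
  using equiv by (auto simp: equiv_def dest: symD)

lemma kappa_trans: "\<lbrakk>(a, b) \<in> \<kappa>; (b, c) \<in> \<kappa>\<rbrakk> \<Longrightarrow> (a, c) \<in> \<kappa>"
  using equiv by (auto simp: equiv_def dest: transD)

lemma kappa_refl: "a \<in> carrier S \<Longrightarrow> (a, a) \<in> \<kappa>"
  using equiv by (auto simp: equiv_def refl_on_def)

lemma kappa_mult: "\<lbrakk>(a, b) \<in> \<kappa>; (c, d) \<in> \<kappa>\<rbrakk> \<Longrightarrow> (a \<otimes> c, b \<otimes> d) \<in> \<kappa>"
  using monoid_congruenceD(2)[OF cong] by blast

text \<open>Conjugating \<open>e\<close> by \<open>c \<otimes> f\<close> rather than by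
  \<open>c\<close> makes the witness depend on \<open>c\<close> only through
  \<open>c \<otimes> f\<close>. If also \<open>a \<otimes> e = b \<otimes> e\<close> and
  \<open>c \<otimes> f = d \<otimes> f\<close>, the same \<open>g\<close> therefore serves for
  \<open>a \<otimes> c\<close> and \<open>b \<otimes> d\<close>, and both products with
  \<open>g\<close> agree.\<close>

lemma min_cong_mult_witness:
  assumes "a \<in> carrier S" "c \<in> carrier S" "e \<in> idems S" "f \<in> idems S"
    and "(a\<^sup>\<star> \<otimes> a, e) \<in> \<kappa>" "(c\<^sup>\<star> \<otimes> c, f) \<in> \<kappa>"
  defines "g \<equiv> (c \<otimes> f)\<^sup>\<star> \<otimes> (e \<otimes> (c \<otimes> f))"
  shows "g \<in> idems S" "a \<otimes> c \<otimes> g = (a \<otimes> e) \<otimes> (c \<otimes> f)"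
    "((a \<otimes> c)\<^sup>\<star> \<otimes> (a \<otimes> c), g) \<in> \<kappa>"
proof -
  let ?h = "c\<^sup>\<star> \<otimes> (e \<otimes> c)"
  have h: "?h \<in> idems S" using assms by simp
  show "g \<in> idems S" unfolding g_def using assms by (intro conj_idem) auto
  have "g = f \<otimes> (?h \<otimes> f)" unfolding g_def using assms by (simp add: m_assoc)
  also have "\<dots> = ?h \<otimes> f"
    using idems_left_commute[OF h \<open>f \<in> idems S\<close>, of f] idems_commute[OF h \<open>f \<in> idems S\<close>] assms h by simp
  finally have g: "g = ?h \<otimes> f" .
  have "a \<otimes> c \<otimes> g = a \<otimes> (c \<otimes> ?h) \<otimes> f" unfolding g using assms by (simp add: m_assoc)
  also have "c \<otimes> ?h = e \<otimes> c" using idem_mult_eq_conj assms by simp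
  finally show "a \<otimes> c \<otimes> g = (a \<otimes> e) \<otimes> (c \<otimes> f)" using assms by (simp add: m_assoc)
  have "(c\<^sup>\<star> \<otimes> (a\<^sup>\<star> \<otimes> a \<otimes> c) \<otimes> (c\<^sup>\<star> \<otimes> c), ?h \<otimes> f) \<in> \<kappa>"
    using assms by (intro kappa_mult kappa_refl) auto
  then show "((a \<otimes> c)\<^sup>\<star> \<otimes> (a \<otimes> c), g) \<in> \<kappa>" unfolding g using assms by (simp add: m_assoc)
qed

lemma min_cong_congruence: "monoid_congruence S min_cong"
  unfolding monoid_congruence_def
proof (intro conjI equivI allI impI)
  show "min_cong \<subseteq> carrier S \<times> carrier S" by (auto simp: min_cong_def)
  show "refl_on (carrier S) min_cong"
    by (force simp: refl_on_def min_cong_def intro: kappa_refl)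
  show "sym min_cong" unfolding sym_def min_cong_def by force
  show "trans min_cong"
  proof (rule transI)
    fix a b c assume "(a, b) \<in> min_cong" "(b, c) \<in> min_cong"
    then obtain e f where *: "a \<in> carrier S" "b \<in> carrier S" "c \<in> carrier S"
      "e \<in> idems S" "f \<in> idems S" "a \<otimes> e = b \<otimes> e" "b \<otimes> f = c \<otimes> f"
      "(a\<^sup>\<star> \<otimes> a, e) \<in> \<kappa>" "(b\<^sup>\<star> \<otimes> b, e) \<in> \<kappa>" "(b\<^sup>\<star> \<otimes> b, f) \<in> \<kappa>" "(c\<^sup>\<star> \<otimes> c, f) \<in> \<kappa>"
      by (auto simp: min_cong_def)
    have "a \<otimes> (e \<otimes> f) = b \<otimes> (e \<otimes> f)" using * by (simp add: m_assoc[symmetric])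
    also have "\<dots> = b \<otimes> f \<otimes> e" using *(1-5) idems_commute[of e f] by (simp add: m_assoc)
    also have "\<dots> = c \<otimes> f \<otimes> e" using * by simp
    also have "\<dots> = c \<otimes> (e \<otimes> f)" using *(1-5) idems_commute[of e f] by (simp add: m_assoc)
    finally have 1: "a \<otimes> (e \<otimes> f) = c \<otimes> (e \<otimes> f)" .
    \<comment> \<open>Both witnesses are congruent to the same idempotent, hence so is their
      product, which becomes the witness for \<open>a\<close> and \<open>c\<close>.\<close>
    have "(b\<^sup>\<star> \<otimes> b \<otimes> (b\<^sup>\<star> \<otimes> b), e \<otimes> f) \<in> \<kappa>" by (intro kappa_mult) fact+
    then have 2: "(b\<^sup>\<star> \<otimes> b, e \<otimes> f) \<in> \<kappa>" using * by (simp add: m_assoc)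
    have "(a\<^sup>\<star> \<otimes> a, e \<otimes> f) \<in> \<kappa>" "(c\<^sup>\<star> \<otimes> c, e \<otimes> f) \<in> \<kappa>"
      using * 2 kappa_sym kappa_trans by blast+
    with 1 * show "(a, c) \<in> min_cong" by (auto simp: min_cong_def intro!: bexI[of _ "e \<otimes> f"])
  qed
  fix a b c d assume "(a, b) \<in> min_cong" "(c, d) \<in> min_cong"
  then obtain e f where *: "a \<in> carrier S" "b \<in> carrier S" "c \<in> carrier S" "d \<in> carrier S"
      "e \<in> idems S" "f \<in> idems S" "a \<otimes> e = b \<otimes> e" "c \<otimes> f = d \<otimes> f"
      "(a\<^sup>\<star> \<otimes> a, e) \<in> \<kappa>" "(b\<^sup>\<star> \<otimes> b, e) \<in> \<kappa>" "(c\<^sup>\<star> \<otimes> c, f) \<in> \<kappa>" "(d\<^sup>\<star> \<otimes> d, f) \<in> \<kappa>"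
    by (auto simp: min_cong_def)
  let ?g = "(c \<otimes> f)\<^sup>\<star> \<otimes> (e \<otimes> (c \<otimes> f))"
  note ac = min_cong_mult_witness[OF *(1,3,5,6,9,11)]
  note bd = min_cong_mult_witness[OF *(2,4,5,6,10,12), folded *(7,8)]
  show "(a \<otimes> c, b \<otimes> d) \<in> min_cong"
    unfolding min_cong_def using * ac bd by (auto simp del: sinv_mult intro!: bexI[of _ ?g])
qed

text \<open>Multiplying the two congruences of idempotents by \<open>a\<close> and by
  \<open>b\<close> links \<open>a\<close> to \<open>a \<otimes> e = b \<otimes> e\<close> and this
  to \<open>b\<close>. The inclusion is what makes \<open>psi\<close> single-valued.\<close>

lemma min_cong_subset: "min_cong \<subseteq> \<kappa>"
proof clarify
  fix a b assume "(a, b) \<in> min_cong"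
  then obtain e where *: "a \<in> carrier S" "b \<in> carrier S"
      "e \<in> idems S" "a \<otimes> e = b \<otimes> e" "(a\<^sup>\<star> \<otimes> a, e) \<in> \<kappa>" "(b\<^sup>\<star> \<otimes> b, e) \<in> \<kappa>"
    by (auto simp: min_cong_def)
  have "(a \<otimes> (a\<^sup>\<star> \<otimes> a), a \<otimes> e) \<in> \<kappa>" "(b \<otimes> (b\<^sup>\<star> \<otimes> b), b \<otimes> e) \<in> \<kappa>"
    using * kappa_mult kappa_refl by blast+
  then show "(a, b) \<in> \<kappa>" using * kappa_sym kappa_trans by (metis mult_sinv_mult)
qed

text \<open>The product \<open>e \<otimes> f\<close> is a witness. This yields the injectivity of
  \<open>psi\<close> on idempotents.\<close>

lemma min_cong_idems:
  assumes "e \<in> idems S" "f \<in> idems S" "(e, f) \<in> \<kappa>"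
  shows "(e, f) \<in> min_cong"
proof -
  have "(e \<otimes> e, e \<otimes> f) \<in> \<kappa>" "(f \<otimes> f, e \<otimes> f) \<in> \<kappa>"
    using assms kappa_mult kappa_refl kappa_sym by (metis idemsD(1))+
  then show ?thesis unfolding min_cong_def using assms
    by (auto intro!: bexI[of _ "e \<otimes> f"] simp: idems_left_commute[of f e f])
qed

end

interpretation FIM: inverse_monoid "FIM X" for X
  by (rule inverse_monoid_FIM)

section \<open>The monoids of a presentation and the map \<open>psi\<close> between them\<close>

locale presentation =
  fixes X :: "'x set" and \<R> :: "('x word \<times> 'x word) set"
  assumes relators: "\<R> \<subseteq> words X \<times> words X"
begin

lemma relators_words: "(l, r) \<in> \<R> \<Longrightarrow> l \<in> words X" "(l, r) \<in> \<R> \<Longrightarrow> r \<in> words X"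
  using relators by auto

lemma theta_congruence: "monoid_congruence (FIM X) (theta_cong X \<R>)"
  unfolding theta_cong_def by (rule generated_congruence) (use relators_words in \<open>auto intro: FIM.monoid_axioms\<close>)

sublocale theta: inverse_quotient "FIM X" "theta_cong X \<R>"
  by (intro inverse_quotient.intro inverse_monoid_FIM monoid_quotient.intro
      monoid_quotient_axioms.intro theta_congruence FIM.monoid_axioms)

lemma theta_min_eq: "theta_min X \<R> = theta.min_cong"
proof -
  have "theta X \<R> x = theta X \<R> y \<longleftrightarrow> (x, y) \<in> theta_cong X \<R>"
    "theta X \<R> x = theta X \<R> y \<longleftrightarrow> (y, x) \<in> theta_cong X \<R>"
    if "x \<in> carrier (FIM X)" "y \<in> carrier (FIM X)" for x y
    using that by (auto simp: theta_def theta.cl_eq_iff intro: theta.kappa_sym)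
  then have "theta X \<R> (sinv (FIM X) a \<otimes>\<^bsub>FIM X\<^esub> a) = theta X \<R> e \<and>
        theta X \<R> e = theta X \<R> (sinv (FIM X) b \<otimes>\<^bsub>FIM X\<^esub> b) \<longleftrightarrow>
      (sinv (FIM X) a \<otimes>\<^bsub>FIM X\<^esub> a, e) \<in> theta_cong X \<R> \<and>
        (sinv (FIM X) b \<otimes>\<^bsub>FIM X\<^esub> b, e) \<in> theta_cong X \<R>"
    if "a \<in> carrier (FIM X)" "b \<in> carrier (FIM X)" "e \<in> idems (FIM X)" for a b e
    using that by (metis FIM.idemsD(1) FIM.m_closed FIM.sinv_closed)
  then show ?thesis unfolding theta_min_def theta.min_cong_def by blast
qed

sublocale tau: inverse_quotient "FIM X" "theta_min X \<R>"
  by (intro inverse_quotient.intro inverse_monoid_FIM monoid_quotient.intro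
      monoid_quotient_axioms.intro theta.min_cong_congruence[folded theta_min_eq] FIM.monoid_axioms)

abbreviation "T \<equiv> T_of X \<R>"
abbreviation "M \<equiv> M_of X \<R>"
abbreviation "t \<equiv> T_word X \<R>"

sublocale T: inverse_monoid T
  using tau.inverse_quotient by (simp add: T_of_def)

lemma carrier_T: "carrier T = tau X \<R> ` carrier (FIM X)"
  using tau.carrier_quotient by (simp add: T_of_def tau_def)

lemma idems_T: "idems T = tau X \<R> ` idems (FIM X)"
  using tau.idems_quotient by (simp add: T_of_def tau_def)

lemma tau_mult: "\<lbrakk>a \<in> carrier (FIM X); b \<in> carrier (FIM X)\<rbrakk> \<Longrightarrow>
    tau X \<R> a \<otimes>\<^bsub>T\<^esub> tau X \<R> b = tau X \<R> (a \<otimes>\<^bsub>FIM X\<^esub> b)"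
  using tau.cl_mult by (simp add: T_of_def tau_def)

lemma sinv_tau: "a \<in> carrier (FIM X) \<Longrightarrow> sinv T (tau X \<R> a) = tau X \<R> (sinv (FIM X) a)"
  using tau.sinv_cl by (simp add: T_of_def tau_def)

lemma theta_eq_iff:
  "\<lbrakk>a \<in> carrier (FIM X); b \<in> carrier (FIM X)\<rbrakk> \<Longrightarrow>
     theta X \<R> a = theta X \<R> b \<longleftrightarrow> (a, b) \<in> theta_cong X \<R>"
  by (simp add: theta_def theta.cl_eq_iff)

lemma tau_eq_iff:
  "\<lbrakk>a \<in> carrier (FIM X); b \<in> carrier (FIM X)\<rbrakk> \<Longrightarrow>
     tau X \<R> a = tau X \<R> b \<longleftrightarrow> (a, b) \<in> theta_min X \<R>"
  by (simp add: tau_def tau.cl_eq_iff)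

lemma psi_tau [simp]: "a \<in> carrier (FIM X) \<Longrightarrow> psi X \<R> (tau X \<R> a) = theta X \<R> a"
  unfolding psi_def
proof (rule the_equality)
  fix m assume a: "a \<in> carrier (FIM X)"
    and "\<exists>b\<in>carrier (FIM X). tau X \<R> b = tau X \<R> a \<and> theta X \<R> b = m"
  then obtain b where b: "b \<in> carrier (FIM X)" "tau X \<R> b = tau X \<R> a" "theta X \<R> b = m"
    by blast
  with a have "(b, a) \<in> theta_cong X \<R>"
    using theta.min_cong_subset by (auto simp: tau_eq_iff theta_min_eq)
  then show "m = theta X \<R> a" using a b theta_eq_iff by blast
qed blast

lemma psi_mult:
  assumes "s \<in> carrier T" "u \<in> carrier T"
  shows "psi X \<R> (s \<otimes>\<^bsub>T\<^esub> u) = psi X \<R> s \<otimes>\<^bsub>M\<^esub> psi X \<R> u"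
  using assms by (auto simp: carrier_T tau_mult M_of_def theta_def)

lemma psi_sinv:
  assumes "s \<in> carrier T"
  shows "psi X \<R> (sinv T s) = sinv M (psi X \<R> s)"
  using assms by (auto simp: carrier_T sinv_tau M_of_def theta_def theta.sinv_cl)

lemma idems_M: "idems M = psi X \<R> ` idems T"
  by (auto simp: idems_T M_of_def theta.idems_quotient theta_def image_image cong: image_cong)

lemma psi_idem_separating:
  assumes "e \<in> idems T" "f \<in> idems T" "psi X \<R> e = psi X \<R> f"
  shows "e = f"
proof -
  obtain a b where ab: "a \<in> idems (FIM X)" "b \<in> idems (FIM X)" "e = tau X \<R> a" "f = tau X \<R> b"
    using assms by (auto simp: idems_T)
  then have "(a, b) \<in> theta_min X \<R>"
    using assms theta.min_cong_idems[of a b] by (simp add: theta_eq_iff theta_min_eq)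
  then show ?thesis using ab by (simp add: tau_eq_iff)
qed

lemma t_closed [simp]: "w \<in> words X \<Longrightarrow> t w \<in> carrier T"
  by (auto simp: T_word_def carrier_T)

lemma t_relator_closed [simp]: "(l, r) \<in> \<R> \<Longrightarrow> t l \<in> carrier T" "(l, r) \<in> \<R> \<Longrightarrow> t r \<in> carrier T"
  using relators_words by auto

lemma t_word_inv_append:
  "\<lbrakk>u \<in> words X; v \<in> words X\<rbrakk> \<Longrightarrow> t (word_inv u @ v) = sinv T (t u) \<otimes>\<^bsub>T\<^esub> t v"
  by (simp add: T_word_def sinv_tau sinv_rho tau_mult)

lemma psi_relator: "(l, r) \<in> \<R> \<Longrightarrow> psi X \<R> (t l) = psi X \<R> (t r)"
  using generated_congruence_contains[of "{(rho X l, rho X r) | l r. (l, r) \<in> \<R>}" "FIM X"] relators_words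
  by (auto simp: T_word_def theta_eq_iff theta_cong_def)

text \<open>The image of a relation in \<open>M\<close> is an equality, and \<open>psi\<close> separates idempotents, so the two
  ends of an edge of the Squier complex are parallel arrows of the groupoid.\<close>

lemma edge_parallel:
  assumes "(l, r) \<in> \<R>" "p \<in> carrier T" "q \<in> carrier T"
  defines "a \<equiv> p \<otimes>\<^bsub>T\<^esub> t l \<otimes>\<^bsub>T\<^esub> q" and "b \<equiv> p \<otimes>\<^bsub>T\<^esub> t r \<otimes>\<^bsub>T\<^esub> q"
  shows "a \<otimes>\<^bsub>T\<^esub> sinv T a = b \<otimes>\<^bsub>T\<^esub> sinv T b" "sinv T a \<otimes>\<^bsub>T\<^esub> a = sinv T b \<otimes>\<^bsub>T\<^esub> b"
proof -
  have ab: "a \<in> carrier T" "b \<in> carrier T" unfolding a_def b_def using assms by auto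
  have "psi X \<R> a = psi X \<R> b" unfolding a_def b_def using assms(1-3) by (simp add: psi_mult psi_relator)
  then have "psi X \<R> (a \<otimes>\<^bsub>T\<^esub> sinv T a) = psi X \<R> (b \<otimes>\<^bsub>T\<^esub> sinv T b)"
    "psi X \<R> (sinv T a \<otimes>\<^bsub>T\<^esub> a) = psi X \<R> (sinv T b \<otimes>\<^bsub>T\<^esub> b)"
    using ab by (simp_all add: psi_mult psi_sinv)
  then show "a \<otimes>\<^bsub>T\<^esub> sinv T a = b \<otimes>\<^bsub>T\<^esub> sinv T b" "sinv T a \<otimes>\<^bsub>T\<^esub> a = sinv T b \<otimes>\<^bsub>T\<^esub> b"
    using ab by (simp_all add: psi_idem_separating)
qed

text \<open>In \<open>M\<close> the two sides of a relation agree, so the inverse of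
  \<open>l\<close> times \<open>r\<close> has the same value there as the idempotent
  \<open>(t l)\<^sup>\<star> \<cdot> t l\<close>. The order condition thus compares images of
  idempotents and lifts to \<open>T\<close> because \<open>psi\<close> separates these.\<close>

lemma basis_set_iff:
  "(l, r, x) \<in> basis_set X \<R> \<longleftrightarrow>
     (l, r) \<in> \<R> \<and> x \<in> idems T \<and> x \<otimes>\<^bsub>T\<^esub> (sinv T (t l) \<otimes>\<^bsub>T\<^esub> t l) = x"
proof -
  have "nat_le M (psi X \<R> x) (psi X \<R> (t (word_inv l @ r))) \<longleftrightarrow>
      x \<otimes>\<^bsub>T\<^esub> (sinv T (t l) \<otimes>\<^bsub>T\<^esub> t l) = x" if lr: "(l, r) \<in> \<R>" and x: "x \<in> idems T"
  proof -
    let ?g = "sinv T (t l) \<otimes>\<^bsub>T\<^esub> t l"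
    have g: "?g \<in> idems T" using lr by simp
    have "psi X \<R> (t (word_inv l @ r)) = psi X \<R> ?g"
      using lr relators_words[OF lr] by (simp add: t_word_inv_append psi_mult psi_relator)
    then have "nat_le M (psi X \<R> x) (psi X \<R> (t (word_inv l @ r))) \<longleftrightarrow>
        (\<exists>f \<in> idems T. psi X \<R> x = psi X \<R> (f \<otimes>\<^bsub>T\<^esub> ?g))"
      using g by (auto simp: nat_le_def idems_M psi_mult)
    also have "\<dots> \<longleftrightarrow> (\<exists>f \<in> idems T. x = f \<otimes>\<^bsub>T\<^esub> ?g)"
      using psi_idem_separating[OF x] g by (metis T.idems_mult)
    also have "\<dots> \<longleftrightarrow> x \<otimes>\<^bsub>T\<^esub> ?g = x"
    proof
      assume "\<exists>f \<in> idems T. x = f \<otimes>\<^bsub>T\<^esub> ?g"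
      then obtain f where "f \<in> idems T" "x = f \<otimes>\<^bsub>T\<^esub> ?g" by blast
      then show "x \<otimes>\<^bsub>T\<^esub> ?g = x" using g T.m_assoc T.idemsD by metis
    next
      assume "x \<otimes>\<^bsub>T\<^esub> ?g = x"
      then show "\<exists>f \<in> idems T. x = f \<otimes>\<^bsub>T\<^esub> ?g" using x by metis
    qed
    finally show ?thesis .
  qed
  then show ?thesis by (auto simp: basis_set_def)
qed

lemma basis_map_eq:
  "(l, r) \<in> \<R> \<Longrightarrow> basis_map X \<R> (l, r, x) = x \<otimes>\<^bsub>T\<^esub> (sinv T (t l) \<otimes>\<^bsub>T\<^esub> t r) \<otimes>\<^bsub>T\<^esub> x"
  by (simp add: basis_map_def t_word_inv_append relators_words)

end

section \<open>Homotopy classes of paths\<close>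

lemma path_from_to_unique: "\<lbrakk>path_from_to K u p v; path_from_to K u p w\<rbrakk> \<Longrightarrow> v = w"
  by (induction K u p v rule: path_from_to.induct) auto

definition rev_path :: "('e \<times> bool) list \<Rightarrow> ('e \<times> bool) list" where
  "rev_path p = rev (map (\<lambda>(e, s). (e, \<not> s)) p)"

lemma rev_path_simps [simp]:
  "rev_path [] = []" "rev_path ((e, s) # p) = rev_path p @ [(e, \<not> s)]"
  by (simp_all add: rev_path_def)

locale complex =
  fixes K :: "('v, 'e) complex2"
  assumes ends: "e \<in> edges K \<Longrightarrow> src K e \<in> verts K" "e \<in> edges K \<Longrightarrow> tgt K e \<in> verts K"
begin

abbreviation "path \<equiv> path_from_to K"
abbreviation "cls u p \<equiv> homotopy K `` {(u, p)}"
abbreviation "\<pi> \<equiv> fundamental_groupoid K"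

lemma path_ends: "path u p v \<Longrightarrow> u \<in> verts K \<and> v \<in> verts K"
proof (induction p arbitrary: u)
  case (Cons a p)
  then show ?case by (cases a) (auto simp: ends)
qed auto

lemma path_append: "path u (p @ q) w \<longleftrightarrow> (\<exists>v. path u p v \<and> path v q w)"
proof (induction p arbitrary: u)
  case Nil
  then show ?case using path_ends by auto
next
  case (Cons a p)
  then show ?case by (cases a) auto
qed

lemma path_appendI: "\<lbrakk>path u p v; path v q w\<rbrakk> \<Longrightarrow> path u (p @ q) w"
  using path_append by blast

lemma path_rev: "path u p v \<Longrightarrow> path v (rev_path p) u"
proof (induction p arbitrary: u)
  case (Cons a p)
  then show ?case by (cases a) (fastforce intro!: path_appendI simp: ends)
qed auto

lemma homotopy_ends:
  "(x, y) \<in> homotopy K \<Longrightarrow>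
     fst x = fst y \<and> (\<exists>v. path (fst x) (snd x) v \<and> path (fst y) (snd y) v)"
proof (induction rule: homotopy.induct)
  case refl
  then show ?case by (auto simp: paths_def)
next
  case sym
  then show ?case by auto
next
  case trans
  then show ?case using path_from_to_unique by metis
next
  case (cancel u a v e s w b z)
  then have "path v ((e, s) # (e, \<not> s) # b) z" by (auto simp: ends split: if_splits)
  then have "path u (a @ (e, s) # (e, \<not> s) # b) z" "path u (a @ b) z"
    using cancel path_appendI by blast+
  then show ?case by (metis fst_conv snd_conv)
next
  case (cell v c c' u a w b z)
  then have "path u (a @ c @ b) z" "path u (a @ c' @ b) z" using path_appendI by blast+
  then show ?case by auto
qed

lemma homotopy_paths:
  "((u, p), (u', p')) \<in> homotopy K \<Longrightarrow> u = u' \<and> (\<exists>v. path u p v \<and> path u' p' v)"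
  using homotopy_ends by fastforce

lemma equiv_homotopy: "equiv (paths K) (homotopy K)"
proof (rule equivI)
  show "homotopy K \<subseteq> paths K \<times> paths K" using homotopy_paths by (auto simp: paths_def) blast+
qed (auto simp: refl_on_def sym_def trans_def intro: homotopy.intros)

lemma in_paths: "path u p v \<Longrightarrow> (u, p) \<in> paths K"
  by (auto simp: paths_def)

lemma cls_self: "path u p v \<Longrightarrow> (u, p) \<in> cls u p"
  using equiv_class_self[OF equiv_homotopy in_paths] .

lemma cls_eqI: "((u, p), (u, q)) \<in> homotopy K \<Longrightarrow> cls u p = cls u q"
  using equiv_class_eq[OF equiv_homotopy] .

lemma cls_eqD: "\<lbrakk>cls u p = cls u q; path u q v\<rbrakk> \<Longrightarrow> ((u, p), (u, q)) \<in> homotopy K"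
  using cls_self by blast

lemma in_clsD:
  assumes "(w, q) \<in> cls u p" "path u p v"
  shows "w = u" "path u q v" "cls u q = cls u p"
proof -
  have h: "((u, p), (w, q)) \<in> homotopy K" using assms by blast
  then show w: "w = u" and "path u q v"
    using homotopy_paths[OF h] path_from_to_unique[OF assms(2)] by auto
  show "cls u q = cls u p" using cls_eqI h w by blast
qed

lemma arrs_pi: "arrs \<pi> = {cls u p | u p v. path u p v}"
  by (auto simp: fundamental_groupoid_def quotient_def paths_def)

lemma gdom_cls [simp]: "path u p v \<Longrightarrow> gdom \<pi> (cls u p) = u"
  unfolding fundamental_groupoid_def groupoid_data.simps
proof (rule the_equality)
  assume p: "path u p v"
  show "\<exists>q. (u, q) \<in> cls u p" using cls_self[OF p] by blast
  show "w = u" if "\<exists>q. (w, q) \<in> cls u p" for w using that in_clsD(1)[OF _ p] by blast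
qed

lemma gran_cls [simp]: "path u p v \<Longrightarrow> gran \<pi> (cls u p) = v"
  unfolding fundamental_groupoid_def groupoid_data.simps
proof (rule the_equality)
  assume p: "path u p v"
  show "\<exists>u' q. (u', q) \<in> cls u p \<and> path u' q v" using cls_self[OF p] p by blast
  fix w assume "\<exists>u' q. (u', q) \<in> cls u p \<and> path u' q w"
  then obtain u' q where "(u', q) \<in> cls u p" "path u' q w" by blast
  then show "w = v" using in_clsD[OF _ p, of u' q] path_from_to_unique[of K u' q] by simp
qed

lemma homotopy_append_left:
  "\<lbrakk>(x, y) \<in> homotopy K; path u a (fst x)\<rbrakk> \<Longrightarrow> ((u, a @ snd x), (u, a @ snd y)) \<in> homotopy K"
proof (induction rule: homotopy.induct)
  case refl
  then show ?case by (auto simp: paths_def intro!: homotopy.refl path_appendI)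
next
  case sym
  then show ?case using homotopy_ends homotopy.sym by metis
next
  case trans
  then show ?case using homotopy_ends homotopy.trans by metis
next
  case (cancel v b x e s w c z)
  then have "path u (a @ b) x" using path_appendI by simp
  from homotopy.cancel[OF this cancel(2,3)] show ?case by simp
next
  case (cell x c c' v b w d z)
  then have "path u (a @ b) x" using path_appendI by simp
  from homotopy.cell[OF cell(1) this cell(3-5)] show ?case by simp
qed

lemma homotopy_append_right:
  "\<lbrakk>(x, y) \<in> homotopy K; path (fst x) (snd x) v; path v a z\<rbrakk> \<Longrightarrow>
     ((fst x, snd x @ a), (fst y, snd y @ a)) \<in> homotopy K"
proof (induction rule: homotopy.induct)
  case refl
  then show ?case by (auto simp: paths_def intro!: homotopy.refl path_appendI)
next
  case (sym x y)
  then have "path (fst x) (snd x) v" using homotopy_ends path_from_to_unique by metis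
  then show ?case using sym homotopy.sym by blast
next
  case (trans x y z)
  then have "path (fst y) (snd y) v" using homotopy_ends path_from_to_unique by metis
  then show ?case using trans homotopy.trans by blast
next
  case (cancel u b x e s w c y)
  have "path x ((e, s) # (e, \<not> s) # c) y"
    using cancel(2,3) by (auto simp: ends split: if_splits)
  from path_appendI[OF cancel(1) this] have "y = v"
    using cancel.prems path_from_to_unique by (metis fst_conv snd_conv)
  then have "path x (c @ a) z" using cancel path_appendI by blast
  from homotopy.cancel[OF cancel(1,2) this] show ?case by simp
next
  case (cell x c c' u b w d y)
  have "path u (b @ c @ d) y" using cell(2,3,5) path_appendI by blast
  then have "y = v" using cell.prems path_from_to_unique by (metis fst_conv snd_conv)
  then have "path w (d @ a) z" using cell path_appendI by blast
  from homotopy.cell[OF cell(1-4) this] show ?case by simp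
qed

text \<open>Only one representative in each pair has to be known as a path with given ends; homotopy
  transfers the ends to the other.\<close>

lemma cls_append:
  assumes "cls u p = cls u p'" "cls v q = cls v q'" "path u p' v" "path v q' w"
  shows "cls u (p @ q) = cls u (p' @ q')"
proof -
  have p: "((u, p), (u, p')) \<in> homotopy K" and q: "((v, q), (v, q')) \<in> homotopy K"
    using assms cls_eqD by blast+
  then have "path u p v" "path v q w"
    using homotopy_paths[OF p] homotopy_paths[OF q] assms path_from_to_unique by metis+
  then have "((u, p @ q), (u, p' @ q)) \<in> homotopy K" "((u, p' @ q), (u, p' @ q')) \<in> homotopy K"
    using homotopy_append_right[OF p] homotopy_append_left[OF q] assms \<open>path u p v\<close> \<open>path v q w\<close>
    by auto
  then show ?thesis using cls_eqI by simp
qed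

lemma cls_append_left:
  "\<lbrakk>cls v q = cls v q'; path u p v; path v q' w\<rbrakk> \<Longrightarrow> cls u (p @ q) = cls u (p @ q')"
  using cls_append by blast

lemma cls_append_right:
  "\<lbrakk>cls u p = cls u p'; path u p' v; path v q w\<rbrakk> \<Longrightarrow> cls u (p @ q) = cls u (p' @ q)"
  using cls_append by blast

lemma gcomp_cls:
  assumes "path u p v" "path v q w"
  shows "gcomp \<pi> (cls u p) (cls v q) = cls u (p @ q)"
proof -
  let ?A = "{(u', p' @ q') | u' p' v' q'. (u', p') \<in> cls u p \<and> path u' p' v' \<and> (v', q') \<in> cls v q}"
  have mem: "(u, p @ q) \<in> ?A" using assms cls_self by blast
  have "homotopy K `` {x} = cls u (p @ q)" if "x \<in> ?A" for x
  proof -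
    obtain u' p' v' q' where x: "x = (u', p' @ q')" "(u', p') \<in> cls u p" "path u' p' v'"
      "(v', q') \<in> cls v q" using \<open>x \<in> ?A\<close> by blast
    note P = in_clsD[OF x(2) assms(1)] and Q = in_clsD[OF x(4) assms(2)]
    show ?thesis using cls_append[OF P(3) Q(3) assms] x(1) P(1) by simp
  qed
  then have "homotopy K `` ?A = cls u (p @ q)" using mem by blast
  then show ?thesis by (simp add: fundamental_groupoid_def)
qed

lemma gid_pi: "gid \<pi> u = cls u []"
  by (simp add: fundamental_groupoid_def)

lemma cls_cancel:
  assumes "path u a v" "path v [(e, s)] w" "path v b z"
  shows "cls u (a @ (e, s) # (e, \<not> s) # b) = cls u (a @ b)"
  by (rule cls_eqI, rule homotopy.cancel[OF assms])

lemma cls_rev_path: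
  assumes "path u p v" shows "cls u (p @ rev_path p) = cls u []"
  using assms
proof (induction p arbitrary: u)
  case (Cons a p)
  obtain e s where a: "a = (e, s)" by (cases a)
  let ?w = "if s then tgt K e else src K e"
  have e: "path u [(e, s)] ?w" "path ?w [(e, \<not> s)] u" "path ?w p v"
    using Cons.prems a by (auto simp: ends)
  have "cls ?w ((p @ rev_path p) @ [(e, \<not> s)]) = cls ?w ([] @ [(e, \<not> s)])"
    using Cons.IH[OF e(3)] e path_ends by (intro cls_append[of ?w _ _ ?w _ _ u]) auto
  then have "cls u ([(e, s)] @ ((p @ rev_path p) @ [(e, \<not> s)])) = cls u ([(e, s)] @ [(e, \<not> s)])"
    using e(1,2) path_ends[OF e(2)] by (intro cls_append[of u _ _ ?w _ _ u]) simp_all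
  also have "\<dots> = cls u []"
    using cls_cancel[of u "[]" u e s ?w "[]" u] e path_ends by auto
  finally show ?case by (simp add: a)
qed auto

lemma rev_path_rev_path [simp]: "rev_path (rev_path p) = p"
  by (induction p) (auto simp: rev_path_def)

lemma cls_rev_path_left:
  assumes "path u p v" shows "cls v (rev_path p @ p) = cls v []"
  using cls_rev_path[OF path_rev[OF assms]] by simp

lemma cls_replace:
  assumes "cls v p = cls v p'" "path u a v" "path v p' w" "path w b z"
  shows "cls u (a @ p @ b) = cls u (a @ p' @ b)"
proof -
  have "cls v (p @ b) = cls v (p' @ b)" using assms by (intro cls_append[of v _ _ w _ _ z]) auto
  then show ?thesis using assms path_appendI by (intro cls_append[of u _ _ v _ _ z]) auto
qed

text \<open>The 2-cells speak of forward edges only; this reverses one pair of opposite sides of a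
  square that commutes up to homotopy. The path \<open>a'\<close> and its reverse are inserted at
  the end, the square is applied, and \<open>a\<close> cancels against its reverse.\<close>

lemma square_rev:
  assumes "path u a x" "path x b' y" "path u b z" "path z a' y" "cls u (a @ b') = cls u (b @ a')"
  shows "cls x (rev_path a @ b) = cls x (b' @ rev_path a')"
proof -
  note rev = path_rev[OF assms(1)] path_rev[OF assms(4)]
  have v: "x \<in> verts K" "z \<in> verts K" using path_ends assms by blast+
  have "cls x ((rev_path a @ b) @ (a' @ rev_path a') @ []) = cls x ((rev_path a @ b) @ [] @ [])"
    using assms rev v cls_rev_path[OF assms(4)] path_appendI
    by (intro cls_replace[of z _ _ _ _ z _ z]) auto
  then have "cls x (rev_path a @ b) = cls x (rev_path a @ (b @ a') @ rev_path a')" by simp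
  also have "\<dots> = cls x (rev_path a @ (a @ b') @ rev_path a')"
    using assms(1,2,5) rev path_appendI by (intro cls_replace[of u _ _ _ _ y _ z]) auto
  also have "\<dots> = cls x ([] @ (rev_path a @ a) @ (b' @ rev_path a'))" by simp
  also have "\<dots> = cls x ([] @ [] @ (b' @ rev_path a'))"
    using assms(2) rev v cls_rev_path_left[OF assms(1)] path_appendI
    by (intro cls_replace[of x _ _ _ _ x _ z]) auto
  finally show ?thesis by simp
qed

section \<open>Cellular self-maps and their effect on homotopy classes\<close>

definition edge_map :: "('e \<Rightarrow> 'e) \<Rightarrow> ('e \<times> bool) list \<Rightarrow> ('e \<times> bool) list" where
  "edge_map g p = map (apfst g) p"

lemma edge_map_simps [simp]:
  "edge_map g [] = []" "edge_map g ((e, s) # p) = (g e, s) # edge_map g p"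
  "edge_map g (p @ q) = edge_map g p @ edge_map g q"
  by (simp_all add: edge_map_def)

lemma edge_map_rev_path: "edge_map g (rev_path p) = rev_path (edge_map g p)"
  by (induction p) auto

text \<open>Left and right multiplication by an element of \<open>T\<close> are both of this kind,
  so that both actions on homotopy classes are covered at once.\<close>

definition endo :: "('v \<Rightarrow> 'v) \<Rightarrow> ('e \<Rightarrow> 'e) \<Rightarrow> bool" where
  "endo f g \<longleftrightarrow> (\<forall>v \<in> verts K. f v \<in> verts K) \<and>
     (\<forall>e \<in> edges K. g e \<in> edges K \<and> src K (g e) = f (src K e) \<and> tgt K (g e) = f (tgt K e)) \<and>
     (\<forall>v c c'. (v, c, c') \<in> cells K \<longrightarrow> (f v, edge_map g c, edge_map g c') \<in> cells K)"

lemma path_edge_map: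
  assumes "endo f g" shows "path u p v \<Longrightarrow> path (f u) (edge_map g p) (f v)"
proof (induction p arbitrary: u)
  case Nil
  then show ?case using assms by (auto simp: endo_def)
next
  case (Cons a p)
  then show ?case using assms by (cases a) (auto simp: endo_def)
qed

lemma homotopy_edge_map:
  assumes "endo f g"
  shows "(x, y) \<in> homotopy K \<Longrightarrow>
    ((f (fst x), edge_map g (snd x)), (f (fst y), edge_map g (snd y))) \<in> homotopy K"
proof (induction rule: homotopy.induct)
  case (refl x)
  then obtain v where "path (fst x) (snd x) v" by (auto simp: paths_def)
  from in_paths[OF path_edge_map[OF assms this]] show ?case by (rule homotopy.refl)
next
  case sym
  then show ?case using homotopy.sym by blast
next
  case trans
  then show ?case by (blast intro: homotopy.trans)
next
  case (cancel u a v e s w b z)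
  from homotopy.cancel[OF cancel[THEN path_edge_map[OF assms], unfolded edge_map_simps]]
  show ?case by simp
next
  case (cell v c c' u a w b z)
  have "(f v, edge_map g c, edge_map g c') \<in> cells K" using cell assms by (auto simp: endo_def)
  from homotopy.cell[OF this cell(2-5)[THEN path_edge_map[OF assms]]]
  show ?case by simp
qed

lemma cls_edge_map_cong:
  assumes "endo f g" "cls u p = cls u q" "path u q v"
  shows "cls (f u) (edge_map g p) = cls (f u) (edge_map g q)"
  using homotopy_edge_map[OF assms(1) cls_eqD[OF assms(2,3)]] cls_eqI by simp

text \<open>The left side has the shape in which \<open>lact\<close> and \<open>ract\<close> are
  defined: all representatives are mapped and the result is closed under homotopy.\<close>

lemma cls_edge_map:
  assumes "endo f g" "path u p v"
  shows "homotopy K `` ((\<lambda>(u, p). (f u, edge_map g p)) ` cls u p) = cls (f u) (edge_map g p)"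
proof -
  let ?h = "\<lambda>(u, p). (f u, edge_map g p)"
  have "homotopy K `` {?h x} = cls (f u) (edge_map g p)" if "x \<in> cls u p" for x
  proof -
    obtain w q where x: "x = (w, q)" by (cases x)
    note P = in_clsD[OF that[unfolded x] assms(2)]
    show ?thesis using cls_edge_map_cong[OF assms(1) P(3) assms(2)] P(1) x by simp
  qed
  then show ?thesis using cls_self[OF assms(2)] by blast
qed

end

section \<open>Vertex groups of the groupoid\<close>

context inverse_monoid
begin

text \<open>The group H-class of \<open>e\<close>, that is, the vertex group at \<open>e\<close> of
  the groupoid of the inverse monoid; it is empty unless \<open>e\<close> is idempotent.\<close>

definition H_class :: "'a \<Rightarrow> 'a set" where
  "H_class e = {s \<in> carrier S. s \<otimes> s\<^sup>\<star> = e \<and> s\<^sup>\<star> \<otimes> s = e}"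

lemma H_classD:
  assumes "s \<in> H_class e"
  shows "s \<in> carrier S" "s \<otimes> s\<^sup>\<star> = e" "s\<^sup>\<star> \<otimes> s = e" "e \<in> idems S" "e \<otimes> s = s" "s \<otimes> e = s"
    "s\<^sup>\<star> \<otimes> e = s\<^sup>\<star>" "e \<otimes> s\<^sup>\<star> = s\<^sup>\<star>"
proof -
  show s: "s \<in> carrier S" "s \<otimes> s\<^sup>\<star> = e" "s\<^sup>\<star> \<otimes> s = e" using assms by (auto simp: H_class_def)
  then show "e \<in> idems S" using dom_idem by metis
  have "(s \<otimes> s\<^sup>\<star>) \<otimes> s = s" "s \<otimes> (s\<^sup>\<star> \<otimes> s) = s" "s\<^sup>\<star> \<otimes> (s \<otimes> s\<^sup>\<star>) = s\<^sup>\<star>" "(s\<^sup>\<star> \<otimes> s) \<otimes> s\<^sup>\<star> = s\<^sup>\<star>"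
    using s(1) by (simp_all add: m_assoc)
  then show "e \<otimes> s = s" "s \<otimes> e = s" "s\<^sup>\<star> \<otimes> e = s\<^sup>\<star>" "e \<otimes> s\<^sup>\<star> = s\<^sup>\<star>" using s by simp_all
qed

lemma H_class_self: "e \<in> idems S \<Longrightarrow> e \<in> H_class e"
  by (simp add: H_class_def)

lemma H_class_sinv: "s \<in> H_class e \<Longrightarrow> s\<^sup>\<star> \<in> H_class e"
  by (simp add: H_class_def)

lemma H_class_mult:
  assumes "s \<in> H_class e" "v \<in> H_class e" shows "s \<otimes> v \<in> H_class e"
proof -
  note s = H_classD[OF assms(1)] and v = H_classD[OF assms(2)]
  have "s \<otimes> v \<otimes> (s \<otimes> v)\<^sup>\<star> = s \<otimes> (v \<otimes> v\<^sup>\<star>) \<otimes> s\<^sup>\<star>" using s(1) v(1) by (simp add: m_assoc)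
  moreover have "(s \<otimes> v)\<^sup>\<star> \<otimes> (s \<otimes> v) = v\<^sup>\<star> \<otimes> (s\<^sup>\<star> \<otimes> s) \<otimes> v" using s(1) v(1) by (simp add: m_assoc)
  ultimately show ?thesis using s v by (simp add: H_class_def)
qed

text \<open>The domain of a product lies below that of its first factor and its range below that of
  its last, while \<open>e\<close> bounds both from the other side; this gives the two outer
  equalities. Each of the two middle idempotents then lies below the other. So \<open>p\<close> and
  \<open>u\<close> are composable arrows of the groupoid.\<close>

lemma H_class_factor:
  assumes "p \<in> carrier S" "u \<in> carrier S" "e \<otimes> p = p" "u \<otimes> e = u" "p \<otimes> u \<in> H_class e"
  shows "p \<otimes> p\<^sup>\<star> = e" "u\<^sup>\<star> \<otimes> u = e" "p\<^sup>\<star> \<otimes> p = u \<otimes> u\<^sup>\<star>"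
proof -
  note H = H_classD[OF assms(5)]
  have "e = p \<otimes> u \<otimes> (p \<otimes> u)\<^sup>\<star>" using H by simp
  also have "\<dots> = p \<otimes> p\<^sup>\<star> \<otimes> (p \<otimes> u \<otimes> (p \<otimes> u)\<^sup>\<star>)" using assms(1,2) by (simp add: m_assoc)
  also have "\<dots> = p \<otimes> p\<^sup>\<star> \<otimes> e" using H by simp
  also have "\<dots> = e \<otimes> (p \<otimes> p\<^sup>\<star>)" using assms H by (intro idems_commute) auto
  also have "\<dots> = p \<otimes> p\<^sup>\<star>" using assms H by (metis m_assoc sinv_closed idemsD(1))
  finally show pp: "p \<otimes> p\<^sup>\<star> = e" by simp
  have "e = (p \<otimes> u)\<^sup>\<star> \<otimes> (p \<otimes> u)" using H by simp
  also have "\<dots> = (p \<otimes> u)\<^sup>\<star> \<otimes> (p \<otimes> u) \<otimes> (u\<^sup>\<star> \<otimes> u)" using assms(1,2) by (simp add: m_assoc)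
  also have "\<dots> = e \<otimes> (u\<^sup>\<star> \<otimes> u)" using H by simp
  also have "\<dots> = (u\<^sup>\<star> \<otimes> u) \<otimes> e" using assms H by (intro idems_commute) auto
  also have "\<dots> = u\<^sup>\<star> \<otimes> u" using assms H by (simp add: m_assoc)
  finally show uu: "u\<^sup>\<star> \<otimes> u = e" by simp
  have "p\<^sup>\<star> \<otimes> p = p\<^sup>\<star> \<otimes> (e \<otimes> p)" using assms by simp
  also have "\<dots> = p\<^sup>\<star> \<otimes> ((p \<otimes> u \<otimes> (p \<otimes> u)\<^sup>\<star>) \<otimes> p)" using H by simp
  also have "\<dots> = (p\<^sup>\<star> \<otimes> p) \<otimes> ((u \<otimes> u\<^sup>\<star>) \<otimes> (p\<^sup>\<star> \<otimes> p))" using assms(1,2) by (simp add: m_assoc)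
  also have "\<dots> = (u \<otimes> u\<^sup>\<star>) \<otimes> (p\<^sup>\<star> \<otimes> p)"
    using assms(1,2) by (subst idems_left_commute) (simp_all add: m_assoc)
  finally have 1: "p\<^sup>\<star> \<otimes> p = (u \<otimes> u\<^sup>\<star>) \<otimes> (p\<^sup>\<star> \<otimes> p)" .
  have "u \<otimes> u\<^sup>\<star> = (u \<otimes> e) \<otimes> u\<^sup>\<star>" using assms by simp
  also have "\<dots> = (u \<otimes> ((p \<otimes> u)\<^sup>\<star> \<otimes> (p \<otimes> u))) \<otimes> u\<^sup>\<star>" using H by simp
  also have "\<dots> = (u \<otimes> u\<^sup>\<star>) \<otimes> ((p\<^sup>\<star> \<otimes> p) \<otimes> (u \<otimes> u\<^sup>\<star>))" using assms(1,2) by (simp add: m_assoc)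
  also have "\<dots> = (u \<otimes> u\<^sup>\<star>) \<otimes> ((u \<otimes> u\<^sup>\<star>) \<otimes> (p\<^sup>\<star> \<otimes> p))"
    using assms(1,2) by (subst idems_commute[of "p\<^sup>\<star> \<otimes> p"]) simp_all
  also have "\<dots> = (u \<otimes> u\<^sup>\<star>) \<otimes> (p\<^sup>\<star> \<otimes> p)" using assms(1,2) by (simp add: m_assoc)
  finally show "p\<^sup>\<star> \<otimes> p = u \<otimes> u\<^sup>\<star>" using 1 by simp
qed

end

section \<open>The Squier complex\<close>

context presentation
begin

abbreviation tmult :: "'x T_elt \<Rightarrow> 'x T_elt \<Rightarrow> 'x T_elt" (infixl \<open>\<cdot>\<close> 70) where
  "a \<cdot> b \<equiv> a \<otimes>\<^bsub>T\<^esub> b"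
abbreviation tinv :: "'x T_elt \<Rightarrow> 'x T_elt" (\<open>_\<^sup>\<star>\<close> [1000] 1000) where
  "a\<^sup>\<star> \<equiv> sinv T a"
abbreviation "K \<equiv> Squier X \<R>"

lemma Squier_simps [simp]:
  "verts K = carrier T"
  "(x, l, r, y) \<in> edges K \<longleftrightarrow> x \<in> carrier T \<and> (l, r) \<in> \<R> \<and> y \<in> carrier T"
  "src K (x, l, r, y) = x \<cdot> t l \<cdot> y"
  "tgt K (x, l, r, y) = x \<cdot> t r \<cdot> y"
  by (auto simp: Squier_def Let_def)

lemma cellI:
  assumes "p \<in> carrier T" "q \<in> carrier T" "p' \<in> carrier T" "q' \<in> carrier T"
    "(l, r) \<in> \<R>" "(l', r') \<in> \<R>"
  shows "(p \<cdot> t l \<cdot> q \<cdot> p' \<cdot> t l' \<cdot> q',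
          [((p, l, r, q \<cdot> p' \<cdot> t l' \<cdot> q'), True), ((p \<cdot> t r \<cdot> q \<cdot> p', l', r', q'), True)],
          [((p \<cdot> t l \<cdot> q \<cdot> p', l', r', q'), True), ((p, l, r, q \<cdot> p' \<cdot> t r' \<cdot> q'), True)])
    \<in> cells K"
  unfolding Squier_def Let_def complex2.simps using assms by blast

lemma cellE:
  assumes "(v, c, c') \<in> cells K"
  obtains p l r q p' l' r' q' where
    "p \<in> carrier T" "q \<in> carrier T" "p' \<in> carrier T" "q' \<in> carrier T"
    "(l, r) \<in> \<R>" "(l', r') \<in> \<R>" "v = p \<cdot> t l \<cdot> q \<cdot> p' \<cdot> t l' \<cdot> q'"
    "c = [((p, l, r, q \<cdot> p' \<cdot> t l' \<cdot> q'), True), ((p \<cdot> t r \<cdot> q \<cdot> p', l', r', q'), True)]"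
    "c' = [((p \<cdot> t l \<cdot> q \<cdot> p', l', r', q'), True), ((p, l, r, q \<cdot> p' \<cdot> t r' \<cdot> q'), True)]"
  using assms unfolding Squier_def Let_def complex2.simps by blast

sublocale Sq: complex K
  by unfold_locales auto

lemma Sq_pi: "Sq_pi X \<R> = Sq.\<pi>"
  by (simp add: Sq_pi_def)

definition lmul :: "'x T_elt \<Rightarrow> 'x sq_edge \<Rightarrow> 'x sq_edge" where
  "lmul s = (\<lambda>(a, l, r, b). (s \<cdot> a, l, r, b))"

definition rmul :: "'x T_elt \<Rightarrow> 'x sq_edge \<Rightarrow> 'x sq_edge" where
  "rmul s = (\<lambda>(a, l, r, b). (a, l, r, b \<cdot> s))"

lemma lmul_rmul_simps [simp]:
  "lmul s (a, l, r, b) = (s \<cdot> a, l, r, b)" "rmul s (a, l, r, b) = (a, l, r, b \<cdot> s)"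
  by (simp_all add: lmul_def rmul_def)

abbreviation "lpath s p \<equiv> Sq.edge_map (lmul s) p"
abbreviation "rpath p s \<equiv> Sq.edge_map (rmul s) p"

lemma endo_lmul: assumes "s \<in> carrier T" shows "Sq.endo (\<lambda>u. s \<cdot> u) (lmul s)"
  unfolding Sq.endo_def
proof (intro conjI ballI allI impI)
  fix v c c' assume "(v, c, c') \<in> cells K"
  then obtain p l r q p' l' r' q' where *:
    "p \<in> carrier T" "q \<in> carrier T" "p' \<in> carrier T" "q' \<in> carrier T"
    "(l, r) \<in> \<R>" "(l', r') \<in> \<R>" "v = p \<cdot> t l \<cdot> q \<cdot> p' \<cdot> t l' \<cdot> q'"
    "c = [((p, l, r, q \<cdot> p' \<cdot> t l' \<cdot> q'), True), ((p \<cdot> t r \<cdot> q \<cdot> p', l', r', q'), True)]"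
    "c' = [((p \<cdot> t l \<cdot> q \<cdot> p', l', r', q'), True), ((p, l, r, q \<cdot> p' \<cdot> t r' \<cdot> q'), True)]"
    by (rule cellE)
  show "(s \<cdot> v, lpath s c, lpath s c') \<in> cells K"
    using cellI[of "s \<cdot> p" q p' q' l r l' r'] * assms by (simp add: T.m_assoc)
qed (use assms in \<open>auto simp: T.m_assoc\<close>)

lemma endo_rmul: assumes "s \<in> carrier T" shows "Sq.endo (\<lambda>u. u \<cdot> s) (rmul s)"
  unfolding Sq.endo_def
proof (intro conjI ballI allI impI)
  fix v c c' assume "(v, c, c') \<in> cells K"
  then obtain p l r q p' l' r' q' where *:
    "p \<in> carrier T" "q \<in> carrier T" "p' \<in> carrier T" "q' \<in> carrier T"
    "(l, r) \<in> \<R>" "(l', r') \<in> \<R>" "v = p \<cdot> t l \<cdot> q \<cdot> p' \<cdot> t l' \<cdot> q'"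
    "c = [((p, l, r, q \<cdot> p' \<cdot> t l' \<cdot> q'), True), ((p \<cdot> t r \<cdot> q \<cdot> p', l', r', q'), True)]"
    "c' = [((p \<cdot> t l \<cdot> q \<cdot> p', l', r', q'), True), ((p, l, r, q \<cdot> p' \<cdot> t r' \<cdot> q'), True)]"
    by (rule cellE)
  show "(v \<cdot> s, rpath c s, rpath c' s) \<in> cells K"
    using cellI[of p q p' "q' \<cdot> s" l r l' r'] * assms by (simp add: T.m_assoc)
qed (use assms in \<open>auto simp: T.m_assoc\<close>)

lemmas path_lpath = Sq.path_edge_map[OF endo_lmul]
lemmas path_rpath = Sq.path_edge_map[OF endo_rmul]

lemma lact_cls:
  assumes "s \<in> carrier T" "Sq.path u p v"
  shows "lact X \<R> s (Sq.cls u p) = Sq.cls (s \<cdot> u) (lpath s p)"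
proof -
  have "(\<lambda>(u, p). (s \<cdot> u, map (\<lambda>((a, l, r, b), \<epsilon>). ((s \<cdot> a, l, r, b), \<epsilon>)) p)) =
      (\<lambda>(u, p). (s \<cdot> u, lpath s p))"
    by (auto simp: fun_eq_iff Sq.edge_map_def intro!: map_cong)
  then show ?thesis
    using Sq.cls_edge_map[OF endo_lmul[OF assms(1)] assms(2)] by (simp only: lact_def)
qed

lemma ract_cls:
  assumes "s \<in> carrier T" "Sq.path u p v"
  shows "ract X \<R> (Sq.cls u p) s = Sq.cls (u \<cdot> s) (rpath p s)"
proof -
  have "(\<lambda>(u, p). (u \<cdot> s, map (\<lambda>((a, l, r, b), \<epsilon>). ((a, l, r, b \<cdot> s), \<epsilon>)) p)) =
      (\<lambda>(u, p). (u \<cdot> s, rpath p s))"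
    by (auto simp: fun_eq_iff Sq.edge_map_def intro!: map_cong)
  then show ?thesis
    using Sq.cls_edge_map[OF endo_rmul[OF assms(1)] assms(2)] by (simp only: ract_def)
qed

lemma path_edges:
  "Sq.path u p v \<Longrightarrow> ((x, l, r, y), \<epsilon>) \<in> set p \<Longrightarrow> x \<in> carrier T \<and> (l, r) \<in> \<R> \<and> y \<in> carrier T"
proof (induction p arbitrary: u)
  case (Cons a p)
  then show ?case by (cases a) auto
qed auto

lemma edge_map_cong:
  assumes "\<And>x l r y \<epsilon>. ((x, l, r, y), \<epsilon>) \<in> set p \<Longrightarrow> f (x, l, r, y) = g (x, l, r, y)"
  shows "Sq.edge_map f p = Sq.edge_map g p"
  unfolding Sq.edge_map_def by (rule map_cong) (use assms in \<open>auto\<close>)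

lemma lpath_lpath:
  assumes "Sq.path u p v" "s \<in> carrier T" "s' \<in> carrier T"
  shows "lpath s (lpath s' p) = lpath (s \<cdot> s') p"
  unfolding Sq.edge_map_def map_map
  by (rule map_cong) (use path_edges[OF assms(1)] assms(2,3) in \<open>auto simp: T.m_assoc\<close>)

lemma rpath_rpath:
  assumes "Sq.path u p v" "s \<in> carrier T" "s' \<in> carrier T"
  shows "rpath (rpath p s) s' = rpath p (s \<cdot> s')"
  unfolding Sq.edge_map_def map_map
  by (rule map_cong) (use path_edges[OF assms(1)] assms(2,3) in \<open>auto simp: T.m_assoc\<close>)

lemma lpath_rpath: "lpath s (rpath p s') = rpath (lpath s p) s'"
  unfolding Sq.edge_map_def map_map by (rule map_cong) auto

section \<open>Interchange of disjoint rewriting paths\<close>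

lemma interchange_forward:
  assumes "Sq.path u [(E, True)] u'" "Sq.path v [(E', True)] v'"
  shows "Sq.cls (u \<cdot> v) (rpath [(E, True)] v @ lpath u' [(E', True)]) =
    Sq.cls (u \<cdot> v) (lpath u [(E', True)] @ rpath [(E, True)] v')"
proof -
  obtain p l r q p' l' r' q' where E: "E = (p, l, r, q)" "E' = (p', l', r', q')"
    by (metis prod_cases4)
  have *: "p \<in> carrier T" "q \<in> carrier T" "p' \<in> carrier T" "q' \<in> carrier T"
    "(l, r) \<in> \<R>" "(l', r') \<in> \<R>"
    and u: "u = p \<cdot> t l \<cdot> q" "u' = p \<cdot> t r \<cdot> q" "v = p' \<cdot> t l' \<cdot> q'" "v' = p' \<cdot> t r' \<cdot> q'"
    using assms by (auto simp: E)
  let ?c = "rpath [(E, True)] v @ lpath u' [(E', True)]"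
  let ?c' = "lpath u [(E', True)] @ rpath [(E, True)] v'"
  have cell: "(u \<cdot> v, ?c, ?c') \<in> cells K"
    using cellI[OF *] * by (simp add: E u T.m_assoc)
  have vs: "u \<in> carrier T" "u' \<in> carrier T" "v \<in> carrier T" "v' \<in> carrier T" using * u by auto
  have "Sq.path (u \<cdot> v) ?c (u' \<cdot> v')"
    using path_rpath[OF vs(3) assms(1)] path_lpath[OF vs(2) assms(2)] by (rule Sq.path_appendI)
  moreover have "Sq.path (u \<cdot> v) ?c' (u' \<cdot> v')"
    using path_lpath[OF vs(1) assms(2)] path_rpath[OF vs(4) assms(1)] by (rule Sq.path_appendI)
  moreover have "Sq.path (u \<cdot> v) [] (u \<cdot> v)" "Sq.path (u' \<cdot> v') [] (u' \<cdot> v')" using vs by auto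
  ultimately have "((u \<cdot> v, [] @ ?c @ []), (u \<cdot> v, [] @ ?c' @ [])) \<in> homotopy K"
    using homotopy.cell[OF cell] by blast
  then have "((u \<cdot> v, ?c), (u \<cdot> v, ?c')) \<in> homotopy K" by simp
  then show ?thesis by (rule Sq.cls_eqI)
qed

lemma path_flip: "Sq.path v [(E, False)] u \<longleftrightarrow> Sq.path u [(E, True)] v"
  by (auto dest: Sq.ends simp del: Squier_simps)

lemma path_carrier: "Sq.path u p v \<Longrightarrow> u \<in> carrier T" "Sq.path u p v \<Longrightarrow> v \<in> carrier T"
  using Sq.path_ends by simp_all

text \<open>Reversed edges are reached from the forward case by \<open>square_rev\<close>: first the
  sides of the square that come from \<open>E\<close> are reversed, then those from
  \<open>E'\<close>.\<close>

lemma interchange_edges: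
  assumes "Sq.path u [(E, s)] u'" "Sq.path v [(E', s')] v'"
  shows "Sq.cls (u \<cdot> v) (rpath [(E, s)] v @ lpath u' [(E', s')]) =
    Sq.cls (u \<cdot> v) (lpath u [(E', s')] @ rpath [(E, s)] v')"
proof -
  have rev: "rev_path (rpath [(E, True)] w) = rpath [(E, False)] w"
    "rev_path (lpath w [(E', True)]) = lpath w [(E', False)]" for w
    by (simp_all flip: Sq.edge_map_rev_path)
  have 1: "Sq.cls (u \<cdot> v) (rpath [(E, s)] v @ lpath u' [(E', True)]) =
      Sq.cls (u \<cdot> v) (lpath u [(E', True)] @ rpath [(E, s)] v')"
    if "Sq.path u [(E, s)] u'" "Sq.path v [(E', True)] v'" for u u' v v'
  proof (cases s)
    case True
    then show ?thesis using that interchange_forward[of u E u' v E' v'] by (simp only: True)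
  next
    case False
    then have E: "Sq.path u' [(E, True)] u" using that(1) path_flip by (simp only: False)
    note c = path_carrier[OF E] path_carrier[OF that(2)]
    show ?thesis
      using Sq.square_rev[OF path_rpath[OF c(3) E] path_lpath[OF c(2) that(2)]
          path_lpath[OF c(1) that(2)] path_rpath[OF c(4) E] interchange_forward[OF E that(2)]]
      False by (simp only: rev)
  qed
  show ?thesis
  proof (cases s')
    case True
    then show ?thesis using 1[OF assms(1), of v v'] assms(2) by (simp only: True)
  next
    case False
    then have E': "Sq.path v' [(E', True)] v" using assms(2) path_flip by (simp only: False)
    note c = path_carrier[OF assms(1)] path_carrier[OF E']
    show ?thesis
      using Sq.square_rev[OF path_lpath[OF c(1) E'] path_rpath[OF c(4) assms(1)]
          path_rpath[OF c(3) assms(1)] path_lpath[OF c(2) E'] 1[OF assms(1) E', symmetric]]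
      False by (simp only: rev)
  qed
qed

text \<open>Squares are pasted in a row for a single edge against \<open>q\<close>, then the rows
  are pasted along \<open>p\<close>. The result is the source of the Peiffer identity for
  \<open>S_bowtie\<close>.\<close>

lemma interchange:
  assumes "Sq.path u p u'" "Sq.path v q v'"
  shows "Sq.cls (u \<cdot> v) (rpath p v @ lpath u' q) = Sq.cls (u \<cdot> v) (lpath u q @ rpath p v')"
proof -
  have 1: "Sq.cls (u \<cdot> v) (rpath [a] v @ lpath u' q) = Sq.cls (u \<cdot> v) (lpath u q @ rpath [a] v')"
    if "Sq.path u [a] u'" "Sq.path v q v'" for u u' v a
    using that(2)
  proof (induction q arbitrary: v)
    case Nil
    then show ?case by simp
  next
    case (Cons b q)
    obtain E s E' s' where ab: "a = (E, s)" "b = (E', s')" by (cases a, cases b)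
    obtain w where w: "Sq.path v [b] w" "Sq.path w q v'"
      using Sq.path_append[of v "[b]" q v'] Cons.prems by auto
    note c = path_carrier[OF that(1)] path_carrier[OF w(1)] path_carrier[OF w(2)]
    have "Sq.cls (u \<cdot> v) ((rpath [a] v @ lpath u' [b]) @ lpath u' q) =
        Sq.cls (u \<cdot> v) ((lpath u [b] @ rpath [a] w) @ lpath u' q)"
    proof (rule Sq.cls_append_right)
      show "Sq.cls (u \<cdot> v) (rpath [a] v @ lpath u' [b]) = Sq.cls (u \<cdot> v) (lpath u [b] @ rpath [a] w)"
        using interchange_edges that(1) w(1) unfolding ab by blast
    qed (rule Sq.path_appendI[OF path_lpath[OF c(1) w(1)] path_rpath[OF c(4) that(1)]]
        path_lpath[OF c(2) w(2)])+
    also have "\<dots> = Sq.cls (u \<cdot> v) (lpath u [b] @ (rpath [a] w @ lpath u' q))" by simp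
    also have "\<dots> = Sq.cls (u \<cdot> v) (lpath u [b] @ (lpath u q @ rpath [a] v'))"
      by (rule Sq.cls_append_left[OF Cons.IH[OF w(2)] path_lpath[OF c(1) w(1)]
            Sq.path_appendI[OF path_lpath[OF c(1) w(2)] path_rpath[OF c(6) that(1)]]])
    finally show ?case using Sq.edge_map_simps(3)[of _ "[b]" q] by simp
  qed
  show ?thesis using assms(1)
  proof (induction p arbitrary: u)
    case Nil
    then show ?case by simp
  next
    case (Cons a p)
    obtain w where w: "Sq.path u [a] w" "Sq.path w p u'"
      using Sq.path_append[of u "[a]" p u'] Cons.prems by auto
    note c = path_carrier[OF w(1)] path_carrier[OF w(2)] path_carrier[OF assms(2)]
    have "Sq.cls (u \<cdot> v) (rpath [a] v @ (rpath p v @ lpath u' q)) =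
        Sq.cls (u \<cdot> v) (rpath [a] v @ (lpath w q @ rpath p v'))"
      by (rule Sq.cls_append_left[OF Cons.IH[OF w(2)] path_rpath[OF c(5) w(1)]
            Sq.path_appendI[OF path_lpath[OF c(3) assms(2)] path_rpath[OF c(6) w(2)]]])
    also have "\<dots> = Sq.cls (u \<cdot> v) ((rpath [a] v @ lpath w q) @ rpath p v')" by simp
    also have "\<dots> = Sq.cls (u \<cdot> v) ((lpath u q @ rpath [a] v') @ rpath p v')"
      by (rule Sq.cls_append_right[OF 1[OF w(1) assms(2)]
            Sq.path_appendI[OF path_lpath[OF c(1) assms(2)] path_rpath[OF c(6) w(1)]]
            path_rpath[OF c(6) w(2)]])
    finally show ?case using Sq.edge_map_simps(3)[of _ "[a]" p] by simp
  qed
qed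

end

section \<open>The crossed module \<open>S_bowtie\<close>\<close>

context presentation
begin

abbreviation "\<G> \<equiv> T_groupoid X \<R>"
abbreviation "\<S> \<equiv> S_bowtie X \<R>"

lemma T_groupoid_simps [simp]:
  "objs \<G> = idems T" "arrs \<G> = carrier T" "gdom \<G> w = w \<cdot> w\<^sup>\<star>" "gran \<G> w = w\<^sup>\<star> \<cdot> w"
  "gcomp \<G> v w = v \<cdot> w" "gid \<G> e = e" "ginv \<G> w = w\<^sup>\<star>"
  by (simp_all add: T_groupoid_def Let_def)

lemma groupoid_T: "groupoid \<G>"
proof
  fix g h assume "g \<in> arrs \<G>" "h \<in> arrs \<G>" "gran \<G> g = gdom \<G> h"
  then have gh: "g \<in> carrier T" "h \<in> carrier T" "g\<^sup>\<star> \<cdot> g = h \<cdot> h\<^sup>\<star>" by auto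
  have "g \<cdot> h \<cdot> (g \<cdot> h)\<^sup>\<star> = g \<cdot> (h \<cdot> h\<^sup>\<star>) \<cdot> g\<^sup>\<star>"
    "(g \<cdot> h)\<^sup>\<star> \<cdot> (g \<cdot> h) = h\<^sup>\<star> \<cdot> (g\<^sup>\<star> \<cdot> g) \<cdot> h"
    using gh(1,2) by (simp_all add: T.m_assoc)
  then have "g \<cdot> h \<cdot> (g \<cdot> h)\<^sup>\<star> = g \<cdot> (g\<^sup>\<star> \<cdot> g) \<cdot> g\<^sup>\<star>"
    "(g \<cdot> h)\<^sup>\<star> \<cdot> (g \<cdot> h) = h\<^sup>\<star> \<cdot> (h \<cdot> h\<^sup>\<star>) \<cdot> h"
    using gh(3) by simp_all
  then show "gcomp \<G> g h \<in> arrs \<G> \<and> gdom \<G> (gcomp \<G> g h) = gdom \<G> g \<and>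
      gran \<G> (gcomp \<G> g h) = gran \<G> h"
    using gh(1,2) by (simp add: T.m_assoc)
qed (auto simp: T.m_assoc)

lemma path_H_class:
  "\<lbrakk>Sq.path u p v; u \<in> T.H_class e\<rbrakk> \<Longrightarrow> v \<in> T.H_class e"
proof (induction p arbitrary: u)
  case (Cons a p)
  obtain E s where "a = (E, s)" by (cases a)
  then obtain x l r y where a: "a = ((x, l, r, y), s)" by (cases E) auto
  have E: "x \<in> carrier T" "(l, r) \<in> \<R>" "y \<in> carrier T" using Cons.prems a by auto
  then have "x \<cdot> t l \<cdot> y \<in> T.H_class e \<longleftrightarrow> x \<cdot> t r \<cdot> y \<in> T.H_class e"
    using edge_parallel[of l r x y] by (simp add: T.H_class_def del: T.sinv_mult)
  then show ?case using Cons a by (auto split: if_splits)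
qed auto

definition local_path :: "'x T_elt \<Rightarrow> ('x sq_edge \<times> bool) list \<Rightarrow> bool" where
  "local_path e p \<longleftrightarrow> list_all (\<lambda>((x, l, r, y), \<epsilon>). e \<cdot> x = x \<and> y \<cdot> e = y) p"

lemma local_path_iff:
  "local_path e p \<longleftrightarrow> (\<forall>x l r y \<epsilon>. ((x, l, r, y), \<epsilon>) \<in> set p \<longrightarrow> e \<cdot> x = x \<and> y \<cdot> e = y)"
  by (simp add: local_path_def list_all_iff Ball_def)

lemma local_path_simps [simp]:
  "local_path e []"
  "local_path e (((x, l, r, y), \<epsilon>) # p) \<longleftrightarrow> e \<cdot> x = x \<and> y \<cdot> e = y \<and> local_path e p"
  "local_path e (p @ q) \<longleftrightarrow> local_path e p \<and> local_path e q"
  by (simp_all add: local_path_def)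

lemma local_path_rev [simp]: "local_path e (rev_path p) \<longleftrightarrow> local_path e p"
  by (induction p) auto

lemma edge_map_id: "Sq.edge_map id p = p"
  by (simp add: Sq.edge_map_def)

lemma local_path_fixed:
  assumes "local_path e p" shows "lpath e p = p" "rpath p e = p"
proof -
  have *: "e \<cdot> x = x \<and> y \<cdot> e = y" if "((x, l, r, y), \<epsilon>) \<in> set p" for x l r y \<epsilon>
    using that assms unfolding local_path_iff by blast
  have "lpath e p = Sq.edge_map id p" "rpath p e = Sq.edge_map id p"
    by (rule edge_map_cong; simp; metis *)+
  then show "lpath e p = p" "rpath p e = p" by (simp_all add: edge_map_id)
qed

lemma set_lpathD:
  "((x, l, r, y), \<epsilon>) \<in> set (lpath s p) \<Longrightarrow> \<exists>x'. x = s \<cdot> x' \<and> ((x', l, r, y), \<epsilon>) \<in> set p"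
  by (auto simp: Sq.edge_map_def)

lemma set_rpathD:
  "((x, l, r, y), \<epsilon>) \<in> set (rpath p s) \<Longrightarrow> \<exists>y'. y = y' \<cdot> s \<and> ((x, l, r, y'), \<epsilon>) \<in> set p"
  by (auto simp: Sq.edge_map_def)

lemma local_path_lpath:
  assumes "Sq.path u p v" "local_path e p" "s \<in> T.H_class e"
  shows "local_path e (lpath s p)"
  unfolding local_path_iff
proof (intro allI impI)
  fix x l r y \<epsilon> assume "((x, l, r, y), \<epsilon>) \<in> set (lpath s p)"
  then obtain x' where x': "x = s \<cdot> x'" "((x', l, r, y), \<epsilon>) \<in> set p" using set_lpathD by blast
  then have "x' \<in> carrier T" using path_edges assms by blast
  then have "e \<cdot> x = x"
    using x' T.H_classD[OF assms(3)] T.m_assoc[of e s x'] by simp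
  moreover have "y \<cdot> e = y" using x'(2) assms(2) unfolding local_path_iff by blast
  ultimately show "e \<cdot> x = x \<and> y \<cdot> e = y" ..
qed

lemma local_path_conj:
  assumes "Sq.path u p v" "w \<in> carrier T"
  shows "local_path (w\<^sup>\<star> \<cdot> w) (rpath (lpath w\<^sup>\<star> p) w)"
  unfolding local_path_iff
proof (intro allI impI)
  fix x l r y \<epsilon> assume "((x, l, r, y), \<epsilon>) \<in> set (rpath (lpath w\<^sup>\<star> p) w)"
  then obtain x' y' where x': "x = w\<^sup>\<star> \<cdot> x'" "y = y' \<cdot> w" "((x', l, r, y'), \<epsilon>) \<in> set p"
    using set_lpathD set_rpathD by meson
  then have "x' \<in> carrier T" "y' \<in> carrier T" using path_edges assms by blast+
  then show "w\<^sup>\<star> \<cdot> w \<cdot> x = x \<and> y \<cdot> (w\<^sup>\<star> \<cdot> w) = y"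
    using x' assms(2) by (auto simp: T.m_assoc)
qed

text \<open>Translation by \<open>e\<close> on both sides makes every edge local at
  \<open>e\<close>, and it fixes a path whose edges are already local.\<close>

lemma star_bowtie_eq:
  assumes e: "e \<in> idems T"
  shows "star_bowtie X \<R> e = {Sq.cls e p | p v. Sq.path e p v \<and> local_path e p}"
proof (intro equalityI subsetI)
  fix \<beta> assume "\<beta> \<in> star_bowtie X \<R> e"
  then obtain \<alpha> where \<alpha>: "\<alpha> \<in> arrs Sq.\<pi>" "gdom Sq.\<pi> \<alpha> = e" "\<beta> = ract X \<R> (lact X \<R> e \<alpha>) e"
    by (auto simp: star_bowtie_def Sq_pi)
  then obtain p v where p: "\<alpha> = Sq.cls e p" "Sq.path e p v"
    by (auto simp: Sq.arrs_pi)
  have ec: "e \<in> carrier T" "e \<cdot> e = e" "e\<^sup>\<star> = e" using e by simp_all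
  note L = path_lpath[OF ec(1) p(2), unfolded ec(2)]
  have "\<beta> = Sq.cls e (rpath (lpath e p) e)"
    using \<alpha>(3) p lact_cls[OF ec(1) p(2)] ract_cls[OF ec(1) L] ec by simp
  moreover have "Sq.path e (rpath (lpath e p) e) (e \<cdot> v \<cdot> e)"
    using path_rpath[OF ec(1) L] ec by simp
  moreover have "local_path e (rpath (lpath e p) e)"
    using local_path_conj[OF p(2) ec(1)] ec by simp
  ultimately show "\<beta> \<in> {Sq.cls e p | p v. Sq.path e p v \<and> local_path e p}" by blast
next
  fix \<beta> assume "\<beta> \<in> {Sq.cls e p | p v. Sq.path e p v \<and> local_path e p}"
  then obtain p v where p: "\<beta> = Sq.cls e p" "Sq.path e p v" "local_path e p" by blast
  have ec: "e \<in> carrier T" "e \<cdot> e = e" using e by simp_all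
  have "ract X \<R> (lact X \<R> e \<beta>) e = \<beta>"
    using lact_cls[OF ec(1) p(2)] ract_cls[OF ec(1) p(2)] ec p local_path_fixed[OF p(3)] by simp
  moreover have "\<beta> \<in> arrs Sq.\<pi>" "gdom Sq.\<pi> \<beta> = e" using p by (auto simp: Sq.arrs_pi)
  ultimately show "\<beta> \<in> star_bowtie X \<R> e" unfolding star_bowtie_def Sq_pi by force
qed

lemma S_bowtie_simps [simp]:
  "carrier (fib \<S> e) = star_bowtie X \<R> e"
  "monoid.mult (fib \<S> e) = ast X \<R>"
  "\<one>\<^bsub>fib \<S> e\<^esub> = Sq.cls e []"
  "bd \<S> = gran Sq.\<pi>"
  "act \<S> \<alpha> w = ract X \<R> (lact X \<R> w\<^sup>\<star> \<alpha>) w"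
  by (simp_all add: S_bowtie_def Sq_pi Sq.gid_pi)

lemma star_bowtieE:
  assumes "\<alpha> \<in> star_bowtie X \<R> e" "e \<in> idems T"
  obtains p v where "\<alpha> = Sq.cls e p" "Sq.path e p v" "local_path e p" "v \<in> T.H_class e"
  using assms path_H_class T.H_class_self by (auto simp: star_bowtie_eq)

lemma cls_in_star_bowtie:
  "\<lbrakk>Sq.path e p v; local_path e p; e \<in> idems T\<rbrakk> \<Longrightarrow> Sq.cls e p \<in> star_bowtie X \<R> e"
  by (auto simp: star_bowtie_eq)

lemma path_ast:
  assumes "Sq.path e p v" "Sq.path e q w" "v \<in> T.H_class e"
  shows "Sq.path e (p @ lpath v q) (v \<cdot> w)"
  using Sq.path_appendI[OF assms(1)] path_lpath[OF _ assms(2), of v] T.H_classD[OF assms(3)] by simp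

text \<open>The right translation in \<open>ast\<close> is by the domain \<open>e\<close> of the
  second factor, and it fixes the local path \<open>p\<close>; only the left translation by the end
  of \<open>p\<close> remains.\<close>

lemma ast_cls:
  assumes "Sq.path e p v" "Sq.path e q w" "local_path e p" "v \<in> T.H_class e"
  shows "ast X \<R> (Sq.cls e p) (Sq.cls e q) = Sq.cls e (p @ lpath v q)"
proof -
  note H = T.H_classD[OF assms(4)]
  have e: "e \<in> carrier T" using H by simp
  have L: "Sq.path v (lpath v q) (v \<cdot> w)" using path_lpath[OF H(1) assms(2)] H by simp
  show ?thesis
    using ract_cls[OF e assms(1)] lact_cls[OF H(1) assms(2)] local_path_fixed(2)[OF assms(3)] H
      Sq.gcomp_cls[OF assms(1) L] assms by (simp add: ast_def Sq_pi)
qed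

lemma path_act:
  assumes "Sq.path (w \<cdot> w\<^sup>\<star>) p v" "w \<in> carrier T"
  shows "Sq.path (w\<^sup>\<star> \<cdot> w) (rpath (lpath w\<^sup>\<star> p) w) (w\<^sup>\<star> \<cdot> v \<cdot> w)"
  using path_rpath[OF assms(2) path_lpath[OF _ assms(1), of "w\<^sup>\<star>"]] assms(2) by (simp add: T.m_assoc)

lemma act_cls:
  assumes "Sq.path (w \<cdot> w\<^sup>\<star>) p v" "w \<in> carrier T"
  shows "ract X \<R> (lact X \<R> w\<^sup>\<star> (Sq.cls (w \<cdot> w\<^sup>\<star>) p)) w = Sq.cls (w\<^sup>\<star> \<cdot> w) (rpath (lpath w\<^sup>\<star> p) w)"
  using ract_cls[OF assms(2) path_lpath[OF _ assms(1), of "w\<^sup>\<star>"]] lact_cls[OF _ assms(1), of "w\<^sup>\<star>"] assms(2)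
  by (simp add: T.m_assoc)

lemma S_bowtie_group:
  assumes e: "e \<in> idems T" shows "group (fib \<S> e)"
proof (rule groupI; unfold S_bowtie_simps)
  have eH: "e \<in> T.H_class e" and ec: "e \<in> carrier T" using e T.H_class_self by simp_all
  then have path_Nil: "Sq.path e [] e" by simp
  show "Sq.cls e [] \<in> star_bowtie X \<R> e" using cls_in_star_bowtie[OF path_Nil _ e] by simp
  fix \<alpha> assume "\<alpha> \<in> star_bowtie X \<R> e"
  then obtain p v where p: "\<alpha> = Sq.cls e p" "Sq.path e p v" "local_path e p" "v \<in> T.H_class e"
    using star_bowtieE e by blast
  show "ast X \<R> (Sq.cls e []) \<alpha> = \<alpha>"
    using ast_cls[OF path_Nil p(2) _ eH] p(1) local_path_fixed[OF p(3)] by simp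
  note v = T.H_classD[OF p(4)]
  have v': "v\<^sup>\<star> \<in> T.H_class e" using p T.H_class_sinv by blast
  \<comment> \<open>The reversed path starts at \<open>v\<close>, so it must be translated back by
    the inverse of \<open>v\<close> to represent an element at \<open>e\<close>.\<close>
  have rev: "Sq.path e (lpath v\<^sup>\<star> (rev_path p)) v\<^sup>\<star>"
    using path_lpath[OF _ Sq.path_rev[OF p(2)], of "v\<^sup>\<star>"] v by simp
  have loc: "local_path e (lpath v\<^sup>\<star> (rev_path p))"
    using local_path_lpath[OF Sq.path_rev[OF p(2)] _ v'] p(3) by simp
  have "Sq.cls (v\<^sup>\<star> \<cdot> v) (lpath v\<^sup>\<star> (rev_path p @ p)) = Sq.cls (v\<^sup>\<star> \<cdot> v) (lpath v\<^sup>\<star> [])"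
    using v path_carrier[OF p(2)]
    by (intro Sq.cls_edge_map_cong[OF endo_lmul Sq.cls_rev_path_left[OF p(2)], where v = v]) auto
  then have "ast X \<R> (Sq.cls e (lpath v\<^sup>\<star> (rev_path p))) \<alpha> = Sq.cls e []"
    using ast_cls[OF rev p(2) loc v'] p(1) v by simp
  then show "\<exists>\<beta>\<in>star_bowtie X \<R> e. ast X \<R> \<beta> \<alpha> = Sq.cls e []"
    using cls_in_star_bowtie[OF rev loc e] by blast
  fix \<beta> assume "\<beta> \<in> star_bowtie X \<R> e"
  then obtain q w where q: "\<beta> = Sq.cls e q" "Sq.path e q w" "local_path e q" "w \<in> T.H_class e"
    using star_bowtieE e by blast
  have pq: "Sq.path e (p @ lpath v q) (v \<cdot> w)" "local_path e (p @ lpath v q)"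
    using path_ast[OF p(2) q(2) p(4)] local_path_lpath[OF q(2,3) p(4)] p(3) by simp_all
  show "ast X \<R> \<alpha> \<beta> \<in> star_bowtie X \<R> e"
    using ast_cls[OF p(2) q(2) p(3,4)] cls_in_star_bowtie[OF pq e] p(1) q(1) by simp
  fix \<gamma> assume "\<gamma> \<in> star_bowtie X \<R> e"
  then obtain r z where r: "\<gamma> = Sq.cls e r" "Sq.path e r z" "local_path e r" "z \<in> T.H_class e"
    using star_bowtieE e by blast
  have "ast X \<R> (ast X \<R> \<alpha> \<beta>) \<gamma> = Sq.cls e ((p @ lpath v q) @ lpath (v \<cdot> w) r)"
    using ast_cls[OF p(2) q(2) p(3,4)] ast_cls[OF pq(1) r(2) pq(2) T.H_class_mult[OF p(4) q(4)]]
      p(1) q(1) r(1) by simp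
  also have "\<dots> = Sq.cls e (p @ lpath v (q @ lpath w r))"
    using lpath_lpath[OF r(2) v(1) T.H_classD(1)[OF q(4)]] by simp
  also have "\<dots> = ast X \<R> \<alpha> (ast X \<R> \<beta> \<gamma>)"
    using ast_cls[OF q(2) r(2) q(3,4)] ast_cls[OF p(2) path_ast[OF q(2) r(2) q(4)] p(3,4)]
      p(1) q(1) r(1) by simp
  finally show "ast X \<R> (ast X \<R> \<alpha> \<beta>) \<gamma> = ast X \<R> \<alpha> (ast X \<R> \<beta> \<gamma>)" .
qed

lemma act_closed:
  assumes "w \<in> carrier T" "\<alpha> \<in> star_bowtie X \<R> (w \<cdot> w\<^sup>\<star>)"
  shows "act \<S> \<alpha> w \<in> star_bowtie X \<R> (w\<^sup>\<star> \<cdot> w)"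
proof -
  obtain p v where p: "\<alpha> = Sq.cls (w \<cdot> w\<^sup>\<star>) p" "Sq.path (w \<cdot> w\<^sup>\<star>) p v"
    using star_bowtieE[OF assms(2)] T.dom_idem assms(1) by blast
  show ?thesis
    using cls_in_star_bowtie[OF path_act[OF p(2) assms(1)] local_path_conj[OF p(2) assms(1)]]
      act_cls[OF p(2) assms(1)] p(1) assms(1) by simp
qed

lemma act_idem:
  assumes "e \<in> idems T" "\<alpha> \<in> star_bowtie X \<R> e" shows "act \<S> \<alpha> e = \<alpha>"
proof -
  obtain p v where p: "\<alpha> = Sq.cls e p" "Sq.path e p v" "local_path e p"
    using star_bowtieE assms by metis
  show ?thesis using act_cls[of e p v] p local_path_fixed[OF p(3)] assms(1) by simp
qed

lemma act_act:
  assumes "g \<in> carrier T" "h \<in> carrier T" "g\<^sup>\<star> \<cdot> g = h \<cdot> h\<^sup>\<star>" "\<alpha> \<in> star_bowtie X \<R> (g \<cdot> g\<^sup>\<star>)"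
  shows "act \<S> \<alpha> (g \<cdot> h) = act \<S> (act \<S> \<alpha> g) h"
proof -
  obtain p v where p: "\<alpha> = Sq.cls (g \<cdot> g\<^sup>\<star>) p" "Sq.path (g \<cdot> g\<^sup>\<star>) p v"
    using star_bowtieE[OF assms(4)] T.dom_idem assms(1) by blast
  have "(g \<cdot> h) \<cdot> (g \<cdot> h)\<^sup>\<star> = g \<cdot> (h \<cdot> h\<^sup>\<star>) \<cdot> g\<^sup>\<star>" using assms by (simp add: T.m_assoc)
  also have "\<dots> = g \<cdot> g\<^sup>\<star>" using assms(1) assms(3)[symmetric] by (simp add: T.m_assoc)
  finally have gh: "(g \<cdot> h) \<cdot> (g \<cdot> h)\<^sup>\<star> = g \<cdot> g\<^sup>\<star>" .
  have "(g \<cdot> h)\<^sup>\<star> \<cdot> (g \<cdot> h) = h\<^sup>\<star> \<cdot> (g\<^sup>\<star> \<cdot> g) \<cdot> h" using assms(1,2) by (simp add: T.m_assoc)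
  also have "\<dots> = h\<^sup>\<star> \<cdot> h" unfolding assms(3) using assms(2) by (simp add: T.m_assoc)
  finally have hg: "(g \<cdot> h)\<^sup>\<star> \<cdot> (g \<cdot> h) = h\<^sup>\<star> \<cdot> h" .
  have c: "g \<cdot> h \<in> carrier T" "g\<^sup>\<star> \<in> carrier T" "h\<^sup>\<star> \<in> carrier T" using assms by simp_all
  note q = path_act[OF p(2) assms(1), unfolded assms(3)]
  have "act \<S> \<alpha> (g \<cdot> h) = Sq.cls (h\<^sup>\<star> \<cdot> h) (rpath (lpath (g \<cdot> h)\<^sup>\<star> p) (g \<cdot> h))"
    using act_cls[of "g \<cdot> h" p v, unfolded gh hg, OF p(2) c(1)] p(1) by simp
  also have "rpath (lpath (g \<cdot> h)\<^sup>\<star> p) (g \<cdot> h) = rpath (lpath h\<^sup>\<star> (rpath (lpath g\<^sup>\<star> p) g)) h"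
  proof -
    have 1: "lpath (g \<cdot> h)\<^sup>\<star> p = lpath h\<^sup>\<star> (lpath g\<^sup>\<star> p)"
      using lpath_lpath[OF p(2) c(3,2)] assms by simp
    have "Sq.path (h\<^sup>\<star> \<cdot> (g\<^sup>\<star> \<cdot> (g \<cdot> g\<^sup>\<star>))) (lpath h\<^sup>\<star> (lpath g\<^sup>\<star> p)) (h\<^sup>\<star> \<cdot> (g\<^sup>\<star> \<cdot> v))"
      using path_lpath[OF c(3) path_lpath[OF c(2) p(2)]] .
    from rpath_rpath[OF this assms(1,2)] show ?thesis by (simp add: 1 lpath_rpath)
  qed
  also have "Sq.cls (h\<^sup>\<star> \<cdot> h) \<dots> = act \<S> (act \<S> \<alpha> g) h"
    using act_cls[OF q assms(2)] act_cls[OF p(2) assms(1)] p(1) assms(3) by simp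
  finally show ?thesis .
qed

lemma act_hom:
  assumes w: "w \<in> carrier T"
  shows "(\<lambda>\<alpha>. act \<S> \<alpha> w) \<in> hom (fib \<S> (w \<cdot> w\<^sup>\<star>)) (fib \<S> (w\<^sup>\<star> \<cdot> w))"
proof (rule homI)
  let ?e = "w \<cdot> w\<^sup>\<star>" and ?f = "w\<^sup>\<star> \<cdot> w"
  have e: "?e \<in> idems T" using w by simp
  show "act \<S> \<alpha> w \<in> carrier (fib \<S> ?f)" if "\<alpha> \<in> carrier (fib \<S> ?e)" for \<alpha>
    using that act_closed[OF w] by (simp del: S_bowtie_simps(5))
  fix \<alpha> \<beta> assume "\<alpha> \<in> carrier (fib \<S> ?e)" "\<beta> \<in> carrier (fib \<S> ?e)"
  then obtain p v q z where p: "\<alpha> = Sq.cls ?e p" "Sq.path ?e p v" "local_path ?e p" "v \<in> T.H_class ?e"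
    and q: "\<beta> = Sq.cls ?e q" "Sq.path ?e q z" "local_path ?e q" "z \<in> T.H_class ?e"
    using star_bowtieE[OF _ e] S_bowtie_simps(1) by metis
  note v = T.H_classD[OF p(4)]
  have vw: "w\<^sup>\<star> \<cdot> v \<cdot> w \<in> T.H_class ?f"
    using path_H_class[OF path_act[OF p(2) w] T.H_class_self] w by simp
  have "lpath w\<^sup>\<star> (lpath v q) = lpath (w\<^sup>\<star> \<cdot> v) q"
    using lpath_lpath[OF q(2)] v w by simp
  \<comment> \<open>The element \<open>v\<close> absorbs its range
    \<open>w \<cdot> w\<^sup>\<star>\<close> on the right. Hence translating by \<open>v\<close>
    before the conjugation amounts to translating by the conjugate of \<open>v\<close> after
    it.\<close>
  also have "w\<^sup>\<star> \<cdot> v = (w\<^sup>\<star> \<cdot> v \<cdot> w) \<cdot> w\<^sup>\<star>" using v w by (simp add: T.m_assoc)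
  also have "lpath \<dots> q = lpath (w\<^sup>\<star> \<cdot> v \<cdot> w) (lpath w\<^sup>\<star> q)"
    using lpath_lpath[OF q(2)] v w by simp
  finally have L: "lpath w\<^sup>\<star> (lpath v q) = lpath (w\<^sup>\<star> \<cdot> v \<cdot> w) (lpath w\<^sup>\<star> q)" .
  have *: "act \<S> (\<alpha> \<otimes>\<^bsub>fib \<S> ?e\<^esub> \<beta>) w =
      Sq.cls ?f (rpath (lpath w\<^sup>\<star> p) w @ lpath (w\<^sup>\<star> \<cdot> v \<cdot> w) (rpath (lpath w\<^sup>\<star> q) w))"
    using ast_cls[OF p(2) q(2) p(3,4)] act_cls[OF path_ast[OF p(2) q(2) p(4)] w] p(1) q(1)
    by (simp add: L lpath_rpath)
  show "act \<S> (\<alpha> \<otimes>\<^bsub>fib \<S> ?e\<^esub> \<beta>) w = act \<S> \<alpha> w \<otimes>\<^bsub>fib \<S> ?f\<^esub> act \<S> \<beta> w"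
    unfolding * using act_cls[OF p(2) w] act_cls[OF q(2) w] p(1) q(1)
      ast_cls[OF path_act[OF p(2) w] path_act[OF q(2) w] local_path_conj[OF p(2) w] vw] by simp
qed

lemma S_bowtie_crossed_module: "crossed_module \<G> \<S>"
proof (intro crossed_module.intro groupoid_T crossed_module_axioms.intro)
  fix e assume "e \<in> objs \<G>"
  then have e: "e \<in> idems T" by simp
  show "group (fib \<S> e)" using S_bowtie_group[OF e] .
  show "act \<S> \<alpha> (gid \<G> e) = \<alpha>" if "\<alpha> \<in> carrier (fib \<S> e)" for \<alpha>
    using act_idem[OF e] that by (simp del: S_bowtie_simps(5))
  show "carrier (fib \<S> e) \<inter> carrier (fib \<S> f) = {}" if "f \<in> objs \<G>" "e \<noteq> f" for f
  proof -
    \<comment> \<open>Fibres are disjoint because a homotopy class determines its start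
      vertex.\<close>
    have "gdom Sq.\<pi> \<alpha> = g" if "\<alpha> \<in> star_bowtie X \<R> g" "g \<in> idems T" for \<alpha> g
      using that by (auto elim!: star_bowtieE)
    then show ?thesis using that e by auto
  qed
  fix \<alpha> assume "\<alpha> \<in> carrier (fib \<S> e)"
  then obtain p v where p: "\<alpha> = Sq.cls e p" "Sq.path e p v" "local_path e p" "v \<in> T.H_class e"
    using star_bowtieE[OF _ e] unfolding S_bowtie_simps by blast
  note v = T.H_classD[OF p(4)]
  show "bd \<S> \<alpha> \<in> arrs \<G> \<and> gdom \<G> (bd \<S> \<alpha>) = e \<and> gran \<G> (bd \<S> \<alpha>) = e"
    using p v by simp
  fix \<beta> assume "\<beta> \<in> carrier (fib \<S> e)"
  then obtain q w where q: "\<beta> = Sq.cls e q" "Sq.path e q w" "local_path e q" "w \<in> T.H_class e"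
    using star_bowtieE[OF _ e] unfolding S_bowtie_simps by blast
  show "bd \<S> (\<alpha> \<otimes>\<^bsub>fib \<S> e\<^esub> \<beta>) = gcomp \<G> (bd \<S> \<alpha>) (bd \<S> \<beta>)"
    using ast_cls[OF p(2) q(2) p(3,4)] path_ast[OF p(2) q(2) p(4)] p q by simp
  interpret group "fib \<S> e" using S_bowtie_group[OF e] .
  have q': "Sq.path e (rpath (lpath v\<^sup>\<star> q) v) (v\<^sup>\<star> \<cdot> w \<cdot> v)"
    using path_act[of v q w] q(2) v by simp
  have act: "act \<S> \<beta> v = Sq.cls e (rpath (lpath v\<^sup>\<star> q) v)"
    using act_cls[of v q w] q(1,2) v by simp
  \<comment> \<open>The Peiffer identity is proved with the inverse moved to the other side. Both
    products are then concatenations of translates of \<open>p\<close> and \<open>q\<close>, the two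
    sides of \<open>interchange\<close> at the vertex \<open>e \<cdot> e = e\<close>.\<close>
  have "\<alpha> \<otimes>\<^bsub>fib \<S> e\<^esub> act \<S> \<beta> v = Sq.cls e (p @ rpath (lpath (v \<cdot> v\<^sup>\<star>) q) v)"
    using ast_cls[OF p(2) q' p(3,4)] lpath_lpath[OF q(2)] v p(1)
    by (simp add: act lpath_rpath del: S_bowtie_simps(5))
  also have "\<dots> = Sq.cls e (lpath e p @ rpath q v)"
    using v local_path_fixed[OF p(3)] local_path_fixed[OF q(3)] by simp
  also have "\<dots> = Sq.cls e (rpath q e @ lpath w p)"
    using interchange[OF q(2) p(2)] e by simp
  also have "\<dots> = \<beta> \<otimes>\<^bsub>fib \<S> e\<^esub> \<alpha>"
    using ast_cls[OF q(2) p(2) q(3,4)] p(1) q(1) local_path_fixed[OF q(3)] by simp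
  finally have "\<alpha> \<otimes>\<^bsub>fib \<S> e\<^esub> act \<S> \<beta> v = \<beta> \<otimes>\<^bsub>fib \<S> e\<^esub> \<alpha>" .
  moreover have "act \<S> \<beta> v \<in> carrier (fib \<S> e)"
    using act_closed[of v \<beta>] v \<open>\<beta> \<in> carrier (fib \<S> e)\<close> by simp
  ultimately have "act \<S> \<beta> v = inv\<^bsub>fib \<S> e\<^esub> \<alpha> \<otimes>\<^bsub>fib \<S> e\<^esub> (\<beta> \<otimes>\<^bsub>fib \<S> e\<^esub> \<alpha>)"
    using \<open>\<alpha> \<in> carrier (fib \<S> e)\<close> \<open>\<beta> \<in> carrier (fib \<S> e)\<close> inv_solve_left by blast
  moreover have "bd \<S> \<alpha> = v" using p by simp
  ultimately show "act \<S> \<beta> (bd \<S> \<alpha>) = inv\<^bsub>fib \<S> e\<^esub> \<alpha> \<otimes>\<^bsub>fib \<S> e\<^esub> \<beta> \<otimes>\<^bsub>fib \<S> e\<^esub> \<alpha>"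
    using \<open>\<alpha> \<in> carrier (fib \<S> e)\<close> \<open>\<beta> \<in> carrier (fib \<S> e)\<close> m_assoc inv_closed by metis
next
  fix g assume "g \<in> arrs \<G>"
  then have g: "g \<in> carrier T" by simp
  show "act \<S> \<alpha> (gcomp \<G> g h) = act \<S> (act \<S> \<alpha> g) h"
    if "h \<in> arrs \<G>" "gran \<G> g = gdom \<G> h" "\<alpha> \<in> carrier (fib \<S> (gdom \<G> g))" for h \<alpha>
    using act_act[OF g, of h \<alpha>] that by (simp del: S_bowtie_simps(5))
  show "bd \<S> (act \<S> \<alpha> g) = gcomp \<G> (gcomp \<G> (ginv \<G> g) (bd \<S> \<alpha>)) g"
    if \<alpha>: "\<alpha> \<in> carrier (fib \<S> (gdom \<G> g))" for \<alpha>
  proof -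
    obtain p v where p: "\<alpha> = Sq.cls (g \<cdot> g\<^sup>\<star>) p" "Sq.path (g \<cdot> g\<^sup>\<star>) p v"
      using star_bowtieE[OF _ T.dom_idem[OF g]] \<alpha> unfolding S_bowtie_simps T_groupoid_simps by blast
    then show ?thesis using act_cls[OF p(2) g] path_act[OF p(2) g] by simp
  qed
  have inverse: "act \<S> (act \<S> \<alpha> h) h\<^sup>\<star> = \<alpha>" if "h \<in> carrier T" "\<alpha> \<in> star_bowtie X \<R> (h \<cdot> h\<^sup>\<star>)" for h \<alpha>
    using act_act[of h "h\<^sup>\<star>" \<alpha>] act_idem[of "h \<cdot> h\<^sup>\<star>" \<alpha>] that by (simp del: S_bowtie_simps(5))
  have "bij_betw (\<lambda>\<alpha>. act \<S> \<alpha> g) (star_bowtie X \<R> (g \<cdot> g\<^sup>\<star>)) (star_bowtie X \<R> (g\<^sup>\<star> \<cdot> g))"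
  proof (rule bij_betw_byWitness[where f' = "\<lambda>\<alpha>. act \<S> \<alpha> g\<^sup>\<star>"])
    show "\<forall>\<alpha>\<in>star_bowtie X \<R> (g \<cdot> g\<^sup>\<star>). act \<S> (act \<S> \<alpha> g) g\<^sup>\<star> = \<alpha>" using inverse g by blast
    show "\<forall>\<alpha>\<in>star_bowtie X \<R> (g\<^sup>\<star> \<cdot> g). act \<S> (act \<S> \<alpha> g\<^sup>\<star>) g = \<alpha>"
      using inverse[of "g\<^sup>\<star>"] g by (simp del: S_bowtie_simps(5))
    show "(\<lambda>\<alpha>. act \<S> \<alpha> g) ` star_bowtie X \<R> (g \<cdot> g\<^sup>\<star>) \<subseteq> star_bowtie X \<R> (g\<^sup>\<star> \<cdot> g)"
      using act_closed g by blast
    show "(\<lambda>\<alpha>. act \<S> \<alpha> g\<^sup>\<star>) ` star_bowtie X \<R> (g\<^sup>\<star> \<cdot> g) \<subseteq> star_bowtie X \<R> (g \<cdot> g\<^sup>\<star>)"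
      using act_closed[of "g\<^sup>\<star>"] g by (auto simp del: S_bowtie_simps(5))
  qed
  then show "(\<lambda>\<alpha>. act \<S> \<alpha> g) \<in> iso (fib \<S> (gdom \<G> g)) (fib \<S> (gran \<G> g))"
    using act_hom[OF g] by (simp add: iso_def del: S_bowtie_simps(2-5))
qed

end

section \<open>Freeness\<close>

context presentation
begin

lemma H_class_edge:
  assumes "(l, r) \<in> \<R>" "x \<in> carrier T" "y \<in> carrier T"
  shows "x \<cdot> t l \<cdot> y \<in> T.H_class e \<longleftrightarrow> x \<cdot> t r \<cdot> y \<in> T.H_class e"
  using edge_parallel[OF assms] assms by (simp add: T.H_class_def del: T.sinv_mult)

text \<open>Since \<open>x \<cdot> t l \<cdot> y\<close> and \<open>x \<cdot> t r \<cdot> y\<close>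
  absorb \<open>e\<close>, one may pass to \<open>e \<cdot> x\<close> and \<open>z\<close>. Then
  \<open>H_class_factor\<close> applies to three splittings: \<open>e \<cdot> x\<close> against
  \<open>t l \<cdot> z\<close>, \<open>e \<cdot> x\<close> against \<open>t r \<cdot> z\<close>, and
  \<open>e \<cdot> x \<cdot> t l\<close> against \<open>z\<close>. The first two give
  \<open>t l \<cdot> z\<close> and \<open>t r \<cdot> z\<close> the same domain, whence the last
  claim, which is needed for the 2-cells; the third yields the facts about \<open>z\<close>
  itself.\<close>

lemma edge_local:
  assumes lr: "(l, r) \<in> \<R>" and xy: "x \<in> carrier T" "y \<in> carrier T"
    and H: "x \<cdot> t l \<cdot> y \<in> T.H_class e"
  defines "z \<equiv> y \<cdot> e"
  shows "z \<in> carrier T" "z\<^sup>\<star> \<cdot> z = e" "(z \<cdot> z\<^sup>\<star>) \<cdot> ((t l)\<^sup>\<star> \<cdot> t l) = z \<cdot> z\<^sup>\<star>"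
    "(x \<cdot> t l \<cdot> y)\<^sup>\<star> \<cdot> x = z\<^sup>\<star> \<cdot> (t l)\<^sup>\<star>"
    "(x \<cdot> t l \<cdot> y)\<^sup>\<star> \<cdot> (x \<cdot> t r \<cdot> y) = z\<^sup>\<star> \<cdot> ((t l)\<^sup>\<star> \<cdot> t r) \<cdot> z"
    "(t l \<cdot> z) \<cdot> (t l \<cdot> z)\<^sup>\<star> \<cdot> (t r \<cdot> z) = t r \<cdot> z"
proof -
  let ?s = "x \<cdot> t l \<cdot> y" and ?s' = "x \<cdot> t r \<cdot> y" and ?x = "e \<cdot> x"
  have H': "?s' \<in> T.H_class e" using H H_class_edge[OF lr xy] by simp
  note s = T.H_classD[OF H] and s' = T.H_classD[OF H']
  have e: "e \<in> idems T" "e \<in> carrier T" using s by simp_all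
  show z: "z \<in> carrier T" using e xy by (simp add: z_def)
  have "?x \<cdot> (t l \<cdot> z) = e \<cdot> ?s \<cdot> e" "?x \<cdot> (t r \<cdot> z) = e \<cdot> ?s' \<cdot> e"
    "?x \<cdot> t l \<cdot> z = e \<cdot> ?s \<cdot> e"
    using e(2) lr xy unfolding z_def by (simp_all add: T.m_assoc)
  then have eqs: "?x \<cdot> (t l \<cdot> z) = ?s" "?x \<cdot> (t r \<cdot> z) = ?s'" "?x \<cdot> t l \<cdot> z = ?s"
    using s s' by simp_all
  have ex: "?x \<in> carrier T" "e \<cdot> ?x = ?x" "e \<cdot> (?x \<cdot> t l) = ?x \<cdot> t l"
    using e lr xy by (simp_all add: T.m_assoc)
  have ze: "z \<cdot> e = z" "t l \<cdot> z \<cdot> e = t l \<cdot> z" "t r \<cdot> z \<cdot> e = t r \<cdot> z"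
    using e lr xy by (simp_all add: z_def T.m_assoc)
  have tz: "t l \<cdot> z \<in> carrier T" "t r \<cdot> z \<in> carrier T" "?x \<cdot> t l \<in> carrier T"
    using z lr xy e by simp_all
  note 1 = T.H_class_factor[OF ex(1) tz(1) ex(2) ze(2), unfolded eqs, OF H]
  note 2 = T.H_class_factor[OF ex(1) tz(2) ex(2) ze(3), unfolded eqs, OF H']
  note 3 = T.H_class_factor[OF tz(3) z ex(3) ze(1), unfolded eqs, OF H]
  show "z\<^sup>\<star> \<cdot> z = e" using 3 by simp
  have "(?x \<cdot> t l)\<^sup>\<star> \<cdot> (?x \<cdot> t l) \<cdot> ((t l)\<^sup>\<star> \<cdot> t l) = (?x \<cdot> t l)\<^sup>\<star> \<cdot> (?x \<cdot> t l)"
    using e(2) lr xy by (simp add: T.m_assoc)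
  then show "(z \<cdot> z\<^sup>\<star>) \<cdot> ((t l)\<^sup>\<star> \<cdot> t l) = z \<cdot> z\<^sup>\<star>" unfolding 3(3) .
  have "?s\<^sup>\<star> \<cdot> x = ?s\<^sup>\<star> \<cdot> e \<cdot> x" using s by simp
  also have "\<dots> = ?s\<^sup>\<star> \<cdot> ?x" using s(1) e(2) xy by (simp add: T.m_assoc del: T.sinv_mult)
  also have "\<dots> = (?x \<cdot> (t l \<cdot> z))\<^sup>\<star> \<cdot> ?x" unfolding eqs ..
  also have "\<dots> = (t l \<cdot> z)\<^sup>\<star> \<cdot> (?x\<^sup>\<star> \<cdot> ?x)"
    unfolding T.sinv_mult[OF ex(1) tz(1)] using ex(1) tz(1)
    by (simp add: T.m_assoc del: T.sinv_mult)
  also have "\<dots> = (t l \<cdot> z)\<^sup>\<star>" unfolding 1(3) using tz(1) by (simp del: T.sinv_mult)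
  finally have sx: "?s\<^sup>\<star> \<cdot> ?x = z\<^sup>\<star> \<cdot> (t l)\<^sup>\<star>" and sx': "?s\<^sup>\<star> \<cdot> x = z\<^sup>\<star> \<cdot> (t l)\<^sup>\<star>"
    using z lr \<open>?s\<^sup>\<star> \<cdot> x = ?s\<^sup>\<star> \<cdot> e \<cdot> x\<close> \<open>?s\<^sup>\<star> \<cdot> e \<cdot> x = ?s\<^sup>\<star> \<cdot> ?x\<close> by (simp_all del: T.sinv_mult add: T.sinv_mult[of "t l" z])
  show "?s\<^sup>\<star> \<cdot> x = z\<^sup>\<star> \<cdot> (t l)\<^sup>\<star>" by (fact sx')
  have "?s\<^sup>\<star> \<cdot> ?s' = ?s\<^sup>\<star> \<cdot> ?x \<cdot> (t r \<cdot> z)"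
    using T.m_assoc[of "?s\<^sup>\<star>" ?x "t r \<cdot> z"] s(1) ex(1) tz(2) eqs(2) by (simp del: T.sinv_mult)
  then show "?s\<^sup>\<star> \<cdot> ?s' = z\<^sup>\<star> \<cdot> ((t l)\<^sup>\<star> \<cdot> t r) \<cdot> z"
    unfolding sx using z lr by (simp add: T.m_assoc del: T.sinv_mult)
  have "(t l \<cdot> z) \<cdot> (t l \<cdot> z)\<^sup>\<star> \<cdot> (t r \<cdot> z) = (t r \<cdot> z) \<cdot> (t r \<cdot> z)\<^sup>\<star> \<cdot> (t r \<cdot> z)"
    using 1(3) 2(3) by simp
  then show "(t l \<cdot> z) \<cdot> (t l \<cdot> z)\<^sup>\<star> \<cdot> (t r \<cdot> z) = t r \<cdot> z"
    using tz(2) by (simp add: T.m_assoc del: T.sinv_mult)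
qed

text \<open>The left component \<open>x \<cdot> (t l)\<^sup>\<star>\<close> is chosen so that the
  edge starts at \<open>x\<close>, which holds because \<open>x\<close> lies below
  \<open>(t l)\<^sup>\<star> \<cdot> t l\<close>; its end is then the prescribed value of
  \<open>basis_map\<close>.\<close>

definition basis_elt :: "'x word \<times> 'x word \<times> 'x T_elt \<Rightarrow> 'x sq_arr" where
  "basis_elt = (\<lambda>(l, r, x). Sq.cls x [((x \<cdot> (t l)\<^sup>\<star>, l, r, x), True)])"

lemma basis_path:
  assumes "(l, r, x) \<in> basis_set X \<R>"
  shows "Sq.path x [((x \<cdot> (t l)\<^sup>\<star>, l, r, x), True)] (basis_map X \<R> (l, r, x))"
    "local_path x [((x \<cdot> (t l)\<^sup>\<star>, l, r, x), True)]"
    "basis_map X \<R> (l, r, x) \<in> T.H_class x"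
proof -
  have *: "(l, r) \<in> \<R>" "x \<in> idems T" "x \<cdot> ((t l)\<^sup>\<star> \<cdot> t l) = x"
    using assms by (auto simp: basis_set_iff)
  have "x \<cdot> (t l)\<^sup>\<star> \<cdot> t l \<cdot> x = x \<cdot> ((t l)\<^sup>\<star> \<cdot> t l) \<cdot> x" using * by (simp add: T.m_assoc)
  then have 1: "x \<cdot> (t l)\<^sup>\<star> \<cdot> t l \<cdot> x = x" using * by simp
  show p: "Sq.path x [((x \<cdot> (t l)\<^sup>\<star>, l, r, x), True)] (basis_map X \<R> (l, r, x))"
    using * 1 by (simp add: basis_map_eq T.m_assoc)
  show "local_path x [((x \<cdot> (t l)\<^sup>\<star>, l, r, x), True)]" using * by (simp add: T.m_assoc)
  show "basis_map X \<R> (l, r, x) \<in> T.H_class x"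
    using path_H_class[OF p] T.H_class_self *(2) by blast
qed

lemma basis_elt:
  assumes "b \<in> basis_set X \<R>"
  shows "basis_elt b \<in> total_set \<G> \<S>" "bd \<S> (basis_elt b) = basis_map X \<R> b"
proof -
  obtain l r x where b: "b = (l, r, x)" by (cases b) auto
  have x: "x \<in> idems T" using assms by (auto simp: b basis_set_iff)
  note p = basis_path[OF assms[unfolded b]]
  show "basis_elt b \<in> total_set \<G> \<S>"
    using cls_in_star_bowtie[OF p(1,2) x] x by (auto simp: total_set_def b basis_elt_def)
  show "bd \<S> (basis_elt b) = basis_map X \<R> b"
    using Sq.gran_cls[OF p(1)] by (simp add: b basis_elt_def)
qed

end

section \<open>The morphism induced by an assignment on the basis\<close>

locale free_target = presentation X \<R> + D: crossed_module "T_groupoid X \<R>" D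
  for X :: "'x set" and \<R> and D :: "('x T_elt, 'x T_elt, 'd) xmod_data" +
  fixes \<sigma> :: "'x word \<times> 'x word \<times> 'x T_elt \<Rightarrow> 'd"
  assumes \<sigma>: "b \<in> basis_set X \<R> \<Longrightarrow> \<sigma> b \<in> total_set \<G> D \<and> bd D (\<sigma> b) = basis_map X \<R> b"
begin

abbreviation fibm :: "'d \<Rightarrow> 'x T_elt \<Rightarrow> 'd \<Rightarrow> 'd" (\<open>_ \<odot>\<^bsub>_\<^esub> _\<close> [70, 0, 71] 70) where
  "c \<odot>\<^bsub>e\<^esub> d \<equiv> c \<otimes>\<^bsub>fib D e\<^esub> d"

lemma fib_group: "e \<in> idems T \<Longrightarrow> group (fib D e)"
  using D.fib_group by simp

lemma bd_H_class: "\<lbrakk>e \<in> idems T; c \<in> carrier (fib D e)\<rbrakk> \<Longrightarrow> bd D c \<in> T.H_class e"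
  using D.bd_in[of e c] by (simp add: T.H_class_def)

lemma bd_mult: "\<lbrakk>e \<in> idems T; c \<in> carrier (fib D e); d \<in> carrier (fib D e)\<rbrakk> \<Longrightarrow>
    bd D (c \<odot>\<^bsub>e\<^esub> d) = bd D c \<cdot> bd D d"
  using D.bd_mult[of e c d] by simp

lemma bd_one:
  assumes "e \<in> idems T" shows "bd D \<one>\<^bsub>fib D e\<^esub> = e"
proof -
  interpret group "fib D e" using fib_group[OF assms] .
  let ?g = "bd D \<one>\<^bsub>fib D e\<^esub>"
  note g = T.H_classD[OF bd_H_class[OF assms one_closed]]
  have "?g \<cdot> ?g = ?g" using bd_mult[OF assms one_closed one_closed] by simp
  then have "?g\<^sup>\<star> \<cdot> ?g \<cdot> ?g = ?g\<^sup>\<star> \<cdot> ?g" using g(1) by (simp add: T.m_assoc)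
  then show ?thesis using g by simp
qed

lemma bd_inv:
  assumes "e \<in> idems T" "c \<in> carrier (fib D e)"
  shows "bd D (inv\<^bsub>fib D e\<^esub> c) = (bd D c)\<^sup>\<star>"
proof -
  interpret group "fib D e" using fib_group[OF assms(1)] .
  let ?g = "bd D c" and ?h = "bd D (inv\<^bsub>fib D e\<^esub> c)"
  note g = T.H_classD[OF bd_H_class[OF assms]]
  note h = T.H_classD[OF bd_H_class[OF assms(1) inv_closed[OF assms(2)]]]
  have "?g \<cdot> ?h = e"
    using bd_mult[OF assms inv_closed[OF assms(2)]] bd_one[OF assms(1)] assms(2) by simp
  then have "?g\<^sup>\<star> \<cdot> ?g \<cdot> ?h = ?g\<^sup>\<star> \<cdot> e" using g(1) h(1) by (simp add: T.m_assoc)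
  then show ?thesis using g h by simp
qed

lemma act_group_hom:
  assumes "w \<in> carrier T"
  shows "group_hom (fib D (w \<cdot> w\<^sup>\<star>)) (fib D (w\<^sup>\<star> \<cdot> w)) (\<lambda>c. act D c w)"
  using D.act_iso[of w] assms fib_group
  by (simp add: group_hom_def group_hom_axioms_def iso_def)

text \<open>A priori \<open>\<sigma>\<close> takes its value in some fibre. The boundary of this
  value lies in the vertex group at \<open>x\<close>, and an element determines the vertex group in
  which it lies.\<close>

lemma \<sigma>_fib:
  assumes "(l, r, x) \<in> basis_set X \<R>"
  shows "\<sigma> (l, r, x) \<in> carrier (fib D x)"
proof -
  obtain x' where x': "x' \<in> idems T" "\<sigma> (l, r, x) \<in> carrier (fib D x')"
    using \<sigma>[OF assms] by (auto simp: total_set_def)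
  then have "basis_map X \<R> (l, r, x) \<in> T.H_class x'" using bd_H_class \<sigma>[OF assms] by metis
  then have "x' = x" using basis_path(3)[OF assms] T.H_classD(2) by metis
  then show ?thesis using x' by simp
qed

text \<open>The value of the sought morphism on a forward edge translated back to start at \<open>e\<close>. The left
  component of the edge is irrelevant; the factor \<open>e\<close> extends the definition to edges that are not
  local at \<open>e\<close>, which occur in homotopies between local paths.\<close>

definition edge_val :: "'x T_elt \<Rightarrow> 'x sq_edge \<Rightarrow> 'd" where
  "edge_val e = (\<lambda>(x, l, r, y). act D (\<sigma> (l, r, (y \<cdot> e) \<cdot> (y \<cdot> e)\<^sup>\<star>)) (y \<cdot> e))"

lemma edge_val_eq:
  "edge_val e (x, l, r, y) = act D (\<sigma> (l, r, (y \<cdot> e) \<cdot> (y \<cdot> e)\<^sup>\<star>)) (y \<cdot> e)"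
  by (simp add: edge_val_def)

definition step_val :: "'x T_elt \<Rightarrow> 'x sq_edge \<times> bool \<Rightarrow> 'd" where
  "step_val e a = (if snd a then edge_val e (fst a) else inv\<^bsub>fib D e\<^esub> (edge_val e (fst a)))"

primrec path_val :: "'x T_elt \<Rightarrow> ('x sq_edge \<times> bool) list \<Rightarrow> 'd" where
  "path_val e [] = \<one>\<^bsub>fib D e\<^esub>"
| "path_val e (a # p) = step_val e a \<odot>\<^bsub>e\<^esub> path_val e p"

lemma edge_basis:
  assumes "(l, r) \<in> \<R>" "x \<in> carrier T" "y \<in> carrier T" "x \<cdot> t l \<cdot> y \<in> T.H_class e"
  shows "(l, r, (y \<cdot> e) \<cdot> (y \<cdot> e)\<^sup>\<star>) \<in> basis_set X \<R>"
  unfolding basis_set_iff using assms(1) edge_local(1,3)[OF assms] by (simp del: T.sinv_mult)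

text \<open>Acting by \<open>z = y \<cdot> e\<close> carries the fibre at the domain of
  \<open>z\<close> to the fibre at its range, which is \<open>e\<close>. The boundary is the
  displacement from the start to the end of the edge, in the form that telescopes along a
  path.\<close>

lemma edge_val:
  assumes "(l, r) \<in> \<R>" "x \<in> carrier T" "y \<in> carrier T" "x \<cdot> t l \<cdot> y \<in> T.H_class e"
  shows "edge_val e (x, l, r, y) \<in> carrier (fib D e)"
    "bd D (edge_val e (x, l, r, y)) = (x \<cdot> t l \<cdot> y)\<^sup>\<star> \<cdot> (x \<cdot> t r \<cdot> y)"
proof -
  let ?z = "y \<cdot> e"
  note z = edge_local[OF assms]
  let ?b = "(l, r, ?z \<cdot> ?z\<^sup>\<star>)"
  have b: "?b \<in> basis_set X \<R>" by (rule edge_basis[OF assms])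
  interpret group_hom "fib D (?z \<cdot> ?z\<^sup>\<star>)" "fib D (?z\<^sup>\<star> \<cdot> ?z)" "\<lambda>c. act D c ?z"
    by (rule act_group_hom[OF z(1)])
  show "edge_val e (x, l, r, y) \<in> carrier (fib D e)"
    using hom_closed[OF \<sigma>_fib[OF b]] z(2) by (simp add: edge_val_def del: T.sinv_mult)
  have "bd D (edge_val e (x, l, r, y)) = ?z\<^sup>\<star> \<cdot> basis_map X \<R> ?b \<cdot> ?z"
    using D.bd_act[of ?z "\<sigma> ?b"] z(1) \<sigma>_fib[OF b] \<sigma>[OF b] by (simp add: edge_val_def del: T.sinv_mult)
  also have "basis_map X \<R> ?b = (?z \<cdot> ?z\<^sup>\<star>) \<cdot> ((t l)\<^sup>\<star> \<cdot> t r) \<cdot> (?z \<cdot> ?z\<^sup>\<star>)"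
    using basis_map_eq[OF assms(1)] .
  also have "?z\<^sup>\<star> \<cdot> \<dots> \<cdot> ?z = ?z\<^sup>\<star> \<cdot> ((t l)\<^sup>\<star> \<cdot> t r) \<cdot> ?z"
    using z(1) assms(1) by (simp add: T.m_assoc del: T.sinv_mult)
  finally show "bd D (edge_val e (x, l, r, y)) = (x \<cdot> t l \<cdot> y)\<^sup>\<star> \<cdot> (x \<cdot> t r \<cdot> y)"
    using z(5) by simp
qed

lemma path_ConsE:
  assumes "Sq.path u (a # p) v"
  obtains x l r y \<epsilon> w where "a = ((x, l, r, y), \<epsilon>)" "x \<in> carrier T" "(l, r) \<in> \<R>" "y \<in> carrier T"
    "Sq.path u [a] w" "Sq.path w p v"
    "u = (if \<epsilon> then x \<cdot> t l \<cdot> y else x \<cdot> t r \<cdot> y)" "w = (if \<epsilon> then x \<cdot> t r \<cdot> y else x \<cdot> t l \<cdot> y)"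
proof -
  obtain E \<epsilon> where "a = (E, \<epsilon>)" by (cases a)
  then obtain x l r y where a: "a = ((x, l, r, y), \<epsilon>)" by (cases E) auto
  show thesis by (rule that[OF a]) (use assms a in \<open>auto split: if_splits\<close>)
qed

lemma step_val:
  assumes "Sq.path u [a] v" "u \<in> T.H_class e"
  shows "step_val e a \<in> carrier (fib D e)" "bd D (step_val e a) = u\<^sup>\<star> \<cdot> v"
proof -
  obtain x l r y \<epsilon> w where a: "a = ((x, l, r, y), \<epsilon>)" "x \<in> carrier T" "(l, r) \<in> \<R>" "y \<in> carrier T"
    "Sq.path w [] v" "u = (if \<epsilon> then x \<cdot> t l \<cdot> y else x \<cdot> t r \<cdot> y)"
    "w = (if \<epsilon> then x \<cdot> t r \<cdot> y else x \<cdot> t l \<cdot> y)"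
    using path_ConsE[OF assms(1)] by metis
  then have v: "v = w" by simp
  have H: "x \<cdot> t l \<cdot> y \<in> T.H_class e" using a(6) assms(2) H_class_edge[OF a(3,2,4)] by (auto split: if_splits)
  have e: "e \<in> idems T" using T.H_classD(4)[OF H] .
  interpret group "fib D e" using fib_group[OF e] .
  note E = edge_val[OF a(3,2,4) H]
  show "step_val e a \<in> carrier (fib D e)" using E(1) by (simp add: step_val_def a(1))
  show "bd D (step_val e a) = u\<^sup>\<star> \<cdot> v"
  proof (cases \<epsilon>)
    case True
    then show ?thesis using E(2) by (simp add: step_val_def a(1,6,7) v del: T.sinv_mult)
  next
    case False
    let ?s = "x \<cdot> t l \<cdot> y" and ?s' = "x \<cdot> t r \<cdot> y"
    have "bd D (step_val e a) = (?s\<^sup>\<star> \<cdot> ?s')\<^sup>\<star>"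
      using False bd_inv[OF e E(1)] E(2) by (simp add: step_val_def a(1) del: T.sinv_mult)
    also have "\<dots> = ?s'\<^sup>\<star> \<cdot> ?s"
      using T.sinv_mult[of "?s\<^sup>\<star>" ?s'] T.sinv_sinv[of ?s] a(2-4) by (simp del: T.sinv_mult)
    finally show ?thesis using False by (simp add: a(6,7) v)
  qed
qed

text \<open>Displacements of consecutive pieces telescope, since the idempotent
  \<open>w \<cdot> w\<^sup>\<star> = e\<close> between them is absorbed. Paths start anywhere in the
  vertex group, as the tail in the induction does.\<close>

lemma path_val:
  "\<lbrakk>Sq.path u p v; u \<in> T.H_class e\<rbrakk> \<Longrightarrow>
     path_val e p \<in> carrier (fib D e) \<and> bd D (path_val e p) = u\<^sup>\<star> \<cdot> v"
proof (induction p arbitrary: u)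
  case Nil
  then show ?case
    using bd_one[of e] monoid.one_closed[OF group.is_monoid[OF fib_group[of e]]] T.H_classD[OF Nil(2)] by simp
next
  case (Cons a p)
  obtain w where w: "Sq.path u [a] w" "Sq.path w p v" using path_ConsE[OF Cons.prems(1)] by metis
  have wH: "w \<in> T.H_class e" using path_H_class w Cons.prems by blast
  note u = T.H_classD[OF Cons.prems(2)] and w' = T.H_classD[OF wH]
  note S = step_val[OF w(1) Cons.prems(2)] and IH = Cons.IH[OF w(2) wH]
  interpret group "fib D e" using fib_group[OF u(4)] .
  have "v \<in> carrier T" using path_carrier(2)[OF w(2)] .
  then have "u\<^sup>\<star> \<cdot> w \<cdot> (w\<^sup>\<star> \<cdot> v) = u\<^sup>\<star> \<cdot> (w \<cdot> w\<^sup>\<star>) \<cdot> v" using u(1) w'(1) by (simp add: T.m_assoc)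
  then have "u\<^sup>\<star> \<cdot> w \<cdot> (w\<^sup>\<star> \<cdot> v) = u\<^sup>\<star> \<cdot> v" using w' u by simp
  then show ?case using S IH bd_mult[OF u(4) S(1)] by simp
qed

lemma path_val_append:
  "\<lbrakk>Sq.path u p v; Sq.path v q w; u \<in> T.H_class e\<rbrakk> \<Longrightarrow>
     path_val e (p @ q) = path_val e p \<odot>\<^bsub>e\<^esub> path_val e q"
proof (induction p arbitrary: u)
  case Nil
  interpret group "fib D e" using fib_group T.H_classD(4) Nil by blast
  show ?case using path_val[of v q w e] Nil by simp
next
  case (Cons a p)
  obtain z where z: "Sq.path u [a] z" "Sq.path z p v" using path_ConsE[OF Cons.prems(1)] by metis
  have zH: "z \<in> T.H_class e" using path_H_class z Cons.prems by blast
  have vH: "v \<in> T.H_class e" using path_H_class Cons.prems by blast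
  interpret group "fib D e" using fib_group T.H_classD(4)[OF vH] by blast
  show ?case
    using Cons.IH[OF z(2) Cons.prems(2) zH] step_val(1)[OF z(1) Cons.prems(3)] path_val[OF z(2) zH]
      path_val[OF Cons.prems(2) vH] by (simp add: m_assoc)
qed

text \<open>The two edges for \<open>(l', r')\<close> differ only in the left component and share
  one value \<open>a\<close>. Between the two edges for \<open>(l, r)\<close>, the localised right
  component is multiplied by \<open>g\<close>, the boundary of \<open>a\<close>, so their values are
  \<open>b\<close> and \<open>b\<close> acted on by \<open>g\<close>. The Peiffer identity in
  \<open>D\<close> makes the latter the conjugate of \<open>b\<close> by \<open>a\<close>, and the
  two paths give \<open>b a = a (a^-1 b a)\<close>.\<close>

lemma path_val_cell:
  assumes "(v, c, c') \<in> cells K" "v \<in> T.H_class e"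
  shows "path_val e c = path_val e c'"
proof -
  obtain p l r q p' l' r' q' where *:
    "p \<in> carrier T" "q \<in> carrier T" "p' \<in> carrier T" "q' \<in> carrier T"
    "(l, r) \<in> \<R>" "(l', r') \<in> \<R>" "v = p \<cdot> t l \<cdot> q \<cdot> p' \<cdot> t l' \<cdot> q'"
    "c = [((p, l, r, q \<cdot> p' \<cdot> t l' \<cdot> q'), True), ((p \<cdot> t r \<cdot> q \<cdot> p', l', r', q'), True)]"
    "c' = [((p \<cdot> t l \<cdot> q \<cdot> p', l', r', q'), True), ((p, l, r, q \<cdot> p' \<cdot> t r' \<cdot> q'), True)]"
    by (rule cellE[OF assms(1)])
  let ?Y = "q \<cdot> p' \<cdot> t l' \<cdot> q'" and ?P = "p \<cdot> t l \<cdot> q \<cdot> p'"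
  have Y: "?Y \<in> carrier T" and P: "?P \<in> carrier T" using * by simp_all
  have "v = p \<cdot> t l \<cdot> ?Y" "v = ?P \<cdot> t l' \<cdot> q'" using *(1-7) by (simp_all add: T.m_assoc)
  then have H1: "p \<cdot> t l \<cdot> ?Y \<in> T.H_class e" and H2: "?P \<cdot> t l' \<cdot> q' \<in> T.H_class e"
    using assms(2) by simp_all
  have e: "e \<in> idems T" "e \<in> carrier T" using T.H_classD(4)[OF assms(2)] by simp_all
  let ?a = "edge_val e (?P, l', r', q')" and ?b = "edge_val e (p, l, r, ?Y)"
  let ?b' = "edge_val e (p, l, r, q \<cdot> p' \<cdot> t r' \<cdot> q')"
  note a = edge_val[OF *(6) P *(4) H2] and b = edge_val[OF *(5,1) Y H1]
  note y = edge_local[OF *(5,1) Y H1] and z = edge_local[OF *(6) P *(4) H2]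
  let ?y = "?Y \<cdot> e" and ?z = "q' \<cdot> e" and ?g = "bd D ?a"
  have g: "?g = ?z\<^sup>\<star> \<cdot> ((t l')\<^sup>\<star> \<cdot> t r') \<cdot> ?z" using a(2) z(5) by simp
  note gH = T.H_classD[OF bd_H_class[OF e(1) a(1)]]
  \<comment> \<open>The idempotent that appears between \<open>q \<cdot> p'\<close> and
    \<open>t r' \<cdot> ?z\<close> is the domain of \<open>t l' \<cdot> ?z\<close>; it is absorbed
    because both sides of the relation have the same domain here.\<close>
  have "?y \<cdot> ?g = q \<cdot> p' \<cdot> ((t l' \<cdot> ?z) \<cdot> (t l' \<cdot> ?z)\<^sup>\<star> \<cdot> (t r' \<cdot> ?z))"
    unfolding g using *(1-6) e by (simp add: T.m_assoc)
  also have "\<dots> = q \<cdot> p' \<cdot> t r' \<cdot> q' \<cdot> e" unfolding z(6) using *(1-6) e by (simp add: T.m_assoc)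
  finally have yg: "q \<cdot> p' \<cdot> t r' \<cdot> q' \<cdot> e = ?y \<cdot> ?g" by simp
  \<comment> \<open>As \<open>?g\<close> lies in the vertex group at the range of \<open>?y\<close>,
    the domain is unchanged, so \<open>?b\<close> and \<open>?b'\<close> come from the same basis
    element.\<close>
  have "?y \<cdot> ?g \<cdot> (?y \<cdot> ?g)\<^sup>\<star> = ?y \<cdot> (?g \<cdot> ?g\<^sup>\<star>) \<cdot> ?y\<^sup>\<star>"
    unfolding T.sinv_mult[OF y(1) gH(1)] using y(1) gH(1) by (simp add: T.m_assoc del: T.sinv_mult)
  also have "\<dots> = ?y \<cdot> ?y\<^sup>\<star>" unfolding gH(2) using e Y by (simp add: T.m_assoc del: T.sinv_mult)
  finally have yg': "?y \<cdot> ?g \<cdot> (?y \<cdot> ?g)\<^sup>\<star> = ?y \<cdot> ?y\<^sup>\<star>" .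
  have "?b' = act D (\<sigma> (l, r, ?y \<cdot> ?y\<^sup>\<star>)) (?y \<cdot> ?g)"
    using edge_val_eq[of e p l r "q \<cdot> p' \<cdot> t r' \<cdot> q'"] unfolding yg yg' .
  also have "\<dots> = act D ?b ?g"
    using D.act_comp[of ?y ?g "\<sigma> (l, r, ?y \<cdot> ?y\<^sup>\<star>)"] y(1,2) gH(1,2) \<sigma>_fib[OF edge_basis[OF *(5,1) Y H1]]
    by (simp add: edge_val_def del: T.sinv_mult)
  also have "\<dots> = inv\<^bsub>fib D e\<^esub> ?a \<odot>\<^bsub>e\<^esub> ?b \<odot>\<^bsub>e\<^esub> ?a"
    using D.peiffer[of e ?a ?b] a(1) b(1) e by simp
  finally have b': "?b' = inv\<^bsub>fib D e\<^esub> ?a \<odot>\<^bsub>e\<^esub> ?b \<odot>\<^bsub>e\<^esub> ?a" .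
  interpret group "fib D e" using fib_group[OF e(1)] .
  have "?a \<odot>\<^bsub>e\<^esub> ?b' = ?b \<odot>\<^bsub>e\<^esub> ?a"
    unfolding b' using a(1) b(1) by (simp add: m_assoc[symmetric])
  moreover have "?b' \<in> carrier (fib D e)" unfolding b' using a(1) b(1) by simp
  moreover have "edge_val e (p \<cdot> t r \<cdot> q \<cdot> p', l', r', q') = ?a" by (simp add: edge_val_def)
  ultimately show ?thesis using a(1) b(1) by (simp add: *(8,9) step_val_def)
qed

lemma path_val_homotopy:
  "\<lbrakk>(x, y) \<in> homotopy K; fst x \<in> T.H_class e\<rbrakk> \<Longrightarrow> path_val e (snd x) = path_val e (snd y)"
proof (induction rule: homotopy.induct)
  case sym
  then show ?case using Sq.homotopy_ends by metis
next
  case trans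
  then show ?case using Sq.homotopy_ends by metis
next
  case (cancel u a v E s w b z)
  then have uH: "u \<in> T.H_class e" by simp
  then have vH: "v \<in> T.H_class e" using path_H_class cancel(1) by blast
  have p: "Sq.path v ((E, s) # (E, \<not> s) # b) z"
    using cancel(2,3) by (auto simp: Sq.ends simp del: Squier_simps split: if_splits)
  interpret group "fib D e" using fib_group T.H_classD(4)[OF uH] by blast
  \<comment> \<open>The vertex \<open>v\<close> is the start of \<open>E\<close> only for a forward
    step; for a backward step the start lies in the vertex group because the other end does.\<close>
  have E: "edge_val e E \<in> carrier (fib D e)"
    using step_val(1)[OF cancel(2) vH] cancel(2) vH
    by (cases E) (auto simp: step_val_def H_class_edge split: if_splits intro!: edge_val)
  have b: "path_val e b \<in> carrier (fib D e)" using path_val[OF cancel(3) vH] by blast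
  have "path_val e ((E, s) # (E, \<not> s) # b) = path_val e b"
    using E b by (simp add: step_val_def m_assoc[symmetric])
  then show ?case
    using path_val_append[OF cancel(1) p uH] path_val_append[OF cancel(1,3) uH] by simp
next
  case (cell v c c' u a w b z)
  then have uH: "u \<in> T.H_class e" by simp
  then have vH: "v \<in> T.H_class e" using path_H_class cell(2) by blast
  show ?case
    using path_val_append[OF cell(2) Sq.path_appendI[OF cell(3,5)] uH]
      path_val_append[OF cell(2) Sq.path_appendI[OF cell(4,5)] uH]
      path_val_append[OF cell(3,5) vH] path_val_append[OF cell(4,5) vH]
      path_val_cell[OF cell(1) vH] by simp
qed auto

text \<open>The left component does not enter \<open>edge_val\<close>. As \<open>ast\<close>
  concatenates after a left translation, this makes \<open>path_val\<close> multiplicative for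
  it.\<close>

lemma path_val_lpath: "path_val e (lpath s p) = path_val e p"
proof (induction p)
  case (Cons a p)
  then show ?case by (cases a, cases "fst a") (simp add: step_val_def edge_val_def)
qed simp

text \<open>Right translation by \<open>w\<close> replaces the localised right component
  \<open>?z\<close> by \<open>?z \<cdot> w\<close>. Its domain stays the same because
  \<open>?z\<close> ends at the domain of \<open>w\<close>, so the same basis element is acted on,
  by a composite arrow.\<close>

lemma step_val_rpath:
  assumes "Sq.path u [(E, \<epsilon>)] v" "w \<in> carrier T" "u \<in> T.H_class (w \<cdot> w\<^sup>\<star>)"
  shows "step_val (w\<^sup>\<star> \<cdot> w) (rmul w E, \<epsilon>) = act D (step_val (w \<cdot> w\<^sup>\<star>) (E, \<epsilon>)) w"
proof -
  let ?e = "w \<cdot> w\<^sup>\<star>" and ?f = "w\<^sup>\<star> \<cdot> w"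
  obtain x l r y where E: "E = (x, l, r, y)" by (cases E)
  have lr: "(l, r) \<in> \<R>" "x \<in> carrier T" "y \<in> carrier T" using assms(1) by (auto simp: E)
  have H: "x \<cdot> t l \<cdot> y \<in> T.H_class ?e"
    using assms(1,3) H_class_edge[OF lr, of ?e] by (auto simp: E split: if_splits)
  let ?z = "y \<cdot> ?e"
  note z = edge_local[OF lr H]
  have yw: "y \<cdot> w \<cdot> ?f = ?z \<cdot> w" using lr assms(2) by (simp add: T.m_assoc)
  have yw': "?z \<cdot> w \<cdot> (?z \<cdot> w)\<^sup>\<star> = ?z \<cdot> ?z\<^sup>\<star>" using lr assms(2) by (simp add: T.m_assoc)
  have "edge_val ?f (rmul w E) = act D (\<sigma> (l, r, ?z \<cdot> ?z\<^sup>\<star>)) (?z \<cdot> w)"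
    unfolding E lmul_rmul_simps edge_val_def prod.case yw yw' ..
  also have "\<dots> = act D (edge_val ?e E) w"
    using D.act_comp[of ?z w "\<sigma> (l, r, ?z \<cdot> ?z\<^sup>\<star>)"] z(1,2) assms(2) \<sigma>_fib[OF edge_basis[OF lr H]]
    by (simp add: edge_val_def E del: T.sinv_mult)
  finally have 1: "edge_val ?f (rmul w E) = act D (edge_val ?e E) w" .
  interpret group_hom "fib D ?e" "fib D ?f" "\<lambda>c. act D c w" by (rule act_group_hom[OF assms(2)])
  show ?thesis using 1 hom_inv[OF edge_val(1)[OF lr H]] by (simp add: step_val_def E)
qed

lemma path_val_rpath:
  "\<lbrakk>Sq.path u p v; w \<in> carrier T; u \<in> T.H_class (w \<cdot> w\<^sup>\<star>)\<rbrakk> \<Longrightarrow>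
     path_val (w\<^sup>\<star> \<cdot> w) (rpath p w) = act D (path_val (w \<cdot> w\<^sup>\<star>) p) w"
proof (induction p arbitrary: u)
  case Nil
  interpret group_hom "fib D (w \<cdot> w\<^sup>\<star>)" "fib D (w\<^sup>\<star> \<cdot> w)" "\<lambda>c. act D c w" by (rule act_group_hom[OF Nil(2)])
  show ?case by simp
next
  case (Cons a p)
  interpret group_hom "fib D (w \<cdot> w\<^sup>\<star>)" "fib D (w\<^sup>\<star> \<cdot> w)" "\<lambda>c. act D c w"
    by (rule act_group_hom[OF Cons.prems(2)])
  obtain z where z: "Sq.path u [a] z" "Sq.path z p v" using path_ConsE[OF Cons.prems(1)] by metis
  obtain E \<epsilon> where a: "a = (E, \<epsilon>)" by (cases a)
  have zH: "z \<in> T.H_class (w \<cdot> w\<^sup>\<star>)" using path_H_class z Cons.prems by blast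
  show ?case
    using Cons.IH[OF z(2) Cons.prems(2) zH] step_val_rpath[OF z(1)[unfolded a] Cons.prems(2,3)]
      hom_mult[OF step_val(1)[OF z(1) Cons.prems(3)]] path_val[OF z(2) zH] by (simp add: a)
qed

text \<open>The domain recovers the vertex from the class, which gives one function on all fibres;
  the choice of a representative is harmless by \<open>path_val_homotopy\<close>.\<close>

definition induced :: "'x sq_arr \<Rightarrow> 'd" where
  "induced \<alpha> = path_val (gdom Sq.\<pi> \<alpha>) (SOME p. (gdom Sq.\<pi> \<alpha>, p) \<in> \<alpha>)"

lemma induced_cls:
  assumes "Sq.path e p v" "e \<in> idems T" shows "induced (Sq.cls e p) = path_val e p"
proof -
  have "\<exists>q. (e, q) \<in> Sq.cls e p" using Sq.cls_self[OF assms(1)] by blast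
  from someI_ex[OF this] have "((e, p), (e, SOME q. (e, q) \<in> Sq.cls e p)) \<in> homotopy K" by blast
  from path_val_homotopy[OF this, of e] show ?thesis
    using Sq.gdom_cls[OF assms(1)] T.H_class_self[OF assms(2)] by (simp add: induced_def)
qed

lemma induced_morphism: "xmod_morphism \<G> \<S> D induced"
  unfolding xmod_morphism_def
proof (intro conjI ballI)
  fix e assume "e \<in> objs \<G>"
  then have e: "e \<in> idems T" by simp
  note eH = T.H_class_self[OF e]
  show "induced \<in> hom (fib \<S> e) (fib D e)"
  proof (rule homI)
    fix \<alpha> assume "\<alpha> \<in> carrier (fib \<S> e)"
    then obtain p v where p: "\<alpha> = Sq.cls e p" "Sq.path e p v" "local_path e p" "v \<in> T.H_class e"
      using star_bowtieE[OF _ e] unfolding S_bowtie_simps by blast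
    show "induced \<alpha> \<in> carrier (fib D e)"
      using path_val[OF p(2) eH] induced_cls[OF p(2) e] p(1) by simp
    fix \<beta> assume "\<beta> \<in> carrier (fib \<S> e)"
    then obtain q w where q: "\<beta> = Sq.cls e q" "Sq.path e q w"
      using star_bowtieE[OF _ e] unfolding S_bowtie_simps by blast
    have L: "Sq.path v (lpath v q) (v \<cdot> w)"
      using path_lpath[OF _ q(2), of v] T.H_classD[OF p(4)] by simp
    have "induced (\<alpha> \<otimes>\<^bsub>fib \<S> e\<^esub> \<beta>) = path_val e (p @ lpath v q)"
      using ast_cls[OF p(2) q(2) p(3,4)] induced_cls[OF path_ast[OF p(2) q(2) p(4)] e] p(1) q(1) by simp
    also have "\<dots> = path_val e p \<odot>\<^bsub>e\<^esub> path_val e q"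
      using path_val_append[OF p(2) L eH] by (simp add: path_val_lpath)
    finally show "induced (\<alpha> \<otimes>\<^bsub>fib \<S> e\<^esub> \<beta>) = induced \<alpha> \<odot>\<^bsub>e\<^esub> induced \<beta>"
      using induced_cls[OF p(2) e] induced_cls[OF q(2) e] p(1) q(1) by simp
  qed
next
  fix w \<alpha> assume "w \<in> arrs \<G>" "\<alpha> \<in> carrier (fib \<S> (gdom \<G> w))"
  then have w: "w \<in> carrier T" and \<alpha>: "\<alpha> \<in> star_bowtie X \<R> (w \<cdot> w\<^sup>\<star>)" by simp_all
  obtain p v where p: "\<alpha> = Sq.cls (w \<cdot> w\<^sup>\<star>) p" "Sq.path (w \<cdot> w\<^sup>\<star>) p v"
    using star_bowtieE[OF \<alpha> T.dom_idem[OF w]] by blast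
  have "induced (act \<S> \<alpha> w) = path_val (w\<^sup>\<star> \<cdot> w) (rpath (lpath w\<^sup>\<star> p) w)"
    using act_cls[OF p(2) w] induced_cls[OF path_act[OF p(2) w] T.ran_idem[OF w]] p(1) by simp
  also have "\<dots> = path_val (w\<^sup>\<star> \<cdot> w) (rpath p w)"
    using lpath_rpath path_val_lpath by metis
  also have "\<dots> = act D (path_val (w \<cdot> w\<^sup>\<star>) p) w"
    using path_val_rpath[OF p(2) w T.H_class_self] w by simp
  finally show "induced (act \<S> \<alpha> w) = act D (induced \<alpha>) w"
    using induced_cls[OF p(2) T.dom_idem[OF w]] p(1) by simp
next
  fix \<alpha> assume "\<alpha> \<in> total_set \<G> \<S>"
  then obtain e where e: "e \<in> idems T" "\<alpha> \<in> star_bowtie X \<R> e" by (auto simp: total_set_def)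
  then obtain p v where p: "\<alpha> = Sq.cls e p" "Sq.path e p v" "v \<in> T.H_class e"
    using star_bowtieE by metis
  have "bd D (path_val e p) = e\<^sup>\<star> \<cdot> v" using path_val[OF p(2) T.H_class_self[OF e(1)]] by blast
  then show "bd \<S> \<alpha> = bd D (induced \<alpha>)"
    using induced_cls[OF p(2) e(1)] p e T.H_classD[OF p(3)] by simp
qed

lemma induced_basis:
  assumes "b \<in> basis_set X \<R>" shows "induced (basis_elt b) = \<sigma> b"
proof -
  obtain l r x where b: "b = (l, r, x)" by (cases b) auto
  have x: "x \<in> idems T" using assms by (auto simp: b basis_set_iff)
  interpret group "fib D x" using fib_group[OF x] .
  have s: "\<sigma> b \<in> carrier (fib D x)" using \<sigma>_fib assms by (simp add: b)
  have "induced (basis_elt b) = path_val x [((x \<cdot> (t l)\<^sup>\<star>, l, r, x), True)]"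
    using induced_cls[OF basis_path(1)[OF assms[unfolded b]] x] by (simp add: b basis_elt_def)
  also have "\<dots> = \<sigma> b"
    using x s D.act_id[of x "\<sigma> b"] by (simp add: step_val_def edge_val_def b)
  finally show ?thesis .
qed

section \<open>Uniqueness of the induced morphism\<close>

lemma morphism_forward_edge:
  assumes \<phi>: "xmod_morphism \<G> \<S> D \<phi>" "\<And>b. b \<in> basis_set X \<R> \<Longrightarrow> \<phi> (basis_elt b) = \<sigma> b"
    and lr: "(l, r) \<in> \<R>" "x \<in> carrier T" "y \<in> carrier T"
    and H: "x \<cdot> t l \<cdot> y \<in> T.H_class e" and ye: "y \<cdot> e = y"
  shows "\<phi> (Sq.cls e (lpath (x \<cdot> t l \<cdot> y)\<^sup>\<star> [((x, l, r, y), True)])) = edge_val e (x, l, r, y)"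
proof -
  note y = edge_local[OF lr H, unfolded ye]
  let ?x = "y \<cdot> y\<^sup>\<star>"
  have b: "(l, r, ?x) \<in> basis_set X \<R>" using edge_basis[OF lr H] ye by simp
  have x: "?x \<in> idems T" using lr by simp
  let ?p = "[((?x \<cdot> (t l)\<^sup>\<star>, l, r, ?x), True)]"
  note p = basis_path(1,2)[OF b]
  \<comment> \<open>Here the original left component disappears: conjugating the basis edge by
    \<open>y\<close> leaves \<open>y\<^sup>\<star> \<cdot> (t l)\<^sup>\<star>\<close>, which
    \<open>edge_local\<close> identifies with the translate of \<open>x\<close>.\<close>
  have "y\<^sup>\<star> \<cdot> (?x \<cdot> (t l)\<^sup>\<star>) = y\<^sup>\<star> \<cdot> (t l)\<^sup>\<star>" "?x \<cdot> y = y" using lr by (simp_all add: T.m_assoc)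
  then have "rpath (lpath y\<^sup>\<star> ?p) y = lpath (x \<cdot> t l \<cdot> y)\<^sup>\<star> [((x, l, r, y), True)]"
    using y(4) by simp
  then have "act \<S> (basis_elt (l, r, ?x)) y = Sq.cls e (lpath (x \<cdot> t l \<cdot> y)\<^sup>\<star> [((x, l, r, y), True)])"
    using act_cls[OF p(1) lr(3)] y(2) by (simp add: basis_elt_def)
  moreover have "\<phi> (act \<S> (basis_elt (l, r, ?x)) y) = act D (\<phi> (basis_elt (l, r, ?x))) y"
    using \<phi>(1) lr(3) cls_in_star_bowtie[OF p x]
    unfolding xmod_morphism_def basis_elt_def by (simp del: S_bowtie_simps(5))
  ultimately show ?thesis using \<phi>(2)[OF b] by (simp add: edge_val_def ye)
qed

text \<open>The start is allowed to be any \<open>u\<close> in the vertex group, translated back to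
  \<open>e\<close>, because the tail of a path in the induction no longer starts at
  \<open>e\<close>.\<close>

lemma morphism_unique_path:
  assumes \<phi>: "xmod_morphism \<G> \<S> D \<phi>" "\<And>b. b \<in> basis_set X \<R> \<Longrightarrow> \<phi> (basis_elt b) = \<sigma> b"
    and e: "e \<in> idems T" and p: "Sq.path u p v" "u \<in> T.H_class e" "local_path e p"
  shows "\<phi> (Sq.cls e (lpath u\<^sup>\<star> p)) = path_val e p"
proof -
  have "\<phi> \<in> hom (fib \<S> e) (fib D e)" using \<phi>(1) e by (simp add: xmod_morphism_def)
  then interpret group_hom "fib \<S> e" "fib D e" \<phi>
    using S_bowtie_group[OF e] fib_group[OF e] by (simp add: group_hom_def group_hom_axioms_def)
  have to_star: "Sq.path e (lpath u\<^sup>\<star> p) (u\<^sup>\<star> \<cdot> v)" "local_path e (lpath u\<^sup>\<star> p)"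
    "Sq.cls e (lpath u\<^sup>\<star> p) \<in> carrier (fib \<S> e)"
    if "Sq.path u p v" "u \<in> T.H_class e" "local_path e p" for u p v
  proof -
    note u = T.H_classD[OF that(2)]
    show 1: "Sq.path e (lpath u\<^sup>\<star> p) (u\<^sup>\<star> \<cdot> v)" using path_lpath[OF _ that(1), of "u\<^sup>\<star>"] u by simp
    show 2: "local_path e (lpath u\<^sup>\<star> p)"
      using local_path_lpath[OF that(1,3)] T.H_class_sinv[OF that(2)] by blast
    show "Sq.cls e (lpath u\<^sup>\<star> p) \<in> carrier (fib \<S> e)" using cls_in_star_bowtie[OF 1 2 e] by simp
  qed
  \<comment> \<open>Each piece is translated back to \<open>e\<close> by its own start. The first
    translated piece ends at \<open>u\<^sup>\<star> \<cdot> v\<close>, and the translation by it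
    inside \<open>ast\<close> turns the factor \<open>v\<^sup>\<star>\<close> on the second piece
    into \<open>u\<^sup>\<star>\<close>.\<close>
  have ast: "Sq.cls e (lpath u\<^sup>\<star> p) \<otimes>\<^bsub>fib \<S> e\<^esub> Sq.cls e (lpath v\<^sup>\<star> q) = Sq.cls e (lpath u\<^sup>\<star> (p @ q))"
    if p: "Sq.path u p v" "u \<in> T.H_class e" "local_path e p" and q: "Sq.path v q w" "local_path e q"
    for u p v q w
  proof -
    have vH: "v \<in> T.H_class e" using path_H_class p by blast
    note u = T.H_classD[OF p(2)] and v = T.H_classD[OF vH]
    have uv: "u\<^sup>\<star> \<cdot> v \<in> T.H_class e" using T.H_class_mult T.H_class_sinv p(2) vH by blast
    have "u\<^sup>\<star> \<cdot> v \<cdot> v\<^sup>\<star> = u\<^sup>\<star> \<cdot> (v \<cdot> v\<^sup>\<star>)" using u(1) v(1) by (simp add: T.m_assoc)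
    then have "lpath (u\<^sup>\<star> \<cdot> v) (lpath v\<^sup>\<star> q) = lpath u\<^sup>\<star> q"
      using lpath_lpath[OF q(1), of "u\<^sup>\<star> \<cdot> v" "v\<^sup>\<star>"] u v by simp
    then show ?thesis
      using ast_cls[OF to_star(1)[OF p] to_star(1)[OF q(1) vH q(2)] to_star(2)[OF p] uv] by simp
  qed
  show ?thesis using p
  proof (induction p arbitrary: u)
    case Nil
    then show ?case using hom_one by simp
  next
    case (Cons a p)
    obtain x l r y \<epsilon> w where a: "a = ((x, l, r, y), \<epsilon>)" "x \<in> carrier T" "(l, r) \<in> \<R>" "y \<in> carrier T"
      "Sq.path u [a] w" "Sq.path w p v" "u = (if \<epsilon> then x \<cdot> t l \<cdot> y else x \<cdot> t r \<cdot> y)"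
      "w = (if \<epsilon> then x \<cdot> t r \<cdot> y else x \<cdot> t l \<cdot> y)"
      using path_ConsE[OF Cons.prems(1)] by metis
    have H: "x \<cdot> t l \<cdot> y \<in> T.H_class e"
      using a(7) Cons.prems(2) H_class_edge[OF a(3,2,4)] by (auto split: if_splits)
    have wH: "w \<in> T.H_class e" using path_H_class a(5) Cons.prems(2) by blast
    have loc: "local_path e [((x, l, r, y), \<epsilon>')]" "local_path e p" for \<epsilon>'
      using Cons.prems(3) a(1) by simp_all
    have fwd: "\<phi> (Sq.cls e (lpath (x \<cdot> t l \<cdot> y)\<^sup>\<star> [((x, l, r, y), True)])) = edge_val e (x, l, r, y)"
      using morphism_forward_edge[OF \<phi> a(3,2,4) H] loc by simp
    have step: "\<phi> (Sq.cls e (lpath u\<^sup>\<star> [a])) = step_val e a"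
    proof (cases \<epsilon>)
      case True
      then show ?thesis using fwd a(7) by (simp add: step_val_def a(1) del: Sq.edge_map_simps)
    next
      case False
      then have u: "u = x \<cdot> t r \<cdot> y" and w: "w = x \<cdot> t l \<cdot> y" using a by simp_all
      let ?E = "(x, l, r, y)"
      have 1: "Sq.path u [(?E, False)] w" "Sq.path w [(?E, True)] u"
        unfolding u w using a(2-4) by simp_all
      \<comment> \<open>A backward edge translated from \<open>u\<close> is inverse to the forward
        edge translated from its own start \<open>w\<close>: their product is the class of an edge
        followed by its reverse.\<close>
      have "Sq.cls e (lpath u\<^sup>\<star> [(?E, False)]) \<otimes>\<^bsub>fib \<S> e\<^esub> Sq.cls e (lpath w\<^sup>\<star> [(?E, True)]) =
          Sq.cls e (lpath u\<^sup>\<star> [(?E, False), (?E, True)])"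
        using ast[OF 1(1) Cons.prems(2) loc(1) 1(2) loc(1)] by simp
      also have "\<dots> = Sq.cls e ([] @ [])"
      proof -
        have "Sq.path e [] e" using e by simp
        have "Sq.path e [(lmul u\<^sup>\<star> ?E, False)] (u\<^sup>\<star> \<cdot> w)"
          using to_star(1)[OF 1(1) Cons.prems(2) loc(1)] by (simp only: Sq.edge_map_simps)
        from Sq.cls_cancel[OF \<open>Sq.path e [] e\<close> this \<open>Sq.path e [] e\<close>] show ?thesis by simp
      qed
      finally have 2: "Sq.cls e (lpath u\<^sup>\<star> [(?E, False)]) \<otimes>\<^bsub>fib \<S> e\<^esub> Sq.cls e (lpath w\<^sup>\<star> [(?E, True)]) =
          \<one>\<^bsub>fib \<S> e\<^esub>" by simp
      note c = to_star(3)[OF 1(1) Cons.prems(2) loc(1)] to_star(3)[OF 1(2) wH loc(1)]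
      have "\<phi> (Sq.cls e (lpath u\<^sup>\<star> [(?E, False)])) = inv\<^bsub>fib D e\<^esub> \<phi> (Sq.cls e (lpath w\<^sup>\<star> [(?E, True)]))"
        using G.inv_equality[OF 2 c(2,1)] hom_inv[OF c(2)] by simp
      then show ?thesis using fwd False w by (simp add: step_val_def a(1) del: Sq.edge_map_simps)
    qed
    have la: "local_path e [a]" using loc a(1) by simp
    have "\<phi> (Sq.cls e (lpath u\<^sup>\<star> (a # p))) =
        \<phi> (Sq.cls e (lpath u\<^sup>\<star> [a]) \<otimes>\<^bsub>fib \<S> e\<^esub> Sq.cls e (lpath w\<^sup>\<star> p))"
      using ast[OF a(5) Cons.prems(2) la a(6) loc(2)] by simp
    also have "\<dots> = \<phi> (Sq.cls e (lpath u\<^sup>\<star> [a])) \<odot>\<^bsub>e\<^esub> \<phi> (Sq.cls e (lpath w\<^sup>\<star> p))"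
      by (rule hom_mult[OF to_star(3)[OF a(5) Cons.prems(2) la] to_star(3)[OF a(6) wH loc(2)]])
    also have "\<dots> = path_val e (a # p)" using step Cons.IH[OF a(6) wH loc(2)] by simp
    finally show ?case .
  qed
qed

lemma morphism_unique:
  assumes \<phi>: "xmod_morphism \<G> \<S> D \<phi>" "\<And>b. b \<in> basis_set X \<R> \<Longrightarrow> \<phi> (basis_elt b) = \<sigma> b"
    and "\<alpha> \<in> total_set \<G> \<S>"
  shows "\<phi> \<alpha> = induced \<alpha>"
proof -
  obtain e where e: "e \<in> idems T" "\<alpha> \<in> star_bowtie X \<R> e" using assms(3) by (auto simp: total_set_def)
  then obtain p v where p: "\<alpha> = Sq.cls e p" "Sq.path e p v" "local_path e p"
    using star_bowtieE by metis
  have "\<phi> (Sq.cls e (lpath e\<^sup>\<star> p)) = path_val e p"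
    using morphism_unique_path[OF \<phi> e(1) p(2) T.H_class_self[OF e(1)] p(3)] .
  then show ?thesis using induced_cls[OF p(2) e(1)] p(1) e(1) local_path_fixed[OF p(3)] by simp
qed

end

text \<open>The element type of the test module is left arbitrary, so that freeness can be used at
  every type that occurs in the comparison with another free module.\<close>

lemma (in presentation) S_bowtie_free:
  "free_crossed_module TYPE('d) \<G> (basis_set X \<R>) (basis_map X \<R>) \<S> basis_elt"
  unfolding free_crossed_module_def
proof (intro conjI allI impI)
  show "crossed_module \<G> \<S>" by (rule S_bowtie_crossed_module)
  show "\<forall>b\<in>basis_set X \<R>. basis_elt b \<in> total_set \<G> \<S> \<and> bd \<S> (basis_elt b) = basis_map X \<R> b"
    using basis_elt by blast
  fix D :: "('x T_elt, 'x T_elt, 'd) xmod_data" and \<sigma>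
  assume "crossed_module \<G> D"
    and "\<forall>b\<in>basis_set X \<R>. \<sigma> b \<in> total_set \<G> D \<and> bd D (\<sigma> b) = basis_map X \<R> b"
  then interpret free_target X \<R> D \<sigma>
    by (intro free_target.intro presentation_axioms free_target_axioms.intro) auto
  show "\<exists>\<phi>. xmod_morphism \<G> \<S> D \<phi> \<and> (\<forall>b\<in>basis_set X \<R>. \<phi> (basis_elt b) = \<sigma> b) \<and>
      (\<forall>\<phi>'. xmod_morphism \<G> \<S> D \<phi>' \<and> (\<forall>b\<in>basis_set X \<R>. \<phi>' (basis_elt b) = \<sigma> b) \<longrightarrow>
        (\<forall>\<alpha>\<in>total_set \<G> \<S>. \<phi>' \<alpha> = \<phi> \<alpha>))"
    by (intro exI[of _ induced]) (use induced_morphism induced_basis morphism_unique in blast)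
qed

section \<open>Uniqueness of free crossed modules\<close>

lemma xmod_morphism_fib:
  "\<lbrakk>xmod_morphism G C D \<phi>; e \<in> objs G; c \<in> carrier (fib C e)\<rbrakk> \<Longrightarrow> \<phi> c \<in> carrier (fib D e)"
  by (auto simp: xmod_morphism_def hom_def)

lemma xmod_morphism_total:
  "\<lbrakk>xmod_morphism G C D \<phi>; c \<in> total_set G C\<rbrakk> \<Longrightarrow> \<phi> c \<in> total_set G D"
proof -
  assume \<phi>: "xmod_morphism G C D \<phi>" and "c \<in> total_set G C"
  then obtain e where e: "e \<in> objs G" "c \<in> carrier (fib C e)" by (auto simp: total_set_def)
  from xmod_morphism_fib[OF \<phi> e] e(1) show ?thesis by (auto simp: total_set_def)
qed

lemma xmod_morphism_id: "xmod_morphism G C C (\<lambda>c. c)"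
  by (auto simp: xmod_morphism_def hom_def)

lemma xmod_morphism_comp:
  assumes "crossed_module G C" "xmod_morphism G C D \<phi>" "xmod_morphism G D E \<psi>"
  shows "xmod_morphism G C E (\<lambda>c. \<psi> (\<phi> c))"
proof -
  interpret crossed_module G C by fact
  show ?thesis unfolding xmod_morphism_def
  proof (intro conjI ballI)
    fix e assume "e \<in> objs G"
    then have "\<phi> \<in> hom (fib C e) (fib D e)" "\<psi> \<in> hom (fib D e) (fib E e)"
      using assms(2,3) by (auto simp: xmod_morphism_def)
    from Group.hom_compose[OF this] show "(\<lambda>c. \<psi> (\<phi> c)) \<in> hom (fib C e) (fib E e)"
      by (simp add: comp_def)
  next
    fix g c assume "g \<in> arrs G" "c \<in> carrier (fib C (gdom G g))"
    then show "\<psi> (\<phi> (act C c g)) = act E (\<psi> (\<phi> c)) g"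
      using assms(2,3) xmod_morphism_fib[OF assms(2) dom_in] by (simp add: xmod_morphism_def)
  next
    fix c assume "c \<in> total_set G C"
    then show "bd C c = bd E (\<psi> (\<phi> c))"
      using assms(2,3) xmod_morphism_total[OF assms(2)] by (simp add: xmod_morphism_def)
  qed
qed

lemma free_crossed_module_extend:
  fixes C :: "('v, 'g, 'c) xmod_data" and D :: "('v, 'g, 'd) xmod_data"
  assumes "free_crossed_module TYPE('d) G S \<omega> C \<nu>" "crossed_module G D"
    "\<forall>s \<in> S. \<sigma> s \<in> total_set G D \<and> bd D (\<sigma> s) = \<omega> s"
  shows "\<exists>\<phi>. xmod_morphism G C D \<phi> \<and> (\<forall>s \<in> S. \<phi> (\<nu> s) = \<sigma> s) \<and>
     (\<forall>\<phi>'. xmod_morphism G C D \<phi>' \<and> (\<forall>s \<in> S. \<phi>' (\<nu> s) = \<sigma> s) \<longrightarrow>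
        (\<forall>c \<in> total_set G C. \<phi>' c = \<phi> c))"
  by (rule assms(1)[unfolded free_crossed_module_def, THEN conjunct2, THEN conjunct2,
        THEN spec, THEN spec, THEN mp, THEN mp, OF assms(2,3)])

text \<open>Both \<open>\<phi>\<close> and the identity extend \<open>\<nu>\<close>, so the
  universal property with target \<open>C\<close> itself forces them to agree.\<close>

lemma free_crossed_module_endo:
  fixes C :: "('v, 'g, 'c) xmod_data"
  assumes "free_crossed_module TYPE('c) G S \<omega> C \<nu>" "xmod_morphism G C C \<phi>"
    "\<And>s. s \<in> S \<Longrightarrow> \<phi> (\<nu> s) = \<nu> s" "c \<in> total_set G C"
  shows "\<phi> c = c"
proof -
  have "\<exists>\<psi>. xmod_morphism G C C \<psi> \<and> (\<forall>s \<in> S. \<psi> (\<nu> s) = \<nu> s) \<and>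
      (\<forall>\<phi>'. xmod_morphism G C C \<phi>' \<and> (\<forall>s \<in> S. \<phi>' (\<nu> s) = \<nu> s) \<longrightarrow>
        (\<forall>c \<in> total_set G C. \<phi>' c = \<psi> c))"
    using assms(1)
    by (intro free_crossed_module_extend[OF assms(1)]) (simp_all add: free_crossed_module_def)
  then obtain \<psi> where "\<And>\<phi>'. xmod_morphism G C C \<phi>' \<Longrightarrow> (\<forall>s \<in> S. \<phi>' (\<nu> s) = \<nu> s) \<Longrightarrow> \<phi>' c = \<psi> c"
    using assms(4) by blast
  from this[OF assms(2)] this[OF xmod_morphism_id] assms(3) show ?thesis by simp
qed

text \<open>Each module is tested against the element type of the other to obtain the comparison
  maps, and against its own to see that their composites are identities.\<close>

lemma free_crossed_module_isomorphic:
  fixes C :: "('v, 'g, 'c) xmod_data" and D :: "('v, 'g, 'd) xmod_data"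
  assumes C: "free_crossed_module TYPE('c) G S \<omega> C \<nu>" "free_crossed_module TYPE('d) G S \<omega> C \<nu>"
    and D: "free_crossed_module TYPE('d) G S \<omega> D \<mu>" "free_crossed_module TYPE('c) G S \<omega> D \<mu>"
  shows "xmod_isomorphic G C D"
proof -
  have xm: "crossed_module G C" "crossed_module G D"
    and \<nu>: "\<forall>s\<in>S. \<nu> s \<in> total_set G C \<and> bd C (\<nu> s) = \<omega> s"
    and \<mu>: "\<forall>s\<in>S. \<mu> s \<in> total_set G D \<and> bd D (\<mu> s) = \<omega> s"
    using C(1) D(1) unfolding free_crossed_module_def by blast+
  obtain \<phi> where \<phi>: "xmod_morphism G C D \<phi>" "\<And>s. s \<in> S \<Longrightarrow> \<phi> (\<nu> s) = \<mu> s"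
    using free_crossed_module_extend[OF C(2) xm(2) \<mu>] by blast
  obtain \<psi> where \<psi>: "xmod_morphism G D C \<psi>" "\<And>s. s \<in> S \<Longrightarrow> \<psi> (\<mu> s) = \<nu> s"
    using free_crossed_module_extend[OF D(2) xm(1) \<nu>] by blast
  have 1: "\<psi> (\<phi> c) = c" if "c \<in> total_set G C" for c
    using free_crossed_module_endo[OF C(1) xmod_morphism_comp[OF xm(1) \<phi>(1) \<psi>(1)] _ that] \<phi>(2) \<psi>(2) by simp
  have 2: "\<phi> (\<psi> d) = d" if "d \<in> total_set G D" for d
    using free_crossed_module_endo[OF D(1) xmod_morphism_comp[OF xm(2) \<psi>(1) \<phi>(1)] _ that] \<phi>(2) \<psi>(2) by simp
  have "bij_betw \<phi> (carrier (fib C e)) (carrier (fib D e))" if "e \<in> objs G" for e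
    by (rule bij_betw_byWitness[where f' = \<psi>])
      (use that 1 2 xmod_morphism_fib[OF \<phi>(1)] xmod_morphism_fib[OF \<psi>(1)] in \<open>auto simp: total_set_def\<close>)
  then show ?thesis using \<phi>(1) unfolding xmod_isomorphic_def by blast
qed

lemma xmod_isomorphic_refl: "xmod_isomorphic G C C"
  unfolding xmod_isomorphic_def by (intro exI[of _ "\<lambda>c. c"]) (auto simp: xmod_morphism_id bij_betw_def)

theorem theorem4p7:
  fixes X :: "'x set" and \<R> :: "('x word \<times> 'x word) set"
  assumes "\<R> \<subseteq> words X \<times> words X"
  shows "crossed_module (T_groupoid X \<R>) (S_bowtie X \<R>) \<and>
    (\<exists>(C :: ('x T_elt, 'x T_elt, 'x sq_arr) xmod_data) \<nu>.
       free_crossed_module TYPE('d) (T_groupoid X \<R>) (basis_set X \<R>) (basis_map X \<R>) C \<nu> \<and>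
       xmod_isomorphic (T_groupoid X \<R>) (S_bowtie X \<R>) C) \<and>
    (\<forall>(C :: ('x T_elt, 'x T_elt, 'c) xmod_data) \<nu>.
       free_crossed_module TYPE('c) (T_groupoid X \<R>) (basis_set X \<R>) (basis_map X \<R>) C \<nu> \<and>
       free_crossed_module TYPE('x sq_arr) (T_groupoid X \<R>) (basis_set X \<R>) (basis_map X \<R>) C \<nu> \<longrightarrow>
       xmod_isomorphic (T_groupoid X \<R>) (S_bowtie X \<R>) C)"
proof -
  interpret presentation X \<R> using assms by unfold_locales
  show ?thesis
    \<comment> \<open>The module \<open>S_bowtie\<close> itself witnesses existence. For the
      comparison with any other free module, \<open>S_bowtie_free\<close> is taken at both element
      types.\<close>
    using S_bowtie_crossed_module S_bowtie_free xmod_isomorphic_refl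
      free_crossed_module_isomorphic[OF S_bowtie_free S_bowtie_free] by blast
qed

end
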